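(* Suppose $\sigma$ is a section of $\mathcal E$ for which $|\sigma|^2\colon M\to\mathbb R$ is a non-constant harmonic function. Then for each $p\in\mathbb R$ there exists at most one $q\in\mathbb R$ such that $\sigma$ is a $(p,q)$-harmonic section of $\mathcal E$. Moreover, if $\sigma$ is a $(p,q)$-harmonic section of $\mathcal E$, then: (a) if $p<0$ and $q\le 4p$ then $|\sigma(x)|^2>-2/q$ for some $x\in M$; (b) if $0\le p\le 1$ then $q<0$ and $|\sigma(x)|^2>-2/q$ for some $x\in M$; (c) if $p>1$ and $q<2(1-p)$ then $|\sigma(x)|^2>-2/q$ for some $x\in M$; (d) if $p>1$ and $q\ge 2(1-p)$ then $|\sigma(x)|^2>1/(p-1)$ for some $x\in M$.
   Context: Setting: $(M,g)$ is a smooth, oriented, connected Riemannian manifold without boundary (not necessarily compact), and $\pi\colon\mathcal E\to M$ is a smooth oriented real vector bundle with a fibre metric $\langle\,,\rangle$ and a connection $\nabla$ for which the fibre metric is holonomy-invariant, i.e. $\nabla\langle\,,\rangle=0$. All sections are smooth. For a section $\sigma$, put $F=\tfrac12|\sigma|^2\colon M\to\mathbb R$, let $\nabla F$ be its gradient, and $|\nabla\sigma|^2=\sum_i|\nabla_{E_i}\sigma|^2$ for a local orthonormal tangent frame $\{E_i\}$. For $p,q\in\mathbb R$ define a symmetric 2-tensor on the total space $\mathcal E$ by $h_{p,q}(A,B)=g(d\pi(A),d\pi(B))+(1+|e|^2)^{-p}\big(\langle KA,KB\rangle+q\langle KA,e\rangle\langle KB,e\rangle\big)$ for $A,B\in T_e\mathcal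 E$, where $K\colon T\mathcal E\to\mathcal E$ is the connection map of $\nabla$. The vertical $(p,q)$-energy of $\sigma$ (half the integral of the $h_{p,q}$-square norm of the vertical part of $d\sigma$) is $$E^v_{p,q}(\sigma)=\frac12\int_M\frac{1}{(1+|\sigma|^2)^p}\big(|\nabla\sigma|^2+q|\nabla F|^2\big)\,\mathrm{vol}(g)$$ if $M$ is compact; if $M$ is non-compact the integral is taken over relatively compact domains. $\sigma$ is a $(p,q)$-harmonic section of $\mathcal E$ if $\frac{d}{dt}\big|_{t=0}E^v_{p,q}(\sigma_t)=0$ for every smooth variation $\sigma_t$ of $\sigma_0=\sigma$ through sections of $\mathcal E$ (for non-compact $M$: every variation that equals $\sigma$ outside a compact set independent of $t$, the energy being taken over a relatively compact domain containing that set). *)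

theory Defs
  imports "HOL-Analysis.Analysis"
begin

section \<open>Smooth maps between Euclidean spaces\<close>

text \<open>These are meant for open sets \<open>S\<close>: all derivatives are taken \<open>at x\<close>, not within \<open>S\<close>.\<close>

primrec Ck_on :: "nat \<Rightarrow> 'a::euclidean_space set \<Rightarrow> ('a \<Rightarrow> 'b::real_normed_vector) \<Rightarrow> bool" where
  "Ck_on 0 S f \<longleftrightarrow> continuous_on S f"
| "Ck_on (Suc k) S f \<longleftrightarrow>
     (\<forall>x\<in>S. f differentiable (at x)) \<and> (\<forall>v. Ck_on k S (\<lambda>x. frechet_derivative f (at x) v))"

definition smooth_on :: "'a::euclidean_space set \<Rightarrow> ('a \<Rightarrow> 'b::real_normed_vector) \<Rightarrow> bool" where
  "smooth_on S f \<longleftrightarrow> (\<forall>k. Ck_on k S f)"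

section \<open>Oriented smooth manifolds\<close>

text \<open>
  The manifold is a whole type \<open>'m\<close>, with a (not necessarily maximal) oriented atlas of charts
  with values in \<open>real ^ 'n\<close>. A chart is its domain together with the coordinate map; values of
  the coordinate map outside the domain are irrelevant. Dimension and rank 0 are thereby excluded;
  there every section of a bundle over a connected manifold has constant norm.
\<close>

type_synonym ('m, 'n) chart = "'m set \<times> ('m \<Rightarrow> real ^ 'n)"

abbreviation cdom :: "('m, 'n) chart \<Rightarrow> 'm set" where "cdom c \<equiv> fst c"
abbreviation cmap :: "('m, 'n) chart \<Rightarrow> 'm \<Rightarrow> real ^ 'n" where "cmap c \<equiv> snd c"
abbreviation cinv :: "('m, 'n) chart \<Rightarrow> real ^ 'n \<Rightarrow> 'm" where
  "cinv c \<equiv> inv_into (cdom c) (cmap c)"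

definition transition_deriv ::
    "('m, 'n::finite) chart \<Rightarrow> ('m, 'n) chart \<Rightarrow> 'm \<Rightarrow> real ^ 'n \<Rightarrow> real ^ 'n" where
  "transition_deriv c c' x = frechet_derivative (cmap c' \<circ> cinv c) (at (cmap c x))"

definition oriented_atlas ::
    "('m::{t2_space, second_countable_topology}, 'n::finite) chart set \<Rightarrow> bool" where
  "oriented_atlas A \<longleftrightarrow>
     (\<Union>c\<in>A. cdom c) = UNIV \<and>
     (\<forall>c\<in>A. open (cdom c) \<and> open (cmap c ` cdom c) \<and>
            homeomorphism (cdom c) (cmap c ` cdom c) (cmap c) (cinv c)) \<and>
     (\<forall>c\<in>A. \<forall>c'\<in>A.
        smooth_on (cmap c ` (cdom c \<inter> cdom c')) (cmap c' \<circ> cinv c) \<and>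
        (\<forall>x \<in> cdom c \<inter> cdom c'. det (matrix (transition_deriv c c' x)) > 0))"

definition smooth_map_on ::
    "('m, 'n::finite) chart set \<Rightarrow> 'm set \<Rightarrow> ('m \<Rightarrow> 'b::real_normed_vector) \<Rightarrow> bool" where
  "smooth_map_on A W f \<longleftrightarrow> (\<forall>c\<in>A. smooth_on (cmap c ` (cdom c \<inter> W)) (f \<circ> cinv c))"

section \<open>Tangent vectors\<close>

text \<open>
  A tangent vector at \<open>x\<close> is the family of its component vectors in all charts around \<open>x\<close>,
  subject to the usual transformation law; the value at anything else is fixed to be 0, so that
  equality of tangent vectors is equality of functions. The vector space operations are pointwise.
\<close>

type_synonym ('m, 'n) tvec = "('m, 'n) chart \<Rightarrow> real ^ 'n"

definition tangent_space :: "('m, 'n::finite) chart set \<Rightarrow> 'm \<Rightarrow> ('m, 'n) tvec set" where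
  "tangent_space A x =
     {X. (\<forall>c\<in>A. \<forall>c'\<in>A. x \<in> cdom c \<longrightarrow> x \<in> cdom c' \<longrightarrow> X c' = transition_deriv c c' x (X c)) \<and>
         (\<forall>c. \<not> (c \<in> A \<and> x \<in> cdom c) \<longrightarrow> X c = 0)}"

definition tcomb :: "real \<Rightarrow> ('m, 'n::finite) tvec \<Rightarrow> real \<Rightarrow> ('m, 'n) tvec \<Rightarrow> ('m, 'n) tvec" where
  "tcomb a X b Y = (\<lambda>c. a *\<^sub>R X c + b *\<^sub>R Y c)"

definition coord_vec ::
    "('m, 'n::finite) chart set \<Rightarrow> ('m, 'n) chart \<Rightarrow> 'n \<Rightarrow> 'm \<Rightarrow> ('m, 'n) tvec" where
  \<comment> \<open>the \<open>i\<close>-th coordinate vector of the chart \<open>c\<close> at \<open>x\<close>\<close>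
  "coord_vec A c i x =
     (\<lambda>c'. if c' \<in> A \<and> x \<in> cdom c' then transition_deriv c c' x (axis i 1) else 0)"

definition chart_at :: "('m, 'n::finite) chart set \<Rightarrow> 'm \<Rightarrow> ('m, 'n) chart" where
  "chart_at A x = (SOME c. c \<in> A \<and> x \<in> cdom c)"

definition differential ::
    "('m, 'n::finite) chart set \<Rightarrow> ('m \<Rightarrow> real) \<Rightarrow> 'm \<Rightarrow> ('m, 'n) tvec \<Rightarrow> real" where
  \<comment> \<open>by the chain rule and the transformation law, independent of the chosen chart\<close>
  "differential A f x X =
     (let c = chart_at A x in frechet_derivative (f \<circ> cinv c) (at (cmap c x)) (X c))"

section \<open>Riemannian metrics\<close>

type_synonym ('m, 'n) metric = "'m \<Rightarrow> ('m, 'n) tvec \<Rightarrow> ('m, 'n) tvec \<Rightarrow> real"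

definition riemannian_metric ::
    "('m::{t2_space, second_countable_topology}, 'n::finite) chart set \<Rightarrow> ('m, 'n) metric \<Rightarrow> bool"
where
  "riemannian_metric A g \<longleftrightarrow>
     (\<forall>x. \<forall>X\<in>tangent_space A x. \<forall>Y\<in>tangent_space A x.
        g x X Y = g x Y X \<and>
        (X \<noteq> (\<lambda>c. 0) \<longrightarrow> g x X X > 0) \<and>
        (\<forall>Z\<in>tangent_space A x. \<forall>a b. g x (tcomb a X b Y) Z = a * g x X Z + b * g x Y Z)) \<and>
     (\<forall>c\<in>A. \<forall>i j. smooth_map_on A (cdom c) (\<lambda>x. g x (coord_vec A c i x) (coord_vec A c j x)))"

definition gradient ::
    "('m, 'n::finite) chart set \<Rightarrow> ('m, 'n) metric \<Rightarrow> ('m \<Rightarrow> real) \<Rightarrow> 'm \<Rightarrow> ('m, 'n) tvec" where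
  "gradient A g f x =
     (THE V. V \<in> tangent_space A x \<and> (\<forall>X\<in>tangent_space A x. g x V X = differential A f x X))"

definition sqrt_det_metric ::
    "('m, 'n::finite) chart set \<Rightarrow> ('m, 'n) metric \<Rightarrow> ('m, 'n) chart \<Rightarrow> 'm \<Rightarrow> real" where
  "sqrt_det_metric A g c x = sqrt (det (\<chi> i j. g x (coord_vec A c i x) (coord_vec A c j x)))"

definition divergence_in ::
    "('m, 'n::finite) chart set \<Rightarrow> ('m, 'n) metric \<Rightarrow> ('m, 'n) chart \<Rightarrow> ('m \<Rightarrow> ('m, 'n) tvec) \<Rightarrow> 'm \<Rightarrow> real"
where
  \<comment> \<open>the coordinate formula in the chart \<open>c\<close>; the value does not depend on \<open>c\<close>\<close>
  "divergence_in A g c X x =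
     (\<Sum>i\<in>UNIV. frechet_derivative
        (\<lambda>y. sqrt_det_metric A g c (cinv c y) * (X (cinv c y) c $ i)) (at (cmap c x)) (axis i 1))
     / sqrt_det_metric A g c x"

definition laplacian_in ::
    "('m, 'n::finite) chart set \<Rightarrow> ('m, 'n) metric \<Rightarrow> ('m, 'n) chart \<Rightarrow> ('m \<Rightarrow> real) \<Rightarrow> 'm \<Rightarrow> real" where
  "laplacian_in A g c u = divergence_in A g c (gradient A g u)"

definition harmonic_function ::
    "('m, 'n::finite) chart set \<Rightarrow> ('m, 'n) metric \<Rightarrow> ('m \<Rightarrow> real) \<Rightarrow> bool" where
  "harmonic_function A g u \<longleftrightarrow>
     smooth_map_on A UNIV u \<and> (\<forall>c\<in>A. \<forall>x\<in>cdom c. laplacian_in A g c u x = 0)"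

text \<open>
  The Riemannian measure \<open>vol(g)\<close>. The formula for Borel sets contained in a chart domain
  determines the measure, because countably many chart domains cover the manifold.
\<close>

definition riemannian_measure ::
    "('m::{t2_space, second_countable_topology}, 'n::finite) chart set \<Rightarrow> ('m, 'n) metric
      \<Rightarrow> 'm measure \<Rightarrow> bool" where
  "riemannian_measure A g vol \<longleftrightarrow>
     sets vol = sets borel \<and>
     (\<forall>c\<in>A. \<forall>B\<in>sets borel. B \<subseteq> cdom c \<longrightarrow>
        emeasure vol B =
          (\<integral>\<^sup>+y. ennreal (sqrt_det_metric A g c (cinv c y)) * indicator (cmap c ` B) y \<partial>lborel))"

section \<open>Oriented vector bundles with fibre metric and connection\<close>

text \<open>
  The fibre over \<open>x\<close> is a linear subspace \<open>E x\<close> of one real vector space \<open>'v\<close> which is independent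
  of \<open>x\<close> and carries no topology. This is no restriction (for \<open>'v\<close> one can take the direct sum
  of all fibres). The total space is the disjoint union of the fibres, and its smooth structure is
  given by the atlas \<open>T\<close> of fibrewise linear local trivialisations \<open>(W, \<tau>)\<close>, where
  \<open>\<tau> x\<close> maps \<open>E x\<close> isomorphically to \<open>real ^ 'k\<close> for \<open>x \<in> W\<close>.
\<close>

type_synonym ('m, 'v, 'k) triv = "'m set \<times> ('m \<Rightarrow> 'v \<Rightarrow> real ^ 'k)"

definition oriented_vector_bundle ::
    "('m::{t2_space, second_countable_topology}, 'n::finite) chart set \<Rightarrow>
     ('m \<Rightarrow> 'v::real_vector set) \<Rightarrow> ('m, 'v, 'k::finite) triv set \<Rightarrow> bool" where
  "oriented_vector_bundle A E T \<longleftrightarrow>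
     (\<forall>x. subspace (E x)) \<and>
     (\<Union>(W, \<tau>)\<in>T. W) = UNIV \<and>
     (\<forall>(W, \<tau>)\<in>T. open W \<and>
        (\<forall>x\<in>W. bij_betw (\<tau> x) (E x) UNIV \<and>
          (\<forall>v\<in>E x. \<forall>w\<in>E x. \<forall>a b. \<tau> x (a *\<^sub>R v + b *\<^sub>R w) = a *\<^sub>R \<tau> x v + b *\<^sub>R \<tau> x w))) \<and>
     (\<forall>(W, \<tau>)\<in>T. \<forall>(W', \<tau>')\<in>T.
        smooth_map_on A (W \<inter> W') (\<lambda>x. matrix (\<lambda>z. \<tau>' x (inv_into (E x) (\<tau> x) z))) \<and>
        (\<forall>x \<in> W \<inter> W'. det (matrix (\<lambda>z. \<tau>' x (inv_into (E x) (\<tau> x) z))) > 0))"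

definition smooth_section ::
    "('m, 'n::finite) chart set \<Rightarrow> ('m \<Rightarrow> 'v::real_vector set) \<Rightarrow> ('m, 'v, 'k::finite) triv set \<Rightarrow>
     ('m \<Rightarrow> 'v) \<Rightarrow> bool" where
  "smooth_section A E T s \<longleftrightarrow>
     (\<forall>x. s x \<in> E x) \<and> (\<forall>(W, \<tau>)\<in>T. smooth_map_on A W (\<lambda>x. \<tau> x (s x)))"

definition fibre_metric ::
    "('m, 'n::finite) chart set \<Rightarrow> ('m \<Rightarrow> 'v::real_vector set) \<Rightarrow> ('m, 'v, 'k::finite) triv set \<Rightarrow>
     ('m \<Rightarrow> 'v \<Rightarrow> 'v \<Rightarrow> real) \<Rightarrow> bool" where
  "fibre_metric A E T h \<longleftrightarrow>
     (\<forall>x. \<forall>v\<in>E x. \<forall>w\<in>E x.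
        h x v w = h x w v \<and>
        (v \<noteq> 0 \<longrightarrow> h x v v > 0) \<and>
        (\<forall>u\<in>E x. \<forall>a b. h x (a *\<^sub>R v + b *\<^sub>R w) u = a * h x v u + b * h x w u)) \<and>
     (\<forall>(W, \<tau>)\<in>T. \<forall>i j. smooth_map_on A W
        (\<lambda>x. h x (inv_into (E x) (\<tau> x) (axis i 1)) (inv_into (E x) (\<tau> x) (axis j 1))))"

text \<open>
  \<open>nabla s x X\<close> is the covariant derivative at \<open>x\<close> of the section \<open>s\<close> in the direction of the
  tangent vector \<open>X\<close> at \<open>x\<close>. The last conjunct says that \<open>nabla s\<close> is a smooth bundle-valued 1-form.
\<close>

type_synonym ('m, 'n, 'v) conn = "('m \<Rightarrow> 'v) \<Rightarrow> 'm \<Rightarrow> ('m, 'n) tvec \<Rightarrow> 'v"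

definition connection ::
    "('m, 'n::finite) chart set \<Rightarrow> ('m \<Rightarrow> 'v::real_vector set) \<Rightarrow> ('m, 'v, 'k::finite) triv set \<Rightarrow>
     ('m, 'n, 'v) conn \<Rightarrow> bool" where
  "connection A E T nabla \<longleftrightarrow>
     (\<forall>s. smooth_section A E T s \<longrightarrow>
        (\<forall>x. \<forall>X\<in>tangent_space A x.
           nabla s x X \<in> E x \<and>
           (\<forall>Y\<in>tangent_space A x. \<forall>a b.
              nabla s x (tcomb a X b Y) = a *\<^sub>R nabla s x X + b *\<^sub>R nabla s x Y) \<and>
           (\<forall>s'. smooth_section A E T s' \<longrightarrow>
              nabla (\<lambda>y. s y + s' y) x X = nabla s x X + nabla s' x X) \<and>
           (\<forall>f. smooth_map_on A UNIV f \<longrightarrow>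
              nabla (\<lambda>y. f y *\<^sub>R s y) x X = differential A f x X *\<^sub>R s x + f x *\<^sub>R nabla s x X)) \<and>
        (\<forall>c\<in>A. \<forall>(W, \<tau>)\<in>T. \<forall>i.
           smooth_map_on A (cdom c \<inter> W) (\<lambda>x. \<tau> x (nabla s x (coord_vec A c i x)))))"

definition metric_compatible ::
    "('m, 'n::finite) chart set \<Rightarrow> ('m \<Rightarrow> 'v::real_vector set) \<Rightarrow> ('m, 'v, 'k::finite) triv set \<Rightarrow>
     ('m \<Rightarrow> 'v \<Rightarrow> 'v \<Rightarrow> real) \<Rightarrow> ('m, 'n, 'v) conn \<Rightarrow> bool" where
  "metric_compatible A E T h nabla \<longleftrightarrow>
     (\<forall>s s'. smooth_section A E T s \<longrightarrow> smooth_section A E T s' \<longrightarrow>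
        (\<forall>x. \<forall>X\<in>tangent_space A x.
           differential A (\<lambda>y. h y (s y) (s' y)) x X
             = h x (nabla s x X) (s' x) + h x (s x) (nabla s' x X)))"

section \<open>Vertical energy and harmonic sections\<close>

definition sq_norm :: "('m \<Rightarrow> 'v \<Rightarrow> 'v \<Rightarrow> real) \<Rightarrow> ('m \<Rightarrow> 'v) \<Rightarrow> 'm \<Rightarrow> real" where
  "sq_norm h s x = h x (s x) (s x)"

definition orthonormal_frame ::
    "('m, 'n::finite) chart set \<Rightarrow> ('m, 'n) metric \<Rightarrow> 'm \<Rightarrow> ('n \<Rightarrow> ('m, 'n) tvec) \<Rightarrow> bool" where
  "orthonormal_frame A g x e \<longleftrightarrow>
     (\<forall>i. e i \<in> tangent_space A x) \<and> (\<forall>i j. g x (e i) (e j) = (if i = j then 1 else 0))"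

definition sq_norm_nabla ::
    "('m, 'n::finite) chart set \<Rightarrow> ('m, 'n) metric \<Rightarrow> ('m \<Rightarrow> 'v \<Rightarrow> 'v \<Rightarrow> real) \<Rightarrow> ('m, 'n, 'v) conn \<Rightarrow>
     ('m \<Rightarrow> 'v) \<Rightarrow> 'm \<Rightarrow> real" where
  \<comment> \<open>independent of the choice of the orthonormal frame\<close>
  "sq_norm_nabla A g h nabla s x =
     (let e = (SOME e. orthonormal_frame A g x e)
      in \<Sum>i\<in>UNIV. h x (nabla s x (e i)) (nabla s x (e i)))"

definition sq_norm_grad ::
    "('m, 'n::finite) chart set \<Rightarrow> ('m, 'n) metric \<Rightarrow> ('m \<Rightarrow> real) \<Rightarrow> 'm \<Rightarrow> real" where
  "sq_norm_grad A g f x = g x (gradient A g f x) (gradient A g f x)"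

definition vertical_energy ::
    "('m::topological_space, 'n::finite) chart set \<Rightarrow> ('m, 'n) metric \<Rightarrow> 'm measure \<Rightarrow>
     ('m \<Rightarrow> 'v \<Rightarrow> 'v \<Rightarrow> real) \<Rightarrow> ('m, 'n, 'v) conn \<Rightarrow> real \<Rightarrow> real \<Rightarrow> 'm set \<Rightarrow> ('m \<Rightarrow> 'v) \<Rightarrow> real" where
  "vertical_energy A g vol h nabla p q D s =
     1/2 * (LINT x:D|vol.
        1 / ((1 + sq_norm h s x) powr p) *
        (sq_norm_nabla A g h nabla s x
          + q * sq_norm_grad A g (\<lambda>y. 1/2 * sq_norm h s y) x))"

text \<open>Smooth variations of \<open>s\<close> through sections, with parameter \<open>t\<close> in some interval around 0.\<close>

definition smooth_variation ::
    "('m, 'n::finite) chart set \<Rightarrow> ('m \<Rightarrow> 'v::real_vector set) \<Rightarrow> ('m, 'v, 'k::finite) triv set \<Rightarrow>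
     ('m \<Rightarrow> 'v) \<Rightarrow> real \<Rightarrow> (real \<Rightarrow> 'm \<Rightarrow> 'v) \<Rightarrow> bool" where
  "smooth_variation A E T s \<epsilon> S \<longleftrightarrow>
     \<epsilon> > 0 \<and> S 0 = s \<and>
     (\<forall>t\<in>{-\<epsilon><..<\<epsilon>}. \<forall>x. S t x \<in> E x) \<and>
     (\<forall>c\<in>A. \<forall>(W, \<tau>)\<in>T.
        smooth_on ({-\<epsilon><..<\<epsilon>} \<times> cmap c ` (cdom c \<inter> W))
                  (\<lambda>(t, y). \<tau> (cinv c y) (S t (cinv c y))))"

text \<open>
  For compact \<open>M\<close> the variation is arbitrary and the energy is taken over \<open>M\<close>; otherwise the
  variation has compact support \<open>C\<close> and the energy is taken over a relatively compact domain
  (connected open set with compact closure) containing \<open>C\<close>.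
\<close>

definition harmonic_section ::
    "('m::{t2_space, second_countable_topology}, 'n::finite) chart set \<Rightarrow> ('m, 'n) metric \<Rightarrow>
     'm measure \<Rightarrow> ('m \<Rightarrow> 'v::real_vector set) \<Rightarrow> ('m, 'v, 'k::finite) triv set \<Rightarrow>
     ('m \<Rightarrow> 'v \<Rightarrow> 'v \<Rightarrow> real) \<Rightarrow> ('m, 'n, 'v) conn \<Rightarrow> real \<Rightarrow> real \<Rightarrow> ('m \<Rightarrow> 'v) \<Rightarrow> bool" where
  "harmonic_section A g vol E T h nabla p q s \<longleftrightarrow>
     smooth_section A E T s \<and>
     (if compact (UNIV :: 'm set)
      then \<forall>\<epsilon> S. smooth_variation A E T s \<epsilon> S \<longrightarrow>
             ((\<lambda>t. vertical_energy A g vol h nabla p q UNIV (S t)) has_real_derivative 0) (at 0)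
      else \<forall>\<epsilon> S C D. smooth_variation A E T s \<epsilon> S \<longrightarrow>
             compact C \<longrightarrow> (\<forall>t\<in>{-\<epsilon><..<\<epsilon>}. \<forall>x. x \<notin> C \<longrightarrow> S t x = s x) \<longrightarrow>
             open D \<longrightarrow> connected D \<longrightarrow> compact (closure D) \<longrightarrow> C \<subseteq> D \<longrightarrow>
             ((\<lambda>t. vertical_energy A g vol h nabla p q D (S t)) has_real_derivative 0) (at 0))"

end

(*
  The section is varied radially, sigma_t = (1 + t phi) sigma, with a bump function phi supported in
  a chart. Since u = |sigma|^2 is harmonic, an integration by parts removes the derivatives of phi
  from the first variation, and localising phi gives the pointwise identity

    2 |nabla sigma|^2 (1 + (1 - p) u) + p |grad u|^2 (1 + q u / 2) = 0.

  At a point with grad u <> 0 one has 0 < |grad u|^2 <= 4 u |nabla sigma|^2 by metric compatibility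
  and Cauchy-Schwarz. There the identity excludes p = 0 and determines q, and comparing signs gives (b)
  and (c); in (a) the identity is incompatible with 1 + q u / 2 >= 0 by a discriminant estimate. In (d), if u <= 1/(p-1)
  everywhere, then equality holds at that point, so u has a maximum there and grad u = 0.
*)

theory Submission imports Defs begin

section \<open>Calculus of smooth maps\<close>

text \<open>In the first variation the coefficient of <grad phi, grad u> is psi(u) with psi(t) = (1
  + t)^(-p) (1 + q t), a function of u alone. Since u is harmonic, div(psi(u) grad u) = psi'(u)
  |grad u|^2, so no second derivatives remain and the result is pointwise.

  The obstacle is that the energy is a global integral, its measure is specified only on chart
  domains, and its norms are defined by arbitrarily chosen frames. Frame sums are therefore
  rewritten with the inverse Gram matrix, which makes them smooth functions of the point. The
  energies of sigma_t and sigma differ only on the image of one coordinate box, so both the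
  derivative in t and the integration by parts take place in Euclidean space.

  The discriminant in (a) is that of 4 t^2 + t + 1 with t = p u: the estimate |grad u|^2 <= 4 u
  |nabla sigma|^2 leads to 1 + u + p u + p q u^2 <= 0, and q <= 4 p < 0 gives p q >= 4 p^2.\<close>

lemma Ck_on_subset: "Ck_on k S f \<Longrightarrow> T \<subseteq> S \<Longrightarrow> Ck_on k T f"
  by (induction k arbitrary: f) (auto intro: continuous_on_subset)

text \<open>\<open>S\<close> has to be open: derivatives are taken at the point, so agreement on
  \<open>S\<close> transfers them only if \<open>S\<close> contains a neighbourhood.\<close>

lemma Ck_on_cong:
  assumes "open S" "\<And>x. x \<in> S \<Longrightarrow> f x = g x" "Ck_on k S f"
  shows "Ck_on k S g"
  using assms(2,3)
proof (induction k arbitrary: f g)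
  case 0
  then show ?case by (simp cong: continuous_on_cong)
next
  case (Suc k)
  have *: "g differentiable (at x)" "frechet_derivative g (at x) = frechet_derivative f (at x)"
    if x: "x \<in> S" for x
  proof -
    have f: "(f has_derivative frechet_derivative f (at x)) (at x)"
      using Suc.prems(2) x by (simp add: frechet_derivative_works)
    then have "(g has_derivative frechet_derivative f (at x)) (at x)"
      using has_derivative_transform_within_open[OF f \<open>open S\<close> x] Suc.prems(1) by simp
    then show "g differentiable (at x)" "frechet_derivative g (at x) = frechet_derivative f (at x)"
      by (auto intro: differentiableI dest: frechet_derivative_at)
  qed
  have "Ck_on k S (\<lambda>x. frechet_derivative g (at x) v)" for v
    by (rule Suc.IH[of "\<lambda>x. frechet_derivative f (at x) v"])
      (use Suc.prems(2) * in auto)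
  then show ?case using *(1) by simp
qed

lemma Ck_on_Suc_imp: "Ck_on (Suc k) S f \<Longrightarrow> Ck_on k S f"
proof (induction k arbitrary: f)
  case 0
  then show ?case
    by (auto intro!: continuous_at_imp_continuous_on differentiable_imp_continuous_within)
next
  case (Suc k)
  then show ?case by (metis Ck_on.simps(2))
qed

text \<open>Derivatives at a point see only a neighbourhood of it, so regular pieces on open sets
  can be glued. Functions defined by cases or by extension by zero are treated this way.\<close>

lemma Ck_on_local:
  assumes "\<And>x. x \<in> S \<Longrightarrow> \<exists>T. open T \<and> x \<in> T \<and> Ck_on k T f"
  shows "Ck_on k S f"
  using assms
proof (induction k arbitrary: f)
  case 0
  have "isCont f x" if "x \<in> S" for x
    using "0"[OF that] by (auto simp: continuous_on_eq_continuous_at)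
  then show ?case by (simp add: continuous_at_imp_continuous_on)
next
  case (Suc k)
  then have "f differentiable (at x)" if "x \<in> S" for x
    using that by fastforce
  moreover have "Ck_on k S (\<lambda>x. frechet_derivative f (at x) v)" for v
    using Suc.prems by (intro Suc.IH) fastforce
  ultimately show ?case by simp
qed

text \<open>Lets an induction on \<open>k\<close> use an explicit derivative formula instead of
  \<open>frechet_derivative\<close>; the sum, product and chain rules pass through it.\<close>

lemma Ck_on_Suc_I:
  assumes "open S" "\<And>x. x \<in> S \<Longrightarrow> (f has_derivative D x) (at x)" "\<And>v. Ck_on k S (\<lambda>x. D x v)"
  shows "Ck_on (Suc k) S f"
proof -
  have "frechet_derivative f (at x) = D x" if "x \<in> S" for x
    using frechet_derivative_at[OF assms(2)[OF that]] by simp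
  then have "Ck_on k S (\<lambda>x. frechet_derivative f (at x) v)" for v
    by (intro Ck_on_cong[OF assms(1) _ assms(3)[of v]]) auto
  then show ?thesis using assms(2) by (auto intro: differentiableI)
qed

lemma Ck_on_Suc_D: "Ck_on (Suc k) S f \<Longrightarrow> x \<in> S \<Longrightarrow> (f has_derivative frechet_derivative f (at x)) (at x)"
  by (simp add: frechet_derivative_works)

lemma Ck_on_const: "open S \<Longrightarrow> Ck_on k S (\<lambda>x. c)"
proof (induction k arbitrary: c)
  case (Suc k)
  then show ?case by (intro Ck_on_Suc_I[where D = "\<lambda>x v. 0"]) auto
qed auto

lemma Ck_on_bounded_linear:
  assumes "open S" "bounded_linear L" "Ck_on k S f"
  shows "Ck_on k S (\<lambda>x. L (f x))"
  using assms(3)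
proof (induction k arbitrary: f)
  case 0
  then show ?case using bounded_linear.continuous_on[OF assms(2)] by auto
next
  case (Suc k)
  show ?case
  proof (rule Ck_on_Suc_I[OF assms(1)])
    show "((\<lambda>x. L (f x)) has_derivative (\<lambda>v. L (frechet_derivative f (at x) v))) (at x)" if "x \<in> S" for x
      by (rule bounded_linear.has_derivative[OF assms(2) Ck_on_Suc_D[OF Suc.prems that]])
    show "Ck_on k S (\<lambda>x. L (frechet_derivative f (at x) v))" for v
      using Suc by auto
  qed
qed

lemma Ck_on_add:
  assumes "open S" "Ck_on k S f" "Ck_on k S g"
  shows "Ck_on k S (\<lambda>x. f x + g x)"
  using assms(2,3)
proof (induction k arbitrary: f g)
  case 0
  then show ?case by (auto intro: continuous_on_add)
next
  case (Suc k)
  show ?case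
  proof (rule Ck_on_Suc_I[OF assms(1)])
    show "((\<lambda>x. f x + g x) has_derivative
        (\<lambda>v. frechet_derivative f (at x) v + frechet_derivative g (at x) v)) (at x)" if "x \<in> S" for x
      by (intro has_derivative_add Ck_on_Suc_D[OF Suc.prems(1) that] Ck_on_Suc_D[OF Suc.prems(2) that])
    show "Ck_on k S (\<lambda>x. frechet_derivative f (at x) v + frechet_derivative g (at x) v)" for v
      using Suc by auto
  qed
qed

lemma Ck_on_sum:
  assumes "open S" "\<And>i. i \<in> I \<Longrightarrow> Ck_on k S (f i)"
  shows "Ck_on k S (\<lambda>x. \<Sum>i\<in>I. f i x)"
  using assms(2)
  by (induction I rule: infinite_finite_induct) (auto intro!: Ck_on_const Ck_on_add assms(1))

lemma Ck_on_bilinear: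
  assumes "open S" "bounded_bilinear b" "Ck_on k S f" "Ck_on k S g"
  shows "Ck_on k S (\<lambda>x. b (f x) (g x))"
  using assms(3,4)
proof (induction k arbitrary: f g)
  case 0
  then show ?case using bounded_bilinear.continuous_on[OF assms(2)] by auto
next
  case (Suc k)
  show ?case
  proof (rule Ck_on_Suc_I[OF assms(1)])
    show "((\<lambda>x. b (f x) (g x)) has_derivative
        (\<lambda>v. b (f x) (frechet_derivative g (at x) v) + b (frechet_derivative f (at x) v) (g x))) (at x)"
      if "x \<in> S" for x
      by (intro bounded_bilinear.FDERIV[OF assms(2)] Ck_on_Suc_D[OF Suc.prems(1) that] Ck_on_Suc_D[OF Suc.prems(2) that])
    show "Ck_on k S (\<lambda>x. b (f x) (frechet_derivative g (at x) v) + b (frechet_derivative f (at x) v) (g x))" for v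
      using Suc.prems Ck_on_Suc_imp[OF Suc.prems(1)] Ck_on_Suc_imp[OF Suc.prems(2)]
      by (intro Ck_on_add assms(1) Suc.IH) auto
  qed
qed

text \<open>The chain rule evaluates the derivative of \<open>f\<close> in a direction that varies
  with \<open>x\<close>, while \<open>Ck_on\<close> speaks of fixed directions only. Expanding the
  direction in \<open>Basis\<close> separates the two dependences.\<close>

lemma Ck_on_compose:
  fixes f :: "'b::euclidean_space \<Rightarrow> 'c::real_normed_vector" and g :: "'a::euclidean_space \<Rightarrow> 'b"
  assumes "open S" "open T" "g ` S \<subseteq> T" "Ck_on k T f" "Ck_on k S g"
  shows "Ck_on k S (\<lambda>x. f (g x))"
  using assms(4,5)
proof (induction k arbitrary: f)
  case 0
  then show ?case using assms(3) by (auto intro: continuous_on_compose2)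
next
  case (Suc k)
  have D: "((\<lambda>x. f (g x)) has_derivative
      (\<lambda>v. \<Sum>b\<in>Basis. (frechet_derivative g (at x) v \<bullet> b) *\<^sub>R frechet_derivative f (at (g x)) b)) (at x)"
    if x: "x \<in> S" for x
  proof -
    have g: "(g has_derivative frechet_derivative g (at x)) (at x)"
      using Ck_on_Suc_D[OF Suc.prems(2) x] .
    have f: "(f has_derivative frechet_derivative f (at (g x))) (at (g x))"
      using Ck_on_Suc_D[OF Suc.prems(1)] x assms(3) by blast
    then have l: "linear (frechet_derivative f (at (g x)))"
      by (rule has_derivative_linear)
    have e: "frechet_derivative f (at (g x)) w = (\<Sum>b\<in>Basis. (w \<bullet> b) *\<^sub>R frechet_derivative f (at (g x)) b)" for w
      by (subst euclidean_representation[symmetric, of w])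
        (simp add: linear_sum[OF l] linear_cmul[OF l] del: euclidean_representation)
    show ?thesis
      using has_derivative_compose[OF g f] by (subst (asm) e)
  qed
  show ?case
  proof (rule Ck_on_Suc_I[OF assms(1) D], assumption)
    show "Ck_on k S (\<lambda>x. \<Sum>b\<in>Basis. (frechet_derivative g (at x) v \<bullet> b) *\<^sub>R frechet_derivative f (at (g x)) b)" for v
      using Suc.prems Ck_on_Suc_imp[OF Suc.prems(2)]
      by (intro Ck_on_sum assms(1) Ck_on_bilinear[OF _ bounded_bilinear_scaleR] Suc.IH
          Ck_on_bounded_linear[OF _ bounded_linear_inner_left]) auto
  qed
qed

section \<open>Closure properties of smooth maps\<close>

lemma smooth_on_subset: "smooth_on S f \<Longrightarrow> T \<subseteq> S \<Longrightarrow> smooth_on T f"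
  unfolding smooth_on_def using Ck_on_subset by blast

lemma smooth_on_cong:
  assumes "open S" "\<And>x. x \<in> S \<Longrightarrow> f x = g x" "smooth_on S f"
  shows "smooth_on S g"
  using assms Ck_on_cong unfolding smooth_on_def by blast

lemma smooth_on_local:
  assumes "\<And>x. x \<in> S \<Longrightarrow> \<exists>T. open T \<and> x \<in> T \<and> smooth_on T f"
  shows "smooth_on S f"
  unfolding smooth_on_def
proof
  show "Ck_on k S f" for k
    using assms by (intro Ck_on_local) (meson smooth_on_def)
qed

lemma smooth_on_const: "open S \<Longrightarrow> smooth_on S (\<lambda>x. c)"
  unfolding smooth_on_def by (simp add: Ck_on_const)

lemma smooth_on_bounded_linear:
  "open S \<Longrightarrow> bounded_linear L \<Longrightarrow> smooth_on S f \<Longrightarrow> smooth_on S (\<lambda>x. L (f x))"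
  unfolding smooth_on_def by (simp add: Ck_on_bounded_linear)

lemma smooth_on_id: "open S \<Longrightarrow> smooth_on S (\<lambda>x. x)"
  unfolding smooth_on_def
proof
  show "Ck_on k S (\<lambda>x. x)" if "open S" for k
    by (cases k) (auto intro!: Ck_on_Suc_I[where D = "\<lambda>x v. v"] Ck_on_const that simp del: Ck_on.simps(2))
qed

lemma smooth_on_linear: "open S \<Longrightarrow> bounded_linear L \<Longrightarrow> smooth_on S L"
  using smooth_on_bounded_linear[OF _ _ smooth_on_id] by blast

lemma smooth_on_add: "open S \<Longrightarrow> smooth_on S f \<Longrightarrow> smooth_on S g \<Longrightarrow> smooth_on S (\<lambda>x. f x + g x)"
  unfolding smooth_on_def by (simp add: Ck_on_add)

lemma smooth_on_sum:
  "open S \<Longrightarrow> (\<And>i. i \<in> I \<Longrightarrow> smooth_on S (f i)) \<Longrightarrow> smooth_on S (\<lambda>x. \<Sum>i\<in>I. f i x)"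
  unfolding smooth_on_def by (simp add: Ck_on_sum)

lemma smooth_on_bilinear:
  "open S \<Longrightarrow> bounded_bilinear b \<Longrightarrow> smooth_on S f \<Longrightarrow> smooth_on S g \<Longrightarrow> smooth_on S (\<lambda>x. b (f x) (g x))"
  unfolding smooth_on_def by (simp add: Ck_on_bilinear)

lemma smooth_on_mult:
  fixes f g :: "'a::euclidean_space \<Rightarrow> real"
  shows "open S \<Longrightarrow> smooth_on S f \<Longrightarrow> smooth_on S g \<Longrightarrow> smooth_on S (\<lambda>x. f x * g x)"
  by (rule smooth_on_bilinear[OF _ bounded_bilinear_mult])

lemma smooth_on_scaleR:
  "open S \<Longrightarrow> smooth_on S f \<Longrightarrow> smooth_on S g \<Longrightarrow> smooth_on S (\<lambda>x. f x *\<^sub>R g x)"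
  by (rule smooth_on_bilinear[OF _ bounded_bilinear_scaleR])

lemma smooth_on_prod:
  fixes f :: "'i \<Rightarrow> 'a::euclidean_space \<Rightarrow> real"
  assumes "open S" "\<And>i. i \<in> I \<Longrightarrow> smooth_on S (f i)"
  shows "smooth_on S (\<lambda>x. \<Prod>i\<in>I. f i x)"
  using assms(2)
  by (induction I rule: infinite_finite_induct) (auto intro!: smooth_on_const smooth_on_mult assms(1))

lemma smooth_on_vec_nth: "open S \<Longrightarrow> smooth_on S f \<Longrightarrow> smooth_on S (\<lambda>x. f x $ i)"
  by (rule smooth_on_bounded_linear[OF _ bounded_linear_vec_nth])

lemma smooth_on_compose:
  assumes "open S" "open T" "g ` S \<subseteq> T" "smooth_on T f" "smooth_on S g"
  shows "smooth_on S (\<lambda>x. f (g x))"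
  using assms Ck_on_compose unfolding smooth_on_def by blast

lemma smooth_on_has_derivative:
  "smooth_on S f \<Longrightarrow> x \<in> S \<Longrightarrow> (f has_derivative frechet_derivative f (at x)) (at x)"
  unfolding smooth_on_def using Ck_on_Suc_D by blast

lemma smooth_on_frechet_derivative:
  "smooth_on S f \<Longrightarrow> smooth_on S (\<lambda>x. frechet_derivative f (at x) v)"
  unfolding smooth_on_def by (metis Ck_on.simps(2))

lemma smooth_on_continuous_on: "smooth_on S f \<Longrightarrow> continuous_on S f"
  unfolding smooth_on_def by (metis Ck_on.simps(1))

lemma smooth_on_powr:
  fixes f :: "'a::euclidean_space \<Rightarrow> real"
  assumes S: "open S" and f: "smooth_on S f" and pos: "\<And>x. x \<in> S \<Longrightarrow> f x > 0"
  shows "smooth_on S (\<lambda>x. f x powr a)"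
proof -
  \<comment> \<open>The exponent is generalised in the induction because each derivative lowers it
    by one.\<close>
  have "Ck_on k {0<..} (\<lambda>x::real. x powr a)" for k
  proof (induction k arbitrary: a)
    case (Suc k)
    show ?case
    proof (rule Ck_on_Suc_I[where D = "\<lambda>x v. v * (a * x powr (a - 1))"])
      show "((\<lambda>x. x powr a) has_derivative (\<lambda>v. v * (a * x powr (a - 1)))) (at x)"
        if "x \<in> {0<..}" for x :: real
        using that has_real_derivative_powr[of x a]
        unfolding has_field_derivative_def by (subst mult.commute) simp
      show "Ck_on k {0<..} (\<lambda>x::real. v * (a * x powr (a - 1)))" for v
        using Ck_on_bounded_linear[OF _ bounded_linear_mult_right[of "v * a"] Suc.IH[of "a - 1"]]
        by (simp add: mult.assoc)
    qed simp
  qed (auto intro!: continuous_intros)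
  then show ?thesis
    using smooth_on_compose[OF S _ _ _ f, of "{0<..}" "\<lambda>x. x powr a"] pos
    by (auto simp: smooth_on_def)
qed

lemma smooth_on_sqrt:
  fixes f :: "'a::euclidean_space \<Rightarrow> real"
  assumes "open S" "smooth_on S f" "\<And>x. x \<in> S \<Longrightarrow> f x > 0"
  shows "smooth_on S (\<lambda>x. sqrt (f x))"
  by (rule smooth_on_cong[OF assms(1) _ smooth_on_powr[OF assms, of "1/2"]])
    (simp_all add: powr_half_sqrt assms(3) less_imp_le)

lemma smooth_on_inverse:
  fixes f :: "'a::euclidean_space \<Rightarrow> real"
  assumes "open S" "smooth_on S f" "\<And>x. x \<in> S \<Longrightarrow> f x > 0"
  shows "smooth_on S (\<lambda>x. inverse (f x))"
  by (rule smooth_on_cong[OF assms(1) _ smooth_on_powr[OF assms, of "-1"]])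
    (simp_all add: powr_minus assms(3) less_imp_le)

lemma smooth_on_det:
  fixes M :: "'a::euclidean_space \<Rightarrow> real ^ 'n ^ 'n"
  assumes "open S" "\<And>i j. smooth_on S (\<lambda>x. M x $ i $ j)"
  shows "smooth_on S (\<lambda>x. det (M x))"
  unfolding det_def
  by (intro smooth_on_sum smooth_on_mult smooth_on_prod smooth_on_const assms)

text \<open>The flat function \<open>exp (-1/t)\<close> extended by 0. Its derivatives are combinations of the
  functions below, so the induction has to treat all \<open>m\<close> at once.\<close>

definition flat :: "nat \<Rightarrow> real \<Rightarrow> real" where
  "flat m t = (if t > 0 then exp (- inverse t) * inverse t ^ m else 0)"

text \<open>Substituting x = 1/t on the right of 0 gives x^m / exp x, which tends to 0 at
  infinity.\<close>

lemma flat_tendsto_0: "(flat m \<longlongrightarrow> 0) (at 0)"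
proof -
  have "((\<lambda>t. exp (- inverse t) * inverse t ^ m) \<longlongrightarrow> 0) (at_right (0::real))"
  proof -
    have "((\<lambda>x::real. x ^ m / exp x) \<longlongrightarrow> 0) at_top"
      by (rule tendsto_power_div_exp_0)
    from filterlim_compose[OF this filterlim_inverse_at_top_right]
    show ?thesis by (simp add: exp_minus field_simps)
  qed
  then have "(flat m \<longlongrightarrow> 0) (at_right 0)"
    by (rule Lim_transform_eventually) (auto simp: flat_def eventually_at_right_less eventually_at_filter)
  moreover have "(flat m \<longlongrightarrow> 0) (at_left 0)"
    by (rule Lim_transform_eventually[OF tendsto_const]) (auto simp: flat_def eventually_at_filter)
  ultimately show ?thesis by (simp add: filterlim_split_at)
qed

lemma flat_has_derivative:
  "(flat m has_real_derivative (flat (m + 2) t - real m * flat (m + 1) t)) (at t)"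
proof -
  consider "t > 0" | "t < 0" | "t = 0" by linarith
  then show ?thesis
  proof cases
    case 1
    have "((\<lambda>t. exp (- inverse t) * inverse t ^ m) has_real_derivative
        (flat (m + 2) t - real m * flat (m + 1) t)) (at t)"
      using 1
      by (cases m) (auto intro!: derivative_eq_intros simp: flat_def algebra_simps power2_eq_square,
          metis Suc_pred neq0_conv power_Suc)
    then show ?thesis
      by (rule has_field_derivative_transform_within_open[where S = "{0<..}"]) (use 1 in \<open>auto simp: flat_def\<close>)
  next
    case 2
    have "((\<lambda>t. 0) has_real_derivative (flat (m + 2) t - real m * flat (m + 1) t)) (at t)"
      using 2 by (simp add: flat_def)
    then show ?thesis
      by (rule has_field_derivative_transform_within_open[where S = "{..<0}"]) (use 2 in \<open>auto simp: flat_def\<close>)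
  next
    case 3
    \<comment> \<open>Away from 0 the difference quotient is \<open>flat (Suc m) h\<close>, so the
      limit for the next index gives differentiability for this one.\<close>
    have "((\<lambda>h. flat m h / h) \<longlongrightarrow> 0) (at 0)"
      by (rule Lim_transform_eventually[OF flat_tendsto_0[of "Suc m"]])
        (auto simp: flat_def field_simps eventually_at_filter)
    then have "(flat m has_real_derivative 0) (at 0)"
      by (simp add: DERIV_def flat_def)
    then show ?thesis using 3 by (simp add: flat_def)
  qed
qed

lemma smooth_on_flat: "smooth_on UNIV (flat m)"
proof -
  have "Ck_on k UNIV (flat m)" for k
  proof (induction k arbitrary: m)
    case 0
    then show ?case
      using flat_has_derivative DERIV_continuous_on[of UNIV "flat m"] by force
  next
    case (Suc k)
    show ?case
    proof (rule Ck_on_Suc_I[where D = "\<lambda>t v. v * (flat (m + 2) t - real m * flat (m + 1) t)"])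
      show "(flat m has_derivative (\<lambda>v. v * (flat (m + 2) t - real m * flat (m + 1) t))) (at t)" for t
        using flat_has_derivative[of m t]
        unfolding has_field_derivative_def by (subst mult.commute)
      show "Ck_on k UNIV (\<lambda>t. v * (flat (m + 2) t - real m * flat (m + 1) t))" for v
        using Ck_on_add[OF _ Ck_on_bounded_linear[OF _ bounded_linear_mult_right[of v] Suc.IH[of "m + 2"]]
            Ck_on_bounded_linear[OF _ bounded_linear_mult_right[of "- v * m"] Suc.IH[of "m + 1"]]]
        by (simp add: algebra_simps)
    qed simp
  qed
  then show ?thesis by (simp add: smooth_on_def)
qed

text \<open>The squared distance is polynomial, so the centre causes no trouble. For
  \<open>r > 0\<close> the function is positive exactly on the open ball of radius
  \<open>r\<close>.\<close>

definition bump :: "'a::euclidean_space \<Rightarrow> real \<Rightarrow> 'a \<Rightarrow> real" where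
  "bump z r y = flat 0 (r\<^sup>2 - (y - z) \<bullet> (y - z))"

lemma smooth_on_bump: "smooth_on UNIV (bump z r)"
proof -
  have d: "smooth_on UNIV (\<lambda>y. y + - z)"
    by (intro smooth_on_add smooth_on_const smooth_on_id) auto
  have "smooth_on UNIV (\<lambda>y. r\<^sup>2 + (- 1) * ((y + - z) \<bullet> (y + - z)))"
    by (intro smooth_on_add smooth_on_mult smooth_on_const smooth_on_bilinear[OF _ bounded_bilinear_inner] d) auto
  from smooth_on_compose[OF _ _ _ smooth_on_flat this] show ?thesis
    by (simp add: bump_def[abs_def])
qed

lemma bump_nonneg: "bump z r y \<ge> 0"
  by (simp add: bump_def flat_def)

lemma bump_pos:
  assumes "dist z y < r"
  shows "bump z r y > 0"
proof -
  have "(norm (y - z))\<^sup>2 < r\<^sup>2"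
    using assms by (intro power_strict_mono) (simp_all add: dist_norm norm_minus_commute)
  then show ?thesis by (simp add: bump_def flat_def power2_norm_eq_inner)
qed

lemma bump_eq_0:
  assumes "r > 0" "dist z y \<ge> r"
  shows "bump z r y = 0"
proof -
  have "r\<^sup>2 \<le> (norm (y - z))\<^sup>2"
    using assms by (intro power_mono) (simp_all add: dist_norm norm_minus_commute)
  then show ?thesis by (simp add: bump_def flat_def power2_norm_eq_inner)
qed

section \<open>Integration by parts\<close>

text \<open>\<open>g\<close> is uncontrolled outside \<open>U\<close>, but on the open set
  \<open>- K\<close> the product is zero, and \<open>U\<close> and \<open>- K\<close> cover the
  space.\<close>

lemma smooth_on_extend_mult:
  fixes f g :: "'a::euclidean_space \<Rightarrow> real"
  assumes "smooth_on UNIV f" "\<And>y. y \<notin> K \<Longrightarrow> f y = 0" "closed K" "K \<subseteq> U" "open U" "smooth_on U g"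
  shows "smooth_on UNIV (\<lambda>y. f y * g y)"
proof (rule smooth_on_local)
  fix y
  show "\<exists>T. open T \<and> y \<in> T \<and> smooth_on T (\<lambda>y. f y * g y)"
  proof (cases "y \<in> U")
    case True
    then show ?thesis
      using assms smooth_on_mult[OF assms(5) smooth_on_subset[OF assms(1)] assms(6)] by blast
  next
    case False
    have "smooth_on (- K) (\<lambda>y. f y * g y)"
      by (rule smooth_on_cong[OF _ _ smooth_on_const[of _ 0]]) (use assms in auto)
    then show ?thesis using False assms(3,4) by (metis Compl_iff open_Compl subsetD)
  qed
qed

text \<open>By translation invariance the integral of \<open>W(y + t v)\<close> does not depend on \<open>t\<close>.\<close>

lemma has_integral_derivative_compact_support:
  fixes W :: "'a::euclidean_space \<Rightarrow> real"
  assumes W: "smooth_on UNIV W" and supp: "\<And>y. y \<notin> cbox a b \<Longrightarrow> W y = 0"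
  shows "((\<lambda>y. frechet_derivative W (at y) v) has_integral 0) (cbox a b)"
proof -
  define d where "d y = frechet_derivative W (at y) v" for y
  have dW: "(W has_derivative frechet_derivative W (at y)) (at y)" for y
    using smooth_on_has_derivative[OF W] by simp
  have cd: "continuous_on UNIV d" and cW: "continuous_on UNIV W"
    unfolding d_def using smooth_on_continuous_on smooth_on_frechet_derivative W by blast+
  \<comment> \<open>One box has to contain all translates of the support for |t| <= 1, since
    differentiation under the integral needs a domain that does not move with
    \<open>t\<close>.\<close>
  have "bounded (\<Union>t\<in>{-1..1}. cbox (a - t *\<^sub>R v) (b - t *\<^sub>R v))"
  proof -
    have "bounded ((\<lambda>t. - t *\<^sub>R v) ` {-1..1})"
      by (intro compact_imp_bounded[OF compact_continuous_image] continuous_intros) auto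
    then have "bounded (\<Union>y\<in>cbox a b. \<Union>z\<in>(\<lambda>t. - t *\<^sub>R v) ` {-1..1}. {y + z})"
      by (intro bounded_sums bounded_cbox)
    then show ?thesis
    proof (rule bounded_subset, safe)
      fix x t assume "t \<in> {-1..1::real}" "x \<in> cbox (a - t *\<^sub>R v) (b - t *\<^sub>R v)"
      moreover have "x + t *\<^sub>R v \<in> cbox a b"
        using calculation(2) by (simp add: mem_box inner_add_left inner_diff_left algebra_simps)
      ultimately show "x \<in> (\<Union>y\<in>cbox a b. \<Union>z\<in>(\<lambda>t. - t *\<^sub>R v) ` {-1..1}. {y + z})"
        by (intro UN_I[of "x + t *\<^sub>R v"] UN_I[of "- t *\<^sub>R v"]) auto
    qed
  qed
  then obtain c where c: "(\<Union>t\<in>{-1..1}. cbox (a - t *\<^sub>R v) (b - t *\<^sub>R v)) \<subseteq> cbox (-c) c"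
    using bounded_subset_cbox_symmetric by blast
  define I where "I = integral (cbox a b) W"
  have WI: "(W has_integral I) (cbox a b)"
    unfolding I_def
    by (intro integrable_integral integrable_continuous continuous_on_subset[OF cW]) auto
  have const: "integral (cbox (-c) c) (\<lambda>y. W (y + t *\<^sub>R v)) = I" if t: "t \<in> {-1<..<1}" for t
  proof -
    have "((\<lambda>y. W (y + t *\<^sub>R v)) has_integral I) (cbox (a - t *\<^sub>R v) (b - t *\<^sub>R v))"
      by (rule has_integral_shift_cbox[OF WI])
    moreover have "W (y + t *\<^sub>R v) = 0" if "y \<notin> cbox (a - t *\<^sub>R v) (b - t *\<^sub>R v)" for y
      using that by (intro supp) (simp add: mem_box inner_add_left inner_diff_left algebra_simps)
    moreover have "cbox (a - t *\<^sub>R v) (b - t *\<^sub>R v) \<subseteq> cbox (-c) c"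
      using c t by force
    ultimately show ?thesis
      using has_integral_on_superset integral_unique by blast
  qed
  have "((\<lambda>t. integral (cbox (-c) c) (\<lambda>y. W (y + t *\<^sub>R v))) has_field_derivative
      integral (cbox (-c) c) (\<lambda>y. d (y + 0 *\<^sub>R v))) (at 0 within {-1<..<1})"
  proof (rule leibniz_rule_field_derivative)
    show "((\<lambda>t. W (y + t *\<^sub>R v)) has_field_derivative d (y + t *\<^sub>R v)) (at t within {-1<..<1})" for t y
    proof -
      have "((\<lambda>t. y + t *\<^sub>R v) has_derivative (\<lambda>s. s *\<^sub>R v)) (at t within {-1<..<1})"
        by (auto intro!: derivative_eq_intros)
      from has_derivative_compose[OF this dW]
      show ?thesis
        by (simp add: has_field_derivative_def d_def linear_cmul[OF has_derivative_linear[OF dW]]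
            mult_commute_abs)
    qed
    show "(\<lambda>y. W (y + t *\<^sub>R v)) integrable_on cbox (-c) c" for t
      by (intro integrable_continuous continuous_on_compose2[OF cW] continuous_intros) auto
    show "continuous_on ({-1<..<1} \<times> cbox (-c) c) (\<lambda>(t, y). d (y + t *\<^sub>R v))"
      unfolding case_prod_unfold by (intro continuous_on_compose2[OF cd] continuous_intros) auto
  qed auto
  moreover have "((\<lambda>t. integral (cbox (-c) c) (\<lambda>y. W (y + t *\<^sub>R v))) has_field_derivative 0) (at 0)"
    by (rule has_field_derivative_transform_within_open[of "\<lambda>t. I" 0 0 "{-1<..<1}"])
      (use const in auto)
  ultimately have "integral (cbox (-c) c) d = 0"
    by (simp add: at_within_open[of 0 "{-1<..<1::real}"] DERIV_unique)
  moreover have dint: "d integrable_on cbox p q" for p q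
    by (intro integrable_continuous continuous_on_subset[OF cd]) auto
  ultimately have 1: "(d has_integral 0) (cbox (-c) c)"
    by (metis integrable_integral)
  \<comment> \<open>Off the closed box \<open>W\<close> vanishes on a neighbourhood, so the integral
    over the large box is the integral over the original one.\<close>
  have d0: "d y = 0" if "y \<notin> cbox a b" for y
  proof -
    have "((\<lambda>y. 0) has_derivative frechet_derivative W (at y)) (at y)"
      by (rule has_derivative_transform_within_open[OF dW, of "- cbox a b"])
        (use that supp in \<open>auto simp: closed_cbox\<close>)
    then have "frechet_derivative W (at y) = (\<lambda>_. 0)"
      by (rule has_derivative_unique[OF _ has_derivative_const])
    then show ?thesis by (simp add: d_def)
  qed
  have "cbox (a - 0 *\<^sub>R v) (b - 0 *\<^sub>R v) \<subseteq> cbox (-c) c"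
    by (rule order_trans[OF UN_upper c]) simp
  then have "cbox a b \<subseteq> cbox (-c) c" by simp
  with d0 have "(d has_integral integral (cbox a b) d) (cbox (-c) c)"
    by (intro has_integral_on_superset[OF integrable_integral[OF dint[of a b]]]) auto
  with 1 have "integral (cbox a b) d = 0" by (rule has_integral_unique[symmetric])
  then have "(d has_integral 0) (cbox a b)" using integrable_integral[OF dint[of a b]] by simp
  then show ?thesis by (simp add: d_def[abs_def])
qed

text \<open>The integrand is div(f X) expanded by the product rule. Each f X_i extends smoothly by
  zero beyond \<open>U\<close>, and the integral of a derivative of a compactly supported function
  is zero.\<close>

lemma has_integral_divergence:
  fixes f :: "real ^ 'n \<Rightarrow> real" and X :: "'n \<Rightarrow> real ^ 'n \<Rightarrow> real"
  assumes f: "smooth_on UNIV f" "\<And>y. y \<notin> cbox a b \<Longrightarrow> f y = 0"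
    and U: "open U" "cbox a b \<subseteq> U" and X: "\<And>i. smooth_on U (X i)"
  shows "((\<lambda>y. \<Sum>i\<in>UNIV. frechet_derivative f (at y) (axis i 1) * X i y
      + f y * frechet_derivative (X i) (at y) (axis i 1)) has_integral 0) (cbox a b)"
proof -
  have "((\<lambda>y. frechet_derivative f (at y) (axis i 1) * X i y
      + f y * frechet_derivative (X i) (at y) (axis i 1)) has_integral 0) (cbox a b)" for i
  proof -
    have sm: "smooth_on UNIV (\<lambda>y. f y * X i y)"
      by (rule smooth_on_extend_mult[OF f(1) _ closed_cbox U(2,1) X]) (rule f(2))
    have "frechet_derivative (\<lambda>y. f y * X i y) (at y) (axis i 1) =
        frechet_derivative f (at y) (axis i 1) * X i y + f y * frechet_derivative (X i) (at y) (axis i 1)"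
      if y: "y \<in> cbox a b" for y
    proof -
      have "((\<lambda>y. f y * X i y) has_derivative
          (\<lambda>v. f y * frechet_derivative (X i) (at y) v + frechet_derivative f (at y) v * X i y)) (at y)"
        by (rule has_derivative_mult[OF smooth_on_has_derivative[OF f(1)] smooth_on_has_derivative[OF X]])
          (use y U in auto)
      from frechet_derivative_at[OF this, symmetric] show ?thesis by simp
    qed
    then show ?thesis
      using has_integral_derivative_compact_support[OF sm, of a b "axis i 1"] f(2)
      by (subst has_integral_cong[of _ _ "\<lambda>y. frechet_derivative (\<lambda>y. f y * X i y) (at y) (axis i 1)"]) auto
  qed
  then have "((\<lambda>y. \<Sum>i\<in>UNIV. frechet_derivative f (at y) (axis i 1) * X i y
      + f y * frechet_derivative (X i) (at y) (axis i 1)) has_integral (\<Sum>i\<in>(UNIV :: 'n set). 0)) (cbox a b)"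
    by (intro has_integral_sum[OF finite])
  then show ?thesis by simp
qed

text \<open>The fundamental lemma of the calculus of variations. If \<open>K z > 0\<close>, then
  \<open>K\<close> is positive near \<open>z\<close>; a bump supported there gives a nonnegative
  continuous integrand with integral 0, which would have to vanish at \<open>z\<close>. The case
  \<open>K z < 0\<close> follows by passing to \<open>- K\<close>.\<close>

lemma eq_0_if_bump_integrals_eq_0:
  fixes K :: "'a::euclidean_space \<Rightarrow> real"
  assumes K: "continuous_on (cbox a b) K" and z: "z \<in> box a b"
    and int0: "\<And>r. r > 0 \<Longrightarrow> cball z r \<subseteq> box a b \<Longrightarrow> integral (cbox a b) (\<lambda>y. bump z r y * K y) = 0"
  shows "K z = 0"
proof -
  have *: "\<not> L z > 0" if L: "continuous_on (cbox a b) L"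
    and L0: "\<And>r. r > 0 \<Longrightarrow> cball z r \<subseteq> box a b \<Longrightarrow> integral (cbox a b) (\<lambda>y. bump z r y * L y) = 0"
  for L :: "'a \<Rightarrow> real"
  proof
    assume pos: "L z > 0"
    have "isCont L z"
      using continuous_on_subset[OF L box_subset_cbox] z
      by (simp add: continuous_on_eq_continuous_at[OF open_box])
    then have "\<forall>\<^sub>F y in at z. L y > 0"
      using pos by (auto simp: isCont_def dest: order_tendstoD)
    then obtain d where d0: "d > 0" "\<forall>y. y \<noteq> z \<and> dist y z < d \<longrightarrow> L y > 0"
      unfolding eventually_at by auto
    have d: "L y > 0" if "dist y z < d" for y
      using d0(2) pos that by (cases "y = z") auto
    obtain e where e: "e > 0" "cball z e \<subseteq> box a b"
      using z open_box open_contains_cball by blast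
    define r where "r = min (d / 2) e"
    have r: "r > 0" "cball z r \<subseteq> box a b" "r < d"
      using d0(1) e by (auto simp: r_def subset_eq)
    have c: "continuous_on (cbox a b) (\<lambda>y. bump z r y * L y)"
      by (intro continuous_intros L continuous_on_subset[OF smooth_on_continuous_on[OF smooth_on_bump]]) auto
    have nn: "bump z r y * L y \<ge> 0" for y
    proof (cases "dist z y < r")
      case True
      then show ?thesis using d[of y] r bump_nonneg[of z r y] by (simp add: dist_commute)
    next
      case False
      then show ?thesis using bump_eq_0[of r z y] r by simp
    qed
    have "((\<lambda>y. bump z r y * L y) has_integral 0) (cbox a b)"
      using integrable_continuous[OF c] L0[OF r(1,2)] by (metis integrable_integral)
    from has_integral_0_cbox_imp_0[OF c _ this, of z] nn z
    have "bump z r z * L z = 0" using box_subset_cbox by blast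
    then show False using pos bump_pos[of z z r] r by simp
  qed
  have "\<not> K z > 0" using * K int0 by blast
  moreover have "\<not> - K z > 0"
    using *[of "\<lambda>y. - K y"] K int0 by (simp add: continuous_on_minus)
  ultimately show ?thesis by simp
qed

section \<open>Positive definite matrices\<close>

definition posdef :: "real ^ 'n ^ 'n \<Rightarrow> bool" where
  "posdef M \<longleftrightarrow> transpose M = M \<and> (\<forall>v. v \<noteq> 0 \<longrightarrow> v \<bullet> (M *v v) > 0)"

definition orthonormal_wrt :: "real ^ 'n ^ 'n \<Rightarrow> ('n \<Rightarrow> real ^ 'n) \<Rightarrow> bool" where
  "orthonormal_wrt M e \<longleftrightarrow> (\<forall>i j. e i \<bullet> (M *v e j) = (if i = j then 1 else 0))"

lemma posdef_inner_sym: "posdef M \<Longrightarrow> v \<bullet> (M *v w) = w \<bullet> (M *v v)"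
  by (metis dot_lmul_matrix inner_commute posdef_def vector_transpose_matrix)

text \<open>Gram-Schmidt with respect to \<open>M\<close>, carried out on finite sets of vectors; a
  bijection with the index type turns the full set into a family at the end.\<close>

lemma posdef_ex_orthonormal:
  fixes M :: "real ^ 'n ^ 'n"
  assumes M: "posdef M"
  shows "\<exists>e. orthonormal_wrt M e"
proof -
  have "\<exists>B. finite B \<and> card B = k \<and> (\<forall>u\<in>B. \<forall>v\<in>B. u \<bullet> (M *v v) = (if u = v then 1 else 0))"
    if "k \<le> CARD('n)" for k
    using that
  proof (induction k)
    case 0
    then show ?case by (intro exI[of _ "{}"]) auto
  next
    case (Suc k)
    then obtain B where B: "finite B" "card B = k"
      "\<And>u v. u \<in> B \<Longrightarrow> v \<in> B \<Longrightarrow> u \<bullet> (M *v v) = (if u = v then 1 else 0)" by fastforce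
    have "dim (span B) < DIM(real ^ 'n)"
      using dim_le_card'[OF B(1)] B(2) Suc.prems by simp
    then have "span B \<noteq> UNIV" by (metis dim_UNIV less_irrefl)
    then obtain v where v: "v \<notin> span B" by blast
    define w where "w = v - (\<Sum>u\<in>B. (v \<bullet> (M *v u)) *\<^sub>R u)"
    have "w \<noteq> 0"
    proof
      assume "w = 0"
      then have "v = (\<Sum>u\<in>B. (v \<bullet> (M *v u)) *\<^sub>R u)" by (simp add: w_def)
      moreover have "(\<Sum>u\<in>B. (v \<bullet> (M *v u)) *\<^sub>R u) \<in> span B"
        by (intro span_sum span_scale span_base)
      ultimately show False using v by simp
    qed
    then have pos: "w \<bullet> (M *v w) > 0" using M by (simp add: posdef_def)
    have orth: "w \<bullet> (M *v u) = 0" if "u \<in> B" for u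
    proof -
      have "(\<Sum>x\<in>B. (v \<bullet> (M *v x)) * (x \<bullet> (M *v u))) = (\<Sum>x\<in>B. if x = u then v \<bullet> (M *v u) else 0)"
        using that by (intro sum.cong) (auto simp: B(3))
      then show ?thesis
        using that B(1) by (simp add: w_def inner_diff_left inner_sum_left)
    qed
    define x where "x = (1 / sqrt (w \<bullet> (M *v w))) *\<^sub>R w"
    have xx: "x \<bullet> (M *v x) = 1"
      using pos by (simp add: x_def matrix_vector_mult_scaleR flip: power2_eq_square)
    have xu: "x \<bullet> (M *v u) = 0" if "u \<in> B" for u
      using orth[OF that] by (simp add: x_def)
    have ux: "u \<bullet> (M *v x) = 0" if "u \<in> B" for u
      using xu[OF that] posdef_inner_sym[OF M] by metis
    have "x \<notin> B" using xu xx by force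
    then show ?case
      using B xx xu ux by (intro exI[of _ "insert x B"]) auto
  qed
  from this[OF order_refl] obtain B where B: "finite B" "card B = CARD('n)"
    "\<And>u v. u \<in> B \<Longrightarrow> v \<in> B \<Longrightarrow> u \<bullet> (M *v v) = (if u = v then 1 else 0)" by blast
  obtain e where e: "bij_betw e (UNIV :: 'n set) B"
    using finite_same_card_bij[of "UNIV :: 'n set" B] B by auto
  have "orthonormal_wrt M e"
    unfolding orthonormal_wrt_def
    using B(3) bij_betwE[OF e] bij_betw_imp_inj_on[OF e] by (auto simp: inj_eq)
  then show ?thesis by blast
qed

lemma matrix_inv_mult:
  assumes "invertible M"
  shows "M ** matrix_inv M = mat 1" "matrix_inv M ** M = mat 1"
  using someI_ex[OF assms[unfolded invertible_def]] by (simp_all add: matrix_inv_def)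

text \<open>If \<open>P\<close> has the columns \<open>e k\<close>, orthonormality reads P^T M P =
  1. Hence det M (det P)^2 = 1, and P P^T is the inverse of \<open>M\<close>, whichever orthonormal
  family was chosen.\<close>

lemma orthonormal_wrt_matrix:
  assumes "orthonormal_wrt M e"
  shows "det M > 0" "invertible M"
    "(\<Sum>k\<in>UNIV. e k $ i * e k $ j) = matrix_inv M $ i $ j"
proof -
  define P where "P = (\<chi> i k. e k $ i)"
  have col: "column k P = e k" for k
    by (simp add: P_def column_def vec_eq_iff)
  have PMP: "transpose P ** (M ** P) = mat 1"
  proof -
    have "(transpose P ** (M ** P)) $ i $ j = e i \<bullet> (M *v e j)" for i j
      by (simp add: matrix_matrix_mult_def transpose_def P_def inner_vec_def matrix_vector_mult_def)
    then show ?thesis using assms by (simp add: orthonormal_wrt_def vec_eq_iff mat_def)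
  qed
  then have "det P * (det M * det P) = 1"
    by (metis det_I det_mul det_transpose)
  then have d: "det M * (det P)\<^sup>2 = 1" by (simp add: power2_eq_square algebra_simps)
  then show "det M > 0"
    using mult_nonpos_nonneg[of "det M" "(det P)\<^sup>2"] by (intro ccontr[of "det M > 0"]) simp
  then show inv: "invertible M" by (simp add: invertible_det_nz)
  have "M ** (P ** transpose P) = mat 1"
    using PMP matrix_left_right_inverse by (metis matrix_mul_assoc)
  then have "matrix_inv M = P ** transpose P"
    using matrix_mul_assoc[of "matrix_inv M" M "P ** transpose P"] matrix_inv_mult(2)[OF inv] by simp
  then show "(\<Sum>k\<in>UNIV. e k $ i * e k $ j) = matrix_inv M $ i $ j"
    by (simp add: P_def matrix_matrix_mult_def transpose_def)
qed

lemma posdef_det_pos: "posdef M \<Longrightarrow> det M > 0"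
  and posdef_invertible: "posdef M \<Longrightarrow> invertible M"
  using posdef_ex_orthonormal orthonormal_wrt_matrix by blast+

text \<open>Writing v = M w turns the quadratic form of the inverse at \<open>v\<close> into that of
  \<open>M\<close> at \<open>w\<close>.\<close>

lemma posdef_matrix_inv:
  assumes "posdef M"
  shows "posdef (matrix_inv M)"
proof -
  have inv: "M ** matrix_inv M = mat 1" "matrix_inv M ** M = mat 1"
    using matrix_inv_mult[OF posdef_invertible[OF assms]] by blast+
  have t: "transpose (matrix_inv M) = matrix_inv M"
  proof -
    have "transpose (matrix_inv M) ** M = mat 1"
      using arg_cong[OF inv(1), of transpose] assms by (simp add: matrix_transpose_mul posdef_def transpose_mat)
    then show ?thesis
      using matrix_mul_assoc[of "transpose (matrix_inv M)" M "matrix_inv M"] inv(1) by simp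
  qed
  moreover have "v \<bullet> (matrix_inv M *v v) > 0" if "v \<noteq> 0" for v
  proof -
    define w where "w = matrix_inv M *v v"
    have v: "v = M *v w" by (simp add: w_def matrix_vector_mul_assoc inv)
    then have "w \<noteq> 0" using that by auto
    then have "w \<bullet> (M *v w) > 0" using assms by (simp add: posdef_def)
    then show ?thesis by (simp add: w_def[symmetric] v[symmetric] inner_commute)
  qed
  ultimately show ?thesis by (simp add: posdef_def)
qed

text \<open>By Cramer's rule each entry is a quotient of determinants of smooth matrices, with the
  positive denominator det M.\<close>

lemma smooth_on_matrix_inv:
  fixes M :: "'a::euclidean_space \<Rightarrow> real ^ 'n ^ 'n"
  assumes S: "open S" and M: "\<And>i j. smooth_on S (\<lambda>x. M x $ i $ j)"
    and pd: "\<And>x. x \<in> S \<Longrightarrow> posdef (M x)"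
  shows "smooth_on S (\<lambda>x. matrix_inv (M x) $ i $ j)"
proof -
  let ?C = "\<lambda>x. (\<chi> r s. if s = i then axis j 1 $ r else M x $ r $ s) :: real ^ 'n ^ 'n"
  have "matrix_inv (M x) $ i $ j = det (?C x) * inverse (det (M x))" if x: "x \<in> S" for x
  proof -
    have "M x *v (matrix_inv (M x) *v axis j 1) = axis j 1"
      using posdef_invertible[OF pd[OF x]] by (simp add: matrix_vector_mul_assoc matrix_inv_mult)
    then have "matrix_inv (M x) *v axis j 1 =
        (\<chi> k. det (\<chi> r s. if s = k then axis j 1 $ r else M x $ r $ s) / det (M x))"
      using posdef_det_pos[OF pd[OF x]] by (intro cramer[THEN iffD1]) auto
    then have "(matrix_inv (M x) *v axis j 1) $ i = det (?C x) / det (M x)" by simp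
    then show ?thesis by (simp add: matrix_vector_mul_component inner_axis divide_inverse)
  qed
  moreover have "smooth_on S (\<lambda>x. det (?C x) * inverse (det (M x)))"
  proof (intro smooth_on_mult smooth_on_inverse smooth_on_det S M)
    show "smooth_on S (\<lambda>x. ?C x $ r $ s)" for r s
      by (cases "s = i") (simp_all add: M smooth_on_const[OF S])
  qed (use posdef_det_pos pd in auto)
  ultimately show ?thesis
    using smooth_on_cong[OF S, of "\<lambda>x. det (?C x) * inverse (det (M x))"] by simp
qed

section \<open>Riemannian geometry in a chart\<close>

lemma linear_axis_expansion:
  fixes L :: "real ^ 'n \<Rightarrow> 'a::real_vector"
  assumes "linear L"
  shows "L v = (\<Sum>i\<in>UNIV. v $ i *\<^sub>R L (axis i 1))"
proof -
  have "L (\<Sum>i\<in>UNIV. v $ i *\<^sub>R axis i 1) = (\<Sum>i\<in>UNIV. v $ i *\<^sub>R L (axis i 1))"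
    by (simp add: linear_sum[OF assms] linear_cmul[OF assms])
  then show ?thesis
    using basis_expansion[of v] by (simp add: scalar_mult_eq_scaleR)
qed

text \<open>The sum of the products e_k e_k^T is the inverse of \<open>M\<close>, so the chosen
  family drops out of the sum.\<close>

lemma orthonormal_wrt_sum_inner:
  assumes "orthonormal_wrt M e"
  shows "(\<Sum>k\<in>UNIV. (e k \<bullet> a) * (e k \<bullet> b)) = a \<bullet> (matrix_inv M *v b)"
proof -
  have "(\<Sum>k\<in>UNIV. (e k \<bullet> a) * (e k \<bullet> b)) =
      (\<Sum>k\<in>UNIV. \<Sum>i\<in>UNIV. \<Sum>j\<in>UNIV. a $ i * b $ j * (e k $ i * e k $ j))"
    by (simp add: inner_vec_def sum_product algebra_simps)
  also have "\<dots> = (\<Sum>i\<in>UNIV. \<Sum>k\<in>UNIV. \<Sum>j\<in>UNIV. a $ i * b $ j * (e k $ i * e k $ j))"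
    by (rule sum.swap)
  also have "\<dots> = (\<Sum>i\<in>UNIV. \<Sum>j\<in>UNIV. \<Sum>k\<in>UNIV. a $ i * b $ j * (e k $ i * e k $ j))"
    by (intro sum.cong refl sum.swap)
  also have "\<dots> = (\<Sum>i\<in>UNIV. \<Sum>j\<in>UNIV. a $ i * b $ j * (\<Sum>k\<in>UNIV. e k $ i * e k $ j))"
    by (simp add: sum_distrib_left)
  also have "\<dots> = a \<bullet> (matrix_inv M *v b)"
    by (simp add: orthonormal_wrt_matrix(3)[OF assms] inner_vec_def matrix_vector_mult_def
        sum_distrib_left algebra_simps)
  finally show ?thesis .
qed

locale riemannian_manifold =
  fixes A :: "('m::{t2_space, second_countable_topology}, 'n::finite) chart set"
    and g :: "('m, 'n) metric"
  assumes atlas: "oriented_atlas A" and metric: "riemannian_metric A g"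
begin

abbreviation cimg :: "('m, 'n) chart \<Rightarrow> (real ^ 'n) set" where
  "cimg c \<equiv> cmap c ` cdom c"

lemma cdom_open: "c \<in> A \<Longrightarrow> open (cdom c)"
  and cimg_open: "c \<in> A \<Longrightarrow> open (cimg c)"
  and chart_homeomorphism: "c \<in> A \<Longrightarrow> homeomorphism (cdom c) (cimg c) (cmap c) (cinv c)"
  using atlas by (auto simp: oriented_atlas_def)

lemma ex_chart: "\<exists>c\<in>A. x \<in> cdom c"
  using atlas by (auto simp: oriented_atlas_def)

lemma chart_at: "chart_at A x \<in> A" "x \<in> cdom (chart_at A x)"
proof -
  have "chart_at A x \<in> A \<and> x \<in> cdom (chart_at A x)"
    unfolding chart_at_def by (rule someI_ex) (use ex_chart in blast)
  then show "chart_at A x \<in> A" "x \<in> cdom (chart_at A x)" by auto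
qed

lemma cinv_cmap [simp]: "c \<in> A \<Longrightarrow> x \<in> cdom c \<Longrightarrow> cinv c (cmap c x) = x"
  using chart_homeomorphism by (simp add: homeomorphism_def)

lemma cmap_cinv [simp]: "y \<in> cimg c \<Longrightarrow> cmap c (cinv c y) = y"
  by (rule f_inv_into_f)

lemma cinv_in [simp]: "y \<in> cimg c \<Longrightarrow> cinv c y \<in> cdom c"
  by (rule inv_into_into)

lemma cmap_continuous: "c \<in> A \<Longrightarrow> continuous_on (cdom c) (cmap c)"
  and cinv_continuous: "c \<in> A \<Longrightarrow> continuous_on (cimg c) (cinv c)"
  using chart_homeomorphism by (simp_all add: homeomorphism_def)

lemma cimg_Int_eq: "c \<in> A \<Longrightarrow> cmap c ` (cdom c \<inter> W) = cimg c \<inter> cinv c -` W"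
  by (auto simp: image_iff)

lemma cimg_Int_open: "c \<in> A \<Longrightarrow> open W \<Longrightarrow> open (cmap c ` (cdom c \<inter> W))"
  by (subst cimg_Int_eq) (auto intro: continuous_open_preimage cinv_continuous cimg_open)

lemma transition_smooth:
  "c \<in> A \<Longrightarrow> c' \<in> A \<Longrightarrow> smooth_on (cmap c ` (cdom c \<inter> cdom c')) (cmap c' \<circ> cinv c)"
  using atlas unfolding oriented_atlas_def by blast

lemma transition_has_derivative:
  assumes "c \<in> A" "c' \<in> A" "x \<in> cdom c" "x \<in> cdom c'"
  shows "((cmap c' \<circ> cinv c) has_derivative transition_deriv c c' x) (at (cmap c x))"
  unfolding transition_deriv_def
  by (rule smooth_on_has_derivative[OF transition_smooth]) (use assms in auto)

lemma transition_linear: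
  assumes "c \<in> A" "c' \<in> A" "x \<in> cdom c" "x \<in> cdom c'"
  shows "linear (transition_deriv c c' x)"
  using has_derivative_linear[OF transition_has_derivative[OF assms]] .

lemma transition_refl:
  assumes "c \<in> A" "x \<in> cdom c"
  shows "transition_deriv c c x v = v"
proof -
  have "((cmap c \<circ> cinv c) has_derivative (\<lambda>v. v)) (at (cmap c x))"
    by (rule has_derivative_transform_within_open[OF has_derivative_ident cimg_open[OF assms(1)]])
      (use assms in auto)
  from frechet_derivative_at[OF this] show ?thesis by (simp add: transition_deriv_def fun_eq_iff)
qed

lemma transition_trans:
  assumes "c \<in> A" "c' \<in> A" "c'' \<in> A" "x \<in> cdom c" "x \<in> cdom c'" "x \<in> cdom c''"
  shows "transition_deriv c' c'' x (transition_deriv c c' x v) = transition_deriv c c'' x v"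
proof -
  have "(((cmap c'' \<circ> cinv c') \<circ> (cmap c' \<circ> cinv c)) has_derivative
      transition_deriv c' c'' x \<circ> transition_deriv c c' x) (at (cmap c x))"
    by (rule diff_chain_at) (use assms transition_has_derivative in auto)
  then have "((cmap c'' \<circ> cinv c) has_derivative
      transition_deriv c' c'' x \<circ> transition_deriv c c' x) (at (cmap c x))"
    by (rule has_derivative_transform_within_open[OF _ cimg_Int_open[OF assms(1) cdom_open[OF assms(2)]]])
      (use assms in auto)
  from frechet_derivative_at[OF this] show ?thesis
    by (simp add: transition_deriv_def fun_eq_iff)
qed

text \<open>Inverse of taking the component in \<open>c\<close>: coordinates in one chart determine
  those in all others by the transformation law. The value 0 elsewhere is the default that
  \<open>tangent_space\<close> prescribes.\<close>

definition lift :: "('m, 'n) chart \<Rightarrow> 'm \<Rightarrow> real ^ 'n \<Rightarrow> ('m, 'n) tvec" where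
  "lift c x v = (\<lambda>c'. if c' \<in> A \<and> x \<in> cdom c' then transition_deriv c c' x v else 0)"

lemma coord_vec_eq_lift: "coord_vec A c i x = lift c x (axis i 1)"
  by (simp add: coord_vec_def lift_def)

lemma lift_in_tangent_space [simp]: "c \<in> A \<Longrightarrow> x \<in> cdom c \<Longrightarrow> lift c x v \<in> tangent_space A x"
  by (simp add: tangent_space_def lift_def transition_trans)

lemma lift_component [simp]: "c \<in> A \<Longrightarrow> x \<in> cdom c \<Longrightarrow> lift c x v c = v"
  by (simp add: lift_def transition_refl)

lemma tangent_transition:
  assumes "X \<in> tangent_space A x" "c \<in> A" "c' \<in> A" "x \<in> cdom c" "x \<in> cdom c'"
  shows "transition_deriv c c' x (X c) = X c'"
proof -
  have "X c' = transition_deriv c c' x (X c)"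
    using assms unfolding tangent_space_def by blast
  then show ?thesis by (rule sym)
qed

lemma tangent_zero: "X \<in> tangent_space A x \<Longrightarrow> \<not> (c \<in> A \<and> x \<in> cdom c) \<Longrightarrow> X c = 0"
  unfolding tangent_space_def by blast

lemma lift_eq: "c \<in> A \<Longrightarrow> x \<in> cdom c \<Longrightarrow> X \<in> tangent_space A x \<Longrightarrow> lift c x (X c) = X"
  unfolding lift_def by (rule ext) (metis tangent_transition tangent_zero)

lemma lift_comb:
  "c \<in> A \<Longrightarrow> x \<in> cdom c \<Longrightarrow> lift c x (a *\<^sub>R v + b *\<^sub>R w) = tcomb a (lift c x v) b (lift c x w)"
  by (auto simp: lift_def tcomb_def linear_add[OF transition_linear] linear_cmul[OF transition_linear])

text \<open>Linearity is available only on the tangent space and only through \<open>tcomb\<close>;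
  pulling back along \<open>lift\<close> yields a linear map on \<open>real ^ 'n\<close> to which
  linear algebra applies.\<close>

lemma linear_lift:
  fixes F :: "('m, 'n) tvec \<Rightarrow> 'w::real_vector"
  assumes "c \<in> A" "x \<in> cdom c"
    and "\<And>X Y a b. X \<in> tangent_space A x \<Longrightarrow> Y \<in> tangent_space A x \<Longrightarrow>
      F (tcomb a X b Y) = a *\<^sub>R F X + b *\<^sub>R F Y"
  shows "linear (\<lambda>v. F (lift c x v))"
proof (rule linearI)
  show "F (lift c x (v + w)) = F (lift c x v) + F (lift c x w)" for v w
    using assms lift_comb[OF assms(1,2), of 1 v 1 w] by simp
  show "F (lift c x (r *\<^sub>R v)) = r *\<^sub>R F (lift c x v)" for r v
    using assms lift_comb[OF assms(1,2), of r v 0 v] by simp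
qed

lemma tangent_expansion:
  fixes F :: "('m, 'n) tvec \<Rightarrow> 'w::real_vector"
  assumes "c \<in> A" "x \<in> cdom c" "X \<in> tangent_space A x"
    and "\<And>X Y a b. X \<in> tangent_space A x \<Longrightarrow> Y \<in> tangent_space A x \<Longrightarrow>
      F (tcomb a X b Y) = a *\<^sub>R F X + b *\<^sub>R F Y"
  shows "F X = (\<Sum>i\<in>UNIV. X c $ i *\<^sub>R F (coord_vec A c i x))"
proof -
  have "linear (\<lambda>v. F (lift c x v))"
    by (rule linear_lift) (use assms in auto)
  from linear_axis_expansion[OF this, of "X c"] show ?thesis
    by (simp add: coord_vec_eq_lift lift_eq assms(1-3))
qed

lemma smooth_map_on_chart: "smooth_map_on A UNIV f \<Longrightarrow> c \<in> A \<Longrightarrow> smooth_on (cimg c) (f \<circ> cinv c)"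
  unfolding smooth_map_on_def by force

lemma smooth_map_has_derivative:
  assumes "smooth_map_on A UNIV f" "c \<in> A" "y \<in> cimg c"
  shows "((f \<circ> cinv c) has_derivative frechet_derivative (f \<circ> cinv c) (at y)) (at y)"
  using smooth_on_has_derivative[OF smooth_map_on_chart[OF assms(1,2)] assms(3)] .

text \<open>These are the components of \<open>df\<close>; those of the gradient are obtained by multiplying with the
  inverse Gram matrix.\<close>

definition grad_in :: "('m, 'n) chart \<Rightarrow> ('m \<Rightarrow> real) \<Rightarrow> real ^ 'n \<Rightarrow> real ^ 'n" where
  "grad_in c f y = (\<chi> i. frechet_derivative (f \<circ> cinv c) (at y) (axis i 1))"

lemma grad_in_has_derivative:
  assumes "smooth_map_on A UNIV f" "c \<in> A" "y \<in> cimg c"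
  shows "((f \<circ> cinv c) has_derivative (\<lambda>v. v \<bullet> grad_in c f y)) (at y)"
proof -
  have "frechet_derivative (f \<circ> cinv c) (at y) v = v \<bullet> grad_in c f y" for v
    by (subst linear_axis_expansion[OF has_derivative_linear[OF smooth_map_has_derivative[OF assms]]])
      (simp add: inner_vec_def grad_in_def)
  then have "frechet_derivative (f \<circ> cinv c) (at y) = (\<lambda>v. v \<bullet> grad_in c f y)" by blast
  then show ?thesis using smooth_map_has_derivative[OF assms] by simp
qed

lemma grad_in_unique:
  assumes "((f \<circ> cinv c) has_derivative (\<lambda>v. v \<bullet> d)) (at y)"
  shows "grad_in c f y = d"
  by (simp add: grad_in_def frechet_derivative_at[OF assms, symmetric] inner_axis' vec_eq_iff)

lemma smooth_on_grad_in:
  "smooth_map_on A UNIV f \<Longrightarrow> c \<in> A \<Longrightarrow> smooth_on (cimg c) (\<lambda>y. grad_in c f y $ i)"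
  by (simp add: grad_in_def smooth_on_frechet_derivative smooth_map_on_chart)

text \<open>\<open>differential\<close> is computed in an arbitrarily chosen chart. The chain rule
  for the transition map moves it to \<open>c\<close>, and the transformation law of
  \<open>X\<close> absorbs the transition derivative.\<close>

lemma differential_eq:
  assumes f: "smooth_map_on A UNIV f" and c: "c \<in> A" "x \<in> cdom c" and X: "X \<in> tangent_space A x"
  shows "differential A f x X = X c \<bullet> grad_in c f (cmap c x)"
proof -
  define c' where "c' = chart_at A x"
  have c': "c' \<in> A" "x \<in> cdom c'" using chart_at by (auto simp: c'_def)
  have "((f \<circ> cinv c) \<circ> (cmap c \<circ> cinv c') has_derivative
      (\<lambda>v. v \<bullet> grad_in c f (cmap c x)) \<circ> transition_deriv c' c x) (at (cmap c' x))"
    by (rule diff_chain_at) (use c c' f transition_has_derivative grad_in_has_derivative in auto)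
  then have "((f \<circ> cinv c') has_derivative
      (\<lambda>v. v \<bullet> grad_in c f (cmap c x)) \<circ> transition_deriv c' c x) (at (cmap c' x))"
    by (rule has_derivative_transform_within_open[OF _ cimg_Int_open[OF c'(1) cdom_open[OF c(1)]]])
      (use c c' in auto)
  from frechet_derivative_at[OF this, symmetric]
  have "differential A f x X = transition_deriv c' c x (X c') \<bullet> grad_in c f (cmap c x)"
    by (simp add: differential_def Let_def c'_def[symmetric])
  also have "transition_deriv c' c x (X c') = X c"
    by (rule tangent_transition[OF X c'(1) c(1) c'(2) c(2)])
  finally show ?thesis .
qed

text \<open>The metric coefficients g_ij, taken as functions of the coordinates so that Euclidean
  calculus applies to them.\<close>

definition gram :: "('m, 'n) chart \<Rightarrow> real ^ 'n \<Rightarrow> real ^ 'n ^ 'n" where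
  "gram c y = (\<chi> i j. g (cinv c y) (coord_vec A c i (cinv c y)) (coord_vec A c j (cinv c y)))"

lemma metric_sym: "X \<in> tangent_space A x \<Longrightarrow> Y \<in> tangent_space A x \<Longrightarrow> g x X Y = g x Y X"
  and metric_pos: "X \<in> tangent_space A x \<Longrightarrow> X \<noteq> (\<lambda>c. 0) \<Longrightarrow> g x X X > 0"
  and metric_lin: "X \<in> tangent_space A x \<Longrightarrow> Y \<in> tangent_space A x \<Longrightarrow> Z \<in> tangent_space A x \<Longrightarrow>
    g x (tcomb a X b Y) Z = a * g x X Z + b * g x Y Z"
  using metric unfolding riemannian_metric_def by blast+

lemma tcomb_in_tangent_space:
  assumes "X \<in> tangent_space A x" "Y \<in> tangent_space A x"
  shows "tcomb a X b Y \<in> tangent_space A x"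
proof -
  obtain c where c: "c \<in> A" "x \<in> cdom c" using ex_chart by blast
  have "tcomb a X b Y = lift c x (a *\<^sub>R X c + b *\<^sub>R Y c)"
    using c assms by (simp add: lift_comb lift_eq)
  then show ?thesis using c by simp
qed

lemma metric_eq:
  assumes c: "c \<in> A" "x \<in> cdom c" and X: "X \<in> tangent_space A x" and Y: "Y \<in> tangent_space A x"
  shows "g x X Y = X c \<bullet> (gram c (cmap c x) *v Y c)"
proof -
  have cv: "coord_vec A c i x \<in> tangent_space A x" for i
    using c by (simp add: coord_vec_eq_lift)
  have 1: "g x X Y = (\<Sum>i\<in>UNIV. X c $ i *\<^sub>R g x (coord_vec A c i x) Y)"
    by (rule tangent_expansion[OF c X, of "\<lambda>X. g x X Y"]) (simp add: metric_lin Y)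
  have "g x (coord_vec A c i x) Y = (\<Sum>j\<in>UNIV. Y c $ j *\<^sub>R g x (coord_vec A c i x) (coord_vec A c j x))" for i
    by (rule tangent_expansion[OF c Y, of "\<lambda>Y. g x (coord_vec A c i x) Y"])
      (simp add: metric_lin cv tcomb_in_tangent_space metric_sym[OF cv])
  with 1 show ?thesis
    using c by (simp add: inner_vec_def matrix_vector_mult_def gram_def mult.commute)
qed

lemma posdef_gram:
  assumes "c \<in> A" "y \<in> cimg c"
  shows "posdef (gram c y)"
proof -
  have x: "cinv c y \<in> cdom c" using assms by simp
  have "transpose (gram c y) = gram c y"
    using metric_sym lift_in_tangent_space[OF assms(1) x]
    by (simp add: transpose_def gram_def vec_eq_iff coord_vec_eq_lift)
  moreover have "v \<bullet> (gram c y *v v) > 0" if "v \<noteq> 0" for v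
  proof -
    have "lift c (cinv c y) v \<noteq> (\<lambda>c. 0)"
      using that lift_component[OF assms(1) x] by metis
    with metric_pos[OF lift_in_tangent_space[OF assms(1) x] this] show ?thesis
      using assms x by (simp add: metric_eq[OF assms(1) x])
  qed
  ultimately show ?thesis by (simp add: posdef_def)
qed

lemma smooth_on_gram: "c \<in> A \<Longrightarrow> smooth_on (cimg c) (\<lambda>y. gram c y $ i $ j)"
proof -
  assume c: "c \<in> A"
  then have "smooth_map_on A (cdom c) (\<lambda>x. g x (coord_vec A c i x) (coord_vec A c j x))"
    using metric unfolding riemannian_metric_def by blast
  then have "smooth_on (cmap c ` (cdom c \<inter> cdom c))
      ((\<lambda>x. g x (coord_vec A c i x) (coord_vec A c j x)) \<circ> cinv c)"
    using c unfolding smooth_map_on_def by blast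
  then show ?thesis by (simp add: gram_def comp_def)
qed

lemma sqrt_det_metric_eq: "sqrt_det_metric A g c (cinv c y) = sqrt (det (gram c y))"
  by (simp add: sqrt_det_metric_def gram_def)

lemma smooth_on_sqrt_det: "c \<in> A \<Longrightarrow> smooth_on (cimg c) (\<lambda>y. sqrt (det (gram c y)))"
  by (intro smooth_on_sqrt smooth_on_det smooth_on_gram cimg_open posdef_det_pos posdef_gram) auto

lemma smooth_on_gram_inv: "c \<in> A \<Longrightarrow> smooth_on (cimg c) (\<lambda>y. matrix_inv (gram c y) $ i $ j)"
  by (intro smooth_on_matrix_inv smooth_on_gram cimg_open posdef_gram)

lemma orthonormal_frame_in_chart:
  assumes "c \<in> A" "x \<in> cdom c" "orthonormal_frame A g x e"
  shows "orthonormal_wrt (gram c (cmap c x)) (\<lambda>k. e k c)"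
proof -
  have "e i c \<bullet> (gram c (cmap c x) *v e j c) = g x (e i) (e j)" for i j
    by (rule metric_eq[OF assms(1,2), symmetric]) (use assms(3) in \<open>auto simp: orthonormal_frame_def\<close>)
  then show ?thesis using assms(3) by (simp add: orthonormal_frame_def orthonormal_wrt_def)
qed

text \<open>Guarantees that the choice operator in \<open>sq_norm_nabla\<close> picks a genuine
  orthonormal frame.\<close>

lemma ex_orthonormal_frame: "\<exists>e. orthonormal_frame A g x e"
proof -
  obtain c where c: "c \<in> A" "x \<in> cdom c" using ex_chart by blast
  obtain e where "orthonormal_wrt (gram c (cmap c x)) e"
    using posdef_ex_orthonormal[OF posdef_gram] c by blast
  then have "orthonormal_frame A g x (\<lambda>k. lift c x (e k))"
    using c by (simp add: orthonormal_frame_def orthonormal_wrt_def metric_eq[OF c])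
  then show ?thesis by blast
qed

text \<open>The classical g^ij d_i f d_j f', that is, <grad f, grad f'> in coordinates:
  \<open>grad_in\<close> holds the components of the differentials, and the inverse Gram matrix
  pairs them.\<close>

definition grad_inner :: "('m, 'n) chart \<Rightarrow> ('m \<Rightarrow> real) \<Rightarrow> ('m \<Rightarrow> real) \<Rightarrow> real ^ 'n \<Rightarrow> real" where
  "grad_inner c f f' y = grad_in c f y \<bullet> (matrix_inv (gram c y) *v grad_in c f' y)"

lemma smooth_on_grad_inner:
  assumes "c \<in> A" "smooth_map_on A UNIV f" "smooth_map_on A UNIV f'"
  shows "smooth_on (cimg c) (grad_inner c f f')"
  unfolding grad_inner_def[abs_def] inner_vec_def matrix_vector_mult_def
  using assms
  by (simp, intro smooth_on_sum smooth_on_mult smooth_on_grad_in smooth_on_gram_inv cimg_open)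

text \<open>Parseval's identity for the two differentials.\<close>

lemma frame_sum_differential:
  assumes "c \<in> A" "x \<in> cdom c" "smooth_map_on A UNIV f" "smooth_map_on A UNIV f'"
    and e: "orthonormal_frame A g x e"
  shows "(\<Sum>k\<in>UNIV. differential A f x (e k) * differential A f' x (e k)) = grad_inner c f f' (cmap c x)"
proof -
  have "e k \<in> tangent_space A x" for k using e by (simp add: orthonormal_frame_def)
  then show ?thesis
    using orthonormal_wrt_sum_inner[OF orthonormal_frame_in_chart[OF assms(1,2) e]]
    by (simp add: differential_eq[OF _ assms(1,2)] assms(3,4) grad_inner_def)
qed

text \<open>Resolves the definite description in \<open>gradient\<close>: testing against all
  tangent vectors becomes the linear system \<open>?M *v V c = ?d\<close>, and the Gram matrix is
  invertible.\<close>

lemma gradient_in_chart: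
  assumes c: "c \<in> A" "x \<in> cdom c" and f: "smooth_map_on A UNIV f"
  shows "gradient A g f x = lift c x (matrix_inv (gram c (cmap c x)) *v grad_in c f (cmap c x))"
proof -
  let ?M = "gram c (cmap c x)" and ?d = "grad_in c f (cmap c x)"
  have pd: "posdef ?M" using posdef_gram c by simp
  have inv: "?M ** matrix_inv ?M = mat 1" "matrix_inv ?M ** ?M = mat 1"
    using matrix_inv_mult[OF posdef_invertible[OF pd]] .
  show ?thesis unfolding gradient_def
  proof (rule the_equality, intro conjI ballI)
    show "lift c x (matrix_inv ?M *v ?d) \<in> tangent_space A x" using c by simp
    show "g x (lift c x (matrix_inv ?M *v ?d)) X = differential A f x X" if X: "X \<in> tangent_space A x" for X
      using c X f posdef_inner_sym[OF pd, of _ "X c"]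
      by (simp add: metric_eq[OF c] differential_eq[OF f c] matrix_vector_mul_assoc inv)
  next
    fix V assume V: "V \<in> tangent_space A x \<and> (\<forall>X\<in>tangent_space A x. g x V X = differential A f x X)"
    have "v \<bullet> (?M *v V c) = v \<bullet> ?d" for v
    proof -
      have "g x V (lift c x v) = differential A f x (lift c x v)" using V c by simp
      then show ?thesis
        using c V posdef_inner_sym[OF pd, of _ v] by (simp add: metric_eq[OF c] differential_eq[OF f c])
    qed
    then have "?M *v V c = ?d" by (metis vector_eq_rdot inner_commute)
    then have "V c = matrix_inv ?M *v ?d"
      by (metis inv(2) matrix_vector_mul_assoc matrix_vector_mul_lid)
    then show "V = lift c x (matrix_inv ?M *v ?d)"
      using V c lift_eq[OF c] by metis
  qed
qed

lemma sq_norm_grad_eq: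
  assumes c: "c \<in> A" "x \<in> cdom c" and f: "smooth_map_on A UNIV f"
  shows "sq_norm_grad A g f x = grad_inner c f f (cmap c x)"
proof -
  have pd: "posdef (gram c (cmap c x))" using posdef_gram c by simp
  show ?thesis
    using c matrix_inv_mult[OF posdef_invertible[OF pd]]
    by (simp add: sq_norm_grad_def gradient_in_chart[OF assms] metric_eq[OF c] matrix_vector_mul_assoc
        grad_inner_def inner_commute)
qed

lemma grad_inner_pos:
  assumes "c \<in> A" "y \<in> cimg c" "grad_in c f y \<noteq> 0"
  shows "grad_inner c f f y > 0"
  using posdef_matrix_inv[OF posdef_gram[OF assms(1,2)]] assms(3)
  by (simp add: posdef_def grad_inner_def)

lemma smooth_map_onI:
  assumes "\<And>c. c \<in> A \<Longrightarrow> smooth_on (cimg c) (f \<circ> cinv c)"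
  shows "smooth_map_on A UNIV f"
  using assms by (simp add: smooth_map_on_def)

text \<open>The Laplacian is this sum divided by the positive density, so the sum itself vanishes.
  The coordinate formula for the gradient may be inserted under the derivative because it holds on
  the whole open chart image.\<close>

lemma harmonic_divergence:
  assumes u: "harmonic_function A g u" and c: "c \<in> A" and y: "y \<in> cimg c"
  shows "(\<Sum>i\<in>UNIV. frechet_derivative
      (\<lambda>y. sqrt (det (gram c y)) * (matrix_inv (gram c y) *v grad_in c u y) $ i) (at y) (axis i 1)) = 0"
proof -
  have s: "smooth_map_on A UNIV u" using u by (simp add: harmonic_function_def)
  let ?X = "\<lambda>i y. sqrt (det (gram c y)) * (matrix_inv (gram c y) *v grad_in c u y) $ i"
  have sm: "smooth_on (cimg c) (?X i)" for i
    unfolding matrix_vector_mult_def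
    by (simp, intro smooth_on_mult smooth_on_sum smooth_on_sqrt_det smooth_on_gram_inv smooth_on_grad_in
        cimg_open c s)
  have eq: "?X i y' = sqrt_det_metric A g c (cinv c y') * (gradient A g u (cinv c y') c $ i)"
    if "y' \<in> cimg c" for y' i
    using that c gradient_in_chart[OF c _ s, of "cinv c y'"] by (simp add: sqrt_det_metric_eq)
  have "frechet_derivative (?X i) (at y) = frechet_derivative
      (\<lambda>y'. sqrt_det_metric A g c (cinv c y') * (gradient A g u (cinv c y') c $ i)) (at y)" for i
    by (rule frechet_derivative_transform_within_open[OF _ cimg_open[OF c] y eq])
      (use smooth_on_has_derivative[OF sm y] in \<open>auto intro: differentiableI\<close>)
  moreover have "laplacian_in A g c u (cinv c y) = 0"
    using u c y by (simp add: harmonic_function_def)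
  moreover have "sqrt_det_metric A g c (cinv c y) > 0"
    using posdef_det_pos[OF posdef_gram[OF c y]] by (simp add: sqrt_det_metric_eq)
  ultimately show ?thesis
    using y by (simp add: laplacian_in_def divergence_in_def)
qed

text \<open>The function is constant on coordinate balls, hence locally constant, hence constant by
  connectedness. The contrapositive supplies the point at which the theorem is decided.\<close>

lemma constant_if_grad_eq_0:
  assumes "connected (UNIV :: 'm set)" and f: "smooth_map_on A UNIV f"
    and 0: "\<And>c y. c \<in> A \<Longrightarrow> y \<in> cimg c \<Longrightarrow> grad_in c f y = 0"
  shows "f constant_on UNIV"
proof -
  have "\<exists>T. open T \<and> x \<in> T \<and> (\<forall>z\<in>T. f z = f x)" for x
  proof -
    obtain c where c: "c \<in> A" "x \<in> cdom c" using ex_chart by blast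
    obtain r where r: "r > 0" "ball (cmap c x) r \<subseteq> cimg c"
      using cimg_open[OF c(1)] c(2) open_contains_ball by blast
    let ?T = "cdom c \<inter> cmap c -` ball (cmap c x) r"
    have T: "open ?T" "x \<in> ?T" using c r(1)
      by (auto intro: continuous_open_preimage cmap_continuous cdom_open)
    have fz: "f z = f x" if z: "z \<in> ?T" for z
    proof -
      have "(f \<circ> cinv c) constant_on ball (cmap c x) r"
      proof (rule has_derivative_zero_connected_constant_on[of _ "{}"])
        show "continuous_on (ball (cmap c x) r) (f \<circ> cinv c)"
          by (rule continuous_on_subset[OF smooth_on_continuous_on[OF smooth_map_on_chart[OF f c(1)]] r(2)])
        show "\<forall>y\<in>ball (cmap c x) r - {}.
            ((f \<circ> cinv c) has_derivative (\<lambda>h. 0)) (at y within ball (cmap c x) r)"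
        proof
          fix y assume "y \<in> ball (cmap c x) r - {}"
          then have "y \<in> cimg c" using r(2) by blast
          from grad_in_has_derivative[OF f c(1) this] 0[OF c(1) this]
          show "((f \<circ> cinv c) has_derivative (\<lambda>h. 0)) (at y within ball (cmap c x) r)"
            by (simp add: has_derivative_at_withinI)
        qed
      qed auto
      then have "(f \<circ> cinv c) (cmap c z) = (f \<circ> cinv c) (cmap c x)"
        using z r(1) by (auto simp: constant_on_def)
      then show ?thesis using z c by simp
    qed
    show ?thesis by (rule exI[of _ ?T]) (intro conjI T ballI fz)
  qed
  then have "\<forall>\<^sub>F b in at a. f a = f b" for a
    unfolding eventually_at_topological by metis
  then have "\<forall>a\<in>UNIV. \<forall>\<^sub>F b in at a. f a = f b" by blast
  then show ?thesis
    unfolding constant_on_def using connected_local_const[OF assms(1) UNIV_I UNIV_I, of f undefined]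
    by metis
qed

end

section \<open>Integration in a chart\<close>

context riemannian_manifold
begin

lemma smooth_map_continuous:
  assumes "smooth_map_on A UNIV f"
  shows "continuous_on UNIV f"
proof (rule continuous_at_imp_continuous_on, rule ballI)
  fix x
  obtain c where c: "c \<in> A" "x \<in> cdom c" using ex_chart by blast
  have "continuous_on (cdom c) (\<lambda>z. (f \<circ> cinv c) (cmap c z))"
    by (rule continuous_on_compose2[OF smooth_on_continuous_on[OF smooth_map_on_chart[OF assms c(1)]]
          cmap_continuous[OF c(1)]]) simp
  then have "continuous_on (cdom c) f"
    using c(1) by (simp cong: continuous_on_cong)
  then show "isCont f x"
    using c by (simp add: continuous_on_eq_continuous_at cdom_open)
qed

end

locale riemannian_volume = riemannian_manifold A g
  for A :: "('m::{t2_space, second_countable_topology}, 'n::finite) chart set"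
    and g :: "('m, 'n) metric" +
  fixes vol :: "'m measure"
  assumes volume: "riemannian_measure A g vol"
begin

lemma sets_vol [measurable_cong]: "sets vol = sets borel"
  using volume by (simp add: riemannian_measure_def)

lemma emeasure_vol:
  assumes "c \<in> A" "B \<in> sets borel" "B \<subseteq> cdom c"
  shows "emeasure vol B = (\<integral>\<^sup>+y. ennreal (sqrt (det (gram c y))) * indicator (cmap c ` B) y \<partial>lborel)"
  using volume assms unfolding riemannian_measure_def by (simp add: sqrt_det_metric_eq)

lemma sqrt_det_measurable:
  "c \<in> A \<Longrightarrow> (\<lambda>y. sqrt (det (gram c y))) \<in> borel_measurable (restrict_space borel (cimg c))"
  by (intro borel_measurable_continuous_on_restrict smooth_on_continuous_on smooth_on_sqrt_det)

text \<open>Presents the volume on a chart domain as the image of a weighted Lebesgue measure. The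
  rules for image measures and densities then give the change of variables for functions, not only
  for sets.\<close>

lemma restrict_vol_eq:
  assumes c: "c \<in> A"
  shows "restrict_space vol (cdom c) =
    distr (density (restrict_space lborel (cimg c)) (\<lambda>y. ennreal (sqrt (det (gram c y)))))
      (restrict_space borel (cdom c)) (cinv c)"
    (is "_ = distr ?N ?R _")
proof (rule measure_eqI)
  have cdom: "cdom c \<in> sets borel" and cimg: "cimg c \<in> sets borel"
    using cdom_open[OF c] cimg_open[OF c] by auto
  show "sets (restrict_space vol (cdom c)) = sets (distr ?N ?R (cinv c))"
    by (simp add: sets_restrict_space_cong[OF sets_vol])
  fix X assume "X \<in> sets (restrict_space vol (cdom c))"
  then have X: "X \<in> sets borel" "X \<subseteq> cdom c"
    using cdom by (auto simp: sets_restrict_space_iff sets_vol)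
  have m: "cinv c \<in> measurable ?N ?R"
  proof -
    have "cinv c \<in> measurable (restrict_space borel (cimg c)) ?R"
      by (intro measurable_restrict_space2 borel_measurable_continuous_on_restrict cinv_continuous c)
        (auto simp: space_restrict_space)
    moreover have "sets ?N = sets (restrict_space borel (cimg c))"
      by (simp add: sets_restrict_space_cong[OF sets_lborel])
    ultimately show ?thesis by (simp cong: measurable_cong_sets)
  qed
  have img: "cmap c ` X = cinv c -` X \<inter> cimg c"
    using cimg_Int_eq[OF c, of X] X(2) by (simp add: Int_absorb1 Int_commute[of "cimg c"])
  have XR: "X \<in> sets ?R" using X cdom by (simp add: sets_restrict_space_iff)
  have pre: "cinv c -` X \<inter> cimg c \<in> sets (restrict_space lborel (cimg c))"
    using measurable_sets[OF m XR] by (simp add: space_restrict_space)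
  have sq: "(\<lambda>y. ennreal (sqrt (det (gram c y)))) \<in> borel_measurable (restrict_space lborel (cimg c))"
    using sqrt_det_measurable[OF c]
    by (intro measurable_compose[OF _ measurable_ennreal])
      (simp cong: measurable_cong_sets add: sets_restrict_space_cong[OF sets_lborel])
  have "emeasure (distr ?N ?R (cinv c)) X = emeasure ?N (cinv c -` X \<inter> cimg c)"
    by (simp add: emeasure_distr[OF m XR] space_restrict_space)
  also have "\<dots> = (\<integral>\<^sup>+y. ennreal (sqrt (det (gram c y))) * indicator (cinv c -` X \<inter> cimg c) y
      \<partial>restrict_space lborel (cimg c))"
    by (rule emeasure_density[OF sq pre])
  also have "\<dots> = (\<integral>\<^sup>+y. ennreal (sqrt (det (gram c y))) * indicator (cinv c -` X \<inter> cimg c) y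
      * indicator (cimg c) y \<partial>lborel)"
    by (rule nn_integral_restrict_space) (use cimg in simp)
  also have "\<dots> = (\<integral>\<^sup>+y. ennreal (sqrt (det (gram c y))) * indicator (cmap c ` X) y \<partial>lborel)"
    unfolding img by (intro nn_integral_cong) (auto split: split_indicator)
  also have "\<dots> = emeasure vol X" using emeasure_vol[OF c X] by simp
  also have "\<dots> = emeasure (restrict_space vol (cdom c)) X"
    by (rule emeasure_restrict_space[symmetric]) (use X cdom sets_vol in auto)
  finally show "emeasure (restrict_space vol (cdom c)) X = emeasure (distr ?N ?R (cinv c)) X" by simp
qed

text \<open>The right-hand side is a Henstock-Kurzweil integral over a box, the form in which
  differentiation under the integral and the divergence lemma are applied.\<close>

lemma set_lebesgue_integral_chart:
  assumes c: "c \<in> A" and ab: "cbox a b \<subseteq> cimg c" and f: "continuous_on UNIV f"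
  shows "(LINT x:cinv c ` cbox a b|vol. f x) =
    integral (cbox a b) (\<lambda>y. sqrt (det (gram c y)) * f (cinv c y))"
proof -
  let ?B = "cinv c ` cbox a b" and ?sq = "\<lambda>y. sqrt (det (gram c y))"
  let ?L = "restrict_space lborel (cimg c)" and ?R = "restrict_space borel (cdom c)"
  have cdom: "cdom c \<in> sets borel" and cimg: "cimg c \<in> sets borel"
    using cdom_open[OF c] cimg_open[OF c] by auto
  have "compact ?B"
    by (intro compact_continuous_image continuous_on_subset[OF cinv_continuous[OF c] ab] compact_cbox)
  then have B: "?B \<in> sets borel" by (intro borel_closed compact_imp_closed)
  have Bsub: "?B \<subseteq> cdom c" using ab by auto
  have "cinv c y \<in> ?B \<longleftrightarrow> y \<in> cbox a b" if y: "y \<in> cimg c" for y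
  proof
    assume "cinv c y \<in> ?B"
    then obtain z where z: "z \<in> cbox a b" "cinv c y = cinv c z" by blast
    then have "cmap c (cinv c y) = cmap c (cinv c z)" by simp
    then have "y = z" using y z(1) ab by (simp add: subset_iff del: image_iff)
    then show "y \<in> cbox a b" using z by simp
  qed simp
  then have Bind: "indicator ?B (cinv c y) = (indicator (cbox a b) y :: real)" if "y \<in> cimg c" for y
    using that by (simp add: indicator_def)
  have fm: "f \<in> borel_measurable borel" using f by (rule borel_measurable_continuous_onI)
  have fB: "(\<lambda>x. indicator ?B x *\<^sub>R f x) \<in> borel_measurable ?R"
    using B fm by (intro measurable_restrict_space1) simp
  have sL: "sets ?L = sets (restrict_space borel (cimg c))"
    by (rule sets_restrict_space_cong) simp
  have m: "cinv c \<in> measurable ?L ?R"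
  proof -
    have "cinv c \<in> measurable (restrict_space borel (cimg c)) ?R"
      by (intro measurable_restrict_space2 borel_measurable_continuous_on_restrict cinv_continuous c)
        (auto simp: space_restrict_space)
    then show ?thesis using sL by (simp cong: measurable_cong_sets)
  qed
  have sq: "?sq \<in> borel_measurable ?L"
    using sqrt_det_measurable[OF c] sL by (simp cong: measurable_cong_sets)
  have "(LINT x:?B|vol. f x) = (LINT x|vol. indicator (cdom c) x *\<^sub>R (indicator ?B x *\<^sub>R f x))"
    unfolding set_lebesgue_integral_def using Bsub
    by (intro Bochner_Integration.integral_cong) (auto split: split_indicator)
  also have "\<dots> = (LINT x|restrict_space vol (cdom c). indicator ?B x *\<^sub>R f x)"
    by (rule integral_restrict_space[symmetric]) (use cdom sets_vol in auto)
  also have "\<dots> = (LINT y|density ?L (\<lambda>y. ennreal (?sq y)). indicator ?B (cinv c y) *\<^sub>R f (cinv c y))"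
    unfolding restrict_vol_eq[OF c] by (rule integral_distr) (use m fB in \<open>auto cong: measurable_cong_sets\<close>)
  also have "\<dots> = (LINT y|?L. ?sq y *\<^sub>R (indicator ?B (cinv c y) *\<^sub>R f (cinv c y)))"
    by (rule integral_density[OF measurable_compose[OF m fB] sq])
      (use posdef_det_pos[OF posdef_gram[OF c]] in \<open>auto simp: space_restrict_space intro!: AE_I2 less_imp_le\<close>)
  also have "\<dots> = (LINT y|lborel. indicator (cimg c) y *\<^sub>R (?sq y *\<^sub>R (indicator ?B (cinv c y) *\<^sub>R f (cinv c y))))"
    by (rule integral_restrict_space) (use cimg in simp)
  also have "\<dots> = (LINT y:cbox a b|lborel. ?sq y * f (cinv c y))"
    unfolding set_lebesgue_integral_def using ab Bind
    by (intro Bochner_Integration.integral_cong) (auto split: split_indicator)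
  also have "\<dots> = integral (cbox a b) (\<lambda>y. ?sq y * f (cinv c y))"
  proof (rule set_borel_integral_eq_integral(2))
    have "continuous_on (cbox a b) (\<lambda>y. ?sq y * f (cinv c y))"
      by (intro continuous_intros continuous_on_subset[OF smooth_on_continuous_on[OF smooth_on_sqrt_det[OF c]] ab]
          continuous_on_compose2[OF f continuous_on_subset[OF cinv_continuous[OF c] ab]]) auto
    then show "set_integrable lborel (cbox a b) (\<lambda>y. ?sq y * f (cinv c y))"
      unfolding set_integrable_def by (rule borel_integrable_compact[OF compact_cbox])
  qed
  finally show ?thesis .
qed

text \<open>Each point has a neighbourhood whose image lies in a coordinate box on which the volume
  density is bounded; finitely many such neighbourhoods cover \<open>K\<close>.\<close>

lemma emeasure_vol_compact:
  assumes "compact K"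
  shows "emeasure vol K < \<infinity>"
proof -
  have "\<exists>W. open W \<and> x \<in> W \<and> emeasure vol W < \<infinity>" for x
  proof -
    obtain c where c: "c \<in> A" "x \<in> cdom c" using ex_chart by blast
    obtain a b where ab: "cbox a b \<subseteq> cimg c" "cmap c x \<in> box a b"
      by (rule open_contains_cbox[OF cimg_open[OF c(1)] imageI[OF c(2)]])
    let ?W = "cdom c \<inter> cmap c -` box a b" and ?sq = "\<lambda>y. sqrt (det (gram c y))"
    have W: "open ?W"
      by (intro continuous_open_preimage cmap_continuous cdom_open c open_box)
    have "compact (?sq ` cbox a b)"
      by (intro compact_continuous_image compact_cbox
          continuous_on_subset[OF smooth_on_continuous_on[OF smooth_on_sqrt_det[OF c(1)]] ab(1)])
    then obtain M where M: "\<And>y. y \<in> cbox a b \<Longrightarrow> norm (?sq y) \<le> M"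
      using compact_imp_bounded bounded_iff by (metis image_eqI)
    have "emeasure vol ?W = (\<integral>\<^sup>+y. ennreal (?sq y) * indicator (cmap c ` ?W) y \<partial>lborel)"
      using W by (intro emeasure_vol c) auto
    also have "\<dots> \<le> (\<integral>\<^sup>+y. ennreal M * indicator (cbox a b) y \<partial>lborel)"
    proof (intro nn_integral_mono)
      fix y
      show "ennreal (?sq y) * indicator (cmap c ` ?W) y \<le> ennreal M * indicator (cbox a b) y"
        using M[of y] box_subset_cbox[of a b] by (auto split: split_indicator intro!: ennreal_leI)
    qed
    also have "\<dots> < \<infinity>"
      using emeasure_lborel_cbox_finite[of a b]
      by (simp add: nn_integral_cmult_indicator ennreal_mult_less_top)
    finally show ?thesis using W c ab(2) by (intro exI[of _ ?W]) auto
  qed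
  then obtain W where W: "\<And>x. open (W x)" "\<And>x. x \<in> W x" "\<And>x. emeasure vol (W x) < \<infinity>" by metis
  obtain F where F: "finite F" "K \<subseteq> (\<Union>x\<in>F. W x)"
    using compactE_image[OF assms, of K W] W by (metis UN_I subsetI)
  have "emeasure vol K \<le> emeasure vol (\<Union>x\<in>F. W x)"
    by (rule emeasure_mono[OF F(2)]) (use F W sets_vol in auto)
  also have "\<dots> \<le> (\<Sum>x\<in>F. emeasure vol (W x))"
    by (rule emeasure_subadditive_finite[OF F(1)]) (use W sets_vol in auto)
  also have "\<dots> < \<infinity>" using W(3) F(1) by simp
  finally show ?thesis .
qed

text \<open>Energy integrals may be subtracted from one another only if each exists. Compactness of
  the closure bounds \<open>f\<close> on \<open>D\<close> and makes the volume of \<open>D\<close>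
  finite.\<close>

lemma set_integrable_vol:
  fixes f :: "'m \<Rightarrow> real"
  assumes f: "continuous_on UNIV f" and D: "D \<in> sets borel" "compact (closure D)"
  shows "set_integrable vol D f"
proof -
  have "bounded (f ` closure D)"
    by (intro compact_imp_bounded compact_continuous_image D continuous_on_subset[OF f]) auto
  then obtain M where M: "\<And>x. x \<in> D \<Longrightarrow> norm (f x) \<le> M"
    unfolding bounded_iff using closure_subset[of D] by blast
  have "emeasure vol D \<le> emeasure vol (closure D)"
    by (rule emeasure_mono[OF closure_subset]) (simp add: sets_vol)
  then have "emeasure vol D < \<infinity>" using emeasure_vol_compact[OF D(2)] by (rule le_less_trans)
  moreover have "f \<in> borel_measurable vol"
    using borel_measurable_continuous_onI[OF f] sets_vol by (simp cong: measurable_cong_sets)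
  ultimately show ?thesis
    unfolding set_integrable_def using D(1) M sets_vol
    by (intro integrableI_bounded_set_indicator[of _ _ _ M]) auto
qed

end

section \<open>Sections of the bundle\<close>

locale metric_vector_bundle = riemannian_manifold A g
  for A :: "('m::{t2_space, second_countable_topology}, 'n::finite) chart set"
    and g :: "('m, 'n) metric" +
  fixes E :: "'m \<Rightarrow> 'v::real_vector set"
    and T :: "('m, 'v, 'k::finite) triv set"
    and h :: "'m \<Rightarrow> 'v \<Rightarrow> 'v \<Rightarrow> real"
    and nabla :: "('m, 'n, 'v) conn"
  assumes vector_bundle: "oriented_vector_bundle A E T"
    and fibre: "fibre_metric A E T h"
    and connection: "connection A E T nabla"
    and compatible: "metric_compatible A E T h nabla"
begin

lemma fibre_subspace: "subspace (E x)"
  using vector_bundle by (simp add: oriented_vector_bundle_def)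

lemma ex_triv: "\<exists>W \<tau>. (W, \<tau>) \<in> T \<and> x \<in> W"
proof -
  have "x \<in> (\<Union>(W, \<tau>)\<in>T. W)" using vector_bundle by (simp add: oriented_vector_bundle_def)
  then show ?thesis by blast
qed

lemma triv:
  assumes "(W, \<tau>) \<in> T"
  shows "open W" "x \<in> W \<Longrightarrow> bij_betw (\<tau> x) (E x) UNIV"
    "x \<in> W \<Longrightarrow> v \<in> E x \<Longrightarrow> w \<in> E x \<Longrightarrow> \<tau> x (a *\<^sub>R v + b *\<^sub>R w) = a *\<^sub>R \<tau> x v + b *\<^sub>R \<tau> x w"
  using vector_bundle assms unfolding oriented_vector_bundle_def by blast+

lemma h_sym: "v \<in> E x \<Longrightarrow> w \<in> E x \<Longrightarrow> h x v w = h x w v"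
  and h_pos: "v \<in> E x \<Longrightarrow> v \<noteq> 0 \<Longrightarrow> h x v v > 0"
  and h_comb: "v \<in> E x \<Longrightarrow> w \<in> E x \<Longrightarrow> z \<in> E x \<Longrightarrow> h x (a *\<^sub>R v + b *\<^sub>R w) z = a * h x v z + b * h x w z"
  using fibre unfolding fibre_metric_def by blast+

lemma fibre_comb: "v \<in> E x \<Longrightarrow> w \<in> E x \<Longrightarrow> a *\<^sub>R v + b *\<^sub>R w \<in> E x"
  using fibre_subspace by (simp add: subspace_add subspace_scale)

lemma h_comb_right:
  "v \<in> E x \<Longrightarrow> w \<in> E x \<Longrightarrow> z \<in> E x \<Longrightarrow> h x z (a *\<^sub>R v + b *\<^sub>R w) = a * h x z v + b * h x z w"
  using h_comb fibre_comb h_sym by metis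

lemma h_zero: "z \<in> E x \<Longrightarrow> h x 0 z = 0"
  using h_comb[of 0 x 0 z 0 0] fibre_subspace[of x] by (simp add: subspace_0)

lemma h_nonneg: "v \<in> E x \<Longrightarrow> h x v v \<ge> 0"
  using h_pos[of v x] h_zero[of v x] by (cases "v = 0") auto

lemma h_comb_self:
  assumes "v \<in> E x" "w \<in> E x"
  shows "h x (a *\<^sub>R v + b *\<^sub>R w) (a *\<^sub>R v + b *\<^sub>R w) = a\<^sup>2 * h x v v + 2 * a * b * h x v w + b\<^sup>2 * h x w w"
  using assms h_sym[OF assms]
  by (simp add: h_comb h_comb_right fibre_comb power2_eq_square algebra_simps)

text \<open>The squared norm of <w,w> v - <v,w> w is nonnegative and equals <w,w> times the
  difference of the two sides.\<close>

lemma h_cauchy_schwarz: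
  assumes "v \<in> E x" "w \<in> E x"
  shows "(h x v w)\<^sup>2 \<le> h x v v * h x w w"
proof (cases "w = 0")
  case True
  then show ?thesis using assms h_zero[of v x] h_zero[of 0 x] h_sym[OF assms] by simp
next
  case False
  then have pos: "h x w w > 0" using assms h_pos by blast
  have "0 \<le> h x (h x w w *\<^sub>R v + (- h x v w) *\<^sub>R w) (h x w w *\<^sub>R v + (- h x v w) *\<^sub>R w)"
    by (intro h_nonneg fibre_comb assms)
  also have "\<dots> = h x w w * (h x v v * h x w w - (h x v w)\<^sup>2)"
    by (simp only: h_comb_self[OF assms]) (simp add: power2_eq_square algebra_simps)
  finally show ?thesis using pos by (simp add: zero_le_mult_iff)
qed

text \<open>The fibres carry no topology, so smoothness is visible only in a trivialisation.
  Expanding both arguments there reduces \<open>h\<close> to the matrix of the fibre metric, whose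
  entries are smooth.\<close>

lemma h_trivialised:
  assumes W: "(W, \<tau>) \<in> T" "x \<in> W" and v: "v \<in> E x" and w: "w \<in> E x"
  shows "h x v w = (\<Sum>i\<in>UNIV. \<Sum>j\<in>UNIV. \<tau> x v $ i * (\<tau> x w $ j *
    h x (inv_into (E x) (\<tau> x) (axis i 1)) (inv_into (E x) (\<tau> x) (axis j 1))))"
proof -
  let ?i = "inv_into (E x) (\<tau> x)"
  have bij: "bij_betw (\<tau> x) (E x) UNIV" using triv(2)[OF W] .
  have iE: "?i z \<in> E x" and ti: "\<tau> x (?i z) = z" for z
    using bij by (auto simp: bij_betw_def inv_into_into f_inv_into_f)
  have it: "?i (\<tau> x v) = v" if "v \<in> E x" for v
    using that bij by (simp add: bij_betw_def)
  have ilin: "?i (a *\<^sub>R z + b *\<^sub>R z') = a *\<^sub>R ?i z + b *\<^sub>R ?i z'" for a b z z'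
    using it[OF fibre_comb[OF iE iE], of a z b z'] triv(3)[OF W iE iE] by (simp add: ti)
  have lin: "linear (\<lambda>z. h x (?i z) w)" if w: "w \<in> E x" for w
  proof (rule linearI)
    show "h x (?i (z + z')) w = h x (?i z) w + h x (?i z') w" for z z'
      using ilin[of 1 z 1 z'] h_comb[OF iE iE w, of 1 z 1 z'] by simp
    show "h x (?i (r *\<^sub>R z)) w = r *\<^sub>R h x (?i z) w" for r z
      using ilin[of r z 0 z] h_comb[OF iE iE w, of r z 0 z] by simp
  qed
  have "h x v w = (\<Sum>i\<in>UNIV. \<tau> x v $ i * h x (?i (axis i 1)) w)"
    using linear_axis_expansion[OF lin[OF w], of "\<tau> x v"] v by (simp add: it)
  moreover have "h x (?i (axis i 1)) w =
      (\<Sum>j\<in>UNIV. \<tau> x w $ j * h x (?i (axis i 1)) (?i (axis j 1)))" for i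
    using linear_axis_expansion[OF lin[OF iE[of "axis i 1"]], of "\<tau> x w"] w
    by (simp add: it h_sym[OF iE w] h_sym[OF iE iE])
  ultimately show ?thesis by (simp add: sum_distrib_left)
qed

lemma smooth_on_h:
  assumes W: "(W, \<tau>) \<in> T" and c: "c \<in> A"
    and v: "\<And>x. x \<in> cdom c \<inter> W \<Longrightarrow> v x \<in> E x"
      "smooth_on (cmap c ` (cdom c \<inter> W)) ((\<lambda>x. \<tau> x (v x)) \<circ> cinv c)"
    and w: "\<And>x. x \<in> cdom c \<inter> W \<Longrightarrow> w x \<in> E x"
      "smooth_on (cmap c ` (cdom c \<inter> W)) ((\<lambda>x. \<tau> x (w x)) \<circ> cinv c)"
  shows "smooth_on (cmap c ` (cdom c \<inter> W)) ((\<lambda>x. h x (v x) (w x)) \<circ> cinv c)"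
proof -
  let ?H = "\<lambda>i j x. h x (inv_into (E x) (\<tau> x) (axis i 1)) (inv_into (E x) (\<tau> x) (axis j 1))"
  have o: "open (cmap c ` (cdom c \<inter> W))" by (rule cimg_Int_open[OF c triv(1)[OF W]])
  have "smooth_map_on A W (?H i j)" for i j
    using fibre W unfolding fibre_metric_def by blast
  then have H: "smooth_on (cmap c ` (cdom c \<inter> W)) (\<lambda>y. ?H i j (cinv c y))" for i j
    using c by (simp add: smooth_map_on_def comp_def)
  have "smooth_on (cmap c ` (cdom c \<inter> W)) (\<lambda>y. \<Sum>i\<in>UNIV. \<Sum>j\<in>UNIV.
      \<tau> (cinv c y) (v (cinv c y)) $ i * (\<tau> (cinv c y) (w (cinv c y)) $ j * ?H i j (cinv c y)))"
    using v(2) w(2) unfolding comp_def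
    by (intro smooth_on_sum smooth_on_mult smooth_on_vec_nth H o)
  then show ?thesis
    by (rule smooth_on_cong[OF o, rotated])
      (use c v(1) w(1) in \<open>auto intro!: h_trivialised[OF W, symmetric]\<close>)
qed

text \<open>A chart domain need not lie in one trivialisation domain, so smoothness is patched from
  the overlaps.\<close>

lemma smooth_on_triv_local:
  assumes c: "c \<in> A"
    and "\<And>W \<tau>. (W, \<tau>) \<in> T \<Longrightarrow> smooth_on (cmap c ` (cdom c \<inter> W)) f"
  shows "smooth_on (cimg c) f"
proof (rule smooth_on_local)
  fix y assume y: "y \<in> cimg c"
  obtain W \<tau> where W: "(W, \<tau>) \<in> T" "cinv c y \<in> W" using ex_triv by blast
  have "y \<in> cmap c ` (cdom c \<inter> W)"
    using y W(2) by (simp add: cimg_Int_eq[OF c])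
  then show "\<exists>S. open S \<and> y \<in> S \<and> smooth_on S f"
    using cimg_Int_open[OF c triv(1)[OF W(1)]] assms(2)[OF W(1)] by blast
qed

lemma section_in: "smooth_section A E T s \<Longrightarrow> s x \<in> E x"
  by (simp add: smooth_section_def)

lemma section_smooth:
  "smooth_section A E T s \<Longrightarrow> c \<in> A \<Longrightarrow> (W, \<tau>) \<in> T \<Longrightarrow>
    smooth_on (cmap c ` (cdom c \<inter> W)) ((\<lambda>x. \<tau> x (s x)) \<circ> cinv c)"
  unfolding smooth_section_def smooth_map_on_def by blast

lemma smooth_sq_norm:
  assumes s: "smooth_section A E T s"
  shows "smooth_map_on A UNIV (sq_norm h s)"
proof (rule smooth_map_onI)
  fix c assume c: "c \<in> A"
  show "smooth_on (cimg c) (sq_norm h s \<circ> cinv c)"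
  proof (rule smooth_on_triv_local[OF c])
    fix W \<tau> assume W: "(W, \<tau>) \<in> T"
    show "smooth_on (cmap c ` (cdom c \<inter> W)) (sq_norm h s \<circ> cinv c)"
      using smooth_on_h[OF W c section_in[OF s] section_smooth[OF s c W]
          section_in[OF s] section_smooth[OF s c W]]
      by (simp add: sq_norm_def[abs_def])
  qed
qed

lemma sq_norm_nonneg: "smooth_section A E T s \<Longrightarrow> sq_norm h s x \<ge> 0"
  by (simp add: sq_norm_def h_nonneg section_in)

lemma nabla_in: "smooth_section A E T s \<Longrightarrow> X \<in> tangent_space A x \<Longrightarrow> nabla s x X \<in> E x"
  and nabla_comb: "smooth_section A E T s \<Longrightarrow> X \<in> tangent_space A x \<Longrightarrow> Y \<in> tangent_space A x \<Longrightarrow>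
    nabla s x (tcomb a X b Y) = a *\<^sub>R nabla s x X + b *\<^sub>R nabla s x Y"
  and nabla_scale: "smooth_section A E T s \<Longrightarrow> X \<in> tangent_space A x \<Longrightarrow> smooth_map_on A UNIV f \<Longrightarrow>
    nabla (\<lambda>y. f y *\<^sub>R s y) x X = differential A f x X *\<^sub>R s x + f x *\<^sub>R nabla s x X"
  using connection unfolding connection_def by blast+

lemma nabla_smooth:
  "smooth_section A E T s \<Longrightarrow> c \<in> A \<Longrightarrow> (W, \<tau>) \<in> T \<Longrightarrow>
    smooth_on (cmap c ` (cdom c \<inter> W)) ((\<lambda>x. \<tau> x (nabla s x (coord_vec A c i x))) \<circ> cinv c)"
proof -
  assume s: "smooth_section A E T s" and c: "c \<in> A" and W: "(W, \<tau>) \<in> T"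
  then have "smooth_map_on A (cdom c \<inter> W) (\<lambda>x. \<tau> x (nabla s x (coord_vec A c i x)))"
    using connection unfolding connection_def by blast
  then have "smooth_on (cmap c ` (cdom c \<inter> (cdom c \<inter> W))) ((\<lambda>x. \<tau> x (nabla s x (coord_vec A c i x))) \<circ> cinv c)"
    using c unfolding smooth_map_on_def by blast
  then show ?thesis by (simp add: Int_assoc[symmetric])
qed

text \<open>Metric compatibility with both sections equal; symmetry of \<open>h\<close> merges the
  two terms.\<close>

lemma differential_sq_norm:
  assumes s: "smooth_section A E T s" and X: "X \<in> tangent_space A x"
  shows "differential A (sq_norm h s) x X = 2 * h x (s x) (nabla s x X)"
  using compatible s X h_sym[OF section_in[OF s] nabla_in[OF s X]]
  unfolding metric_compatible_def sq_norm_def[abs_def] by simp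

text \<open>The frame in the definition is chosen separately at each point, with no regularity in
  \<open>x\<close>. Summing over the frame leaves only the inverse Gram matrix, from which
  smoothness can be read off.\<close>

lemma sq_norm_nabla_eq:
  assumes s: "smooth_section A E T s" and c: "c \<in> A" "x \<in> cdom c"
  shows "sq_norm_nabla A g h nabla s x = (\<Sum>i\<in>UNIV. \<Sum>j\<in>UNIV. matrix_inv (gram c (cmap c x)) $ i $ j *
    h x (nabla s x (coord_vec A c i x)) (nabla s x (coord_vec A c j x)))"
proof -
  define e where "e = (SOME e. orthonormal_frame A g x e)"
  have e: "orthonormal_frame A g x e"
    unfolding e_def by (rule someI_ex[OF ex_orthonormal_frame])
  then have et: "e k \<in> tangent_space A x" for k by (simp add: orthonormal_frame_def)
  let ?n = "\<lambda>i. nabla s x (coord_vec A c i x)"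
  have cv: "coord_vec A c i x \<in> tangent_space A x" for i
    using c by (simp add: coord_vec_eq_lift)
  have nE: "nabla s x X \<in> E x" if "X \<in> tangent_space A x" for X using nabla_in[OF s that] .
  have 1: "h x (nabla s x X) w = (\<Sum>i\<in>UNIV. X c $ i *\<^sub>R h x (?n i) w)"
    if X: "X \<in> tangent_space A x" and w: "w \<in> E x" for X w
    by (rule tangent_expansion[OF c X, of "\<lambda>X. h x (nabla s x X) w"])
      (simp add: nabla_comb[OF s] h_comb nE w)
  have "h x (nabla s x X) (nabla s x X) =
      (\<Sum>i\<in>UNIV. \<Sum>j\<in>UNIV. X c $ i * X c $ j * h x (?n i) (?n j))" if X: "X \<in> tangent_space A x" for X
  proof -
    have "h x (?n i) (nabla s x X) = (\<Sum>j\<in>UNIV. X c $ j * h x (?n i) (?n j))" for i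
      using 1[OF X nE[OF cv[of i]]] by (simp add: h_sym[OF nE[OF cv] nE[OF X]] h_sym[OF nE[OF cv] nE[OF cv]])
    then show ?thesis using 1[OF X nE[OF X]] by (simp add: sum_distrib_left mult.assoc)
  qed
  then have "sq_norm_nabla A g h nabla s x =
      (\<Sum>k\<in>UNIV. \<Sum>i\<in>UNIV. \<Sum>j\<in>UNIV. e k c $ i * e k c $ j * h x (?n i) (?n j))"
    by (simp add: sq_norm_nabla_def e_def[symmetric] et)
  also have "\<dots> = (\<Sum>i\<in>UNIV. \<Sum>k\<in>UNIV. \<Sum>j\<in>UNIV. e k c $ i * e k c $ j * h x (?n i) (?n j))"
    by (rule sum.swap)
  also have "\<dots> = (\<Sum>i\<in>UNIV. \<Sum>j\<in>UNIV. \<Sum>k\<in>UNIV. e k c $ i * e k c $ j * h x (?n i) (?n j))"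
    by (intro sum.cong refl sum.swap)
  also have "\<dots> = (\<Sum>i\<in>UNIV. \<Sum>j\<in>UNIV. (\<Sum>k\<in>UNIV. e k c $ i * e k c $ j) * h x (?n i) (?n j))"
    by (simp add: sum_distrib_right)
  finally show ?thesis
    by (simp add: orthonormal_wrt_matrix(3)[OF orthonormal_frame_in_chart[OF c e]])
qed

lemma smooth_sq_norm_nabla:
  assumes s: "smooth_section A E T s"
  shows "smooth_map_on A UNIV (sq_norm_nabla A g h nabla s)"
proof (rule smooth_map_onI)
  fix c assume c: "c \<in> A"
  show "smooth_on (cimg c) (sq_norm_nabla A g h nabla s \<circ> cinv c)"
  proof (rule smooth_on_triv_local[OF c])
    fix W \<tau> assume W: "(W, \<tau>) \<in> T"
    let ?n = "\<lambda>i x. nabla s x (coord_vec A c i x)"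
    let ?S = "cmap c ` (cdom c \<inter> W)"
    have o: "open ?S" by (rule cimg_Int_open[OF c triv(1)[OF W]])
    have nE: "?n i x \<in> E x" if "x \<in> cdom c \<inter> W" for i x
      using that c by (intro nabla_in s) (simp add: coord_vec_eq_lift)
    have "smooth_on ?S (\<lambda>y. h (cinv c y) (?n i (cinv c y)) (?n j (cinv c y)))" for i j
      using smooth_on_h[OF W c nE nabla_smooth[OF s c W] nE nabla_smooth[OF s c W]] by (simp add: comp_def)
    then have "smooth_on ?S (\<lambda>y. \<Sum>i\<in>UNIV. \<Sum>j\<in>UNIV. matrix_inv (gram c y) $ i $ j *
        h (cinv c y) (?n i (cinv c y)) (?n j (cinv c y)))"
      by (intro smooth_on_sum smooth_on_mult o smooth_on_subset[OF smooth_on_gram_inv[OF c]]) auto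
    then show "smooth_on ?S (sq_norm_nabla A g h nabla s \<circ> cinv c)"
      by (rule smooth_on_cong[OF o, rotated]) (use c in \<open>auto simp: sq_norm_nabla_eq[OF s c]\<close>)
  qed
qed

lemma smooth_sq_norm_grad:
  assumes f: "smooth_map_on A UNIV f"
  shows "smooth_map_on A UNIV (sq_norm_grad A g f)"
proof (rule smooth_map_onI)
  fix c assume c: "c \<in> A"
  show "smooth_on (cimg c) (sq_norm_grad A g f \<circ> cinv c)"
    by (rule smooth_on_cong[OF cimg_open[OF c] _ smooth_on_grad_inner[OF c f f]])
      (use c in \<open>auto simp: sq_norm_grad_eq[OF c _ f]\<close>)
qed

lemma sq_norm_nabla_nonneg:
  assumes s: "smooth_section A E T s"
  shows "sq_norm_nabla A g h nabla s x \<ge> 0"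
proof -
  define e where "e = (SOME e. orthonormal_frame A g x e)"
  have "orthonormal_frame A g x e"
    unfolding e_def by (rule someI_ex[OF ex_orthonormal_frame])
  then have et: "e k \<in> tangent_space A x" for k by (simp add: orthonormal_frame_def)
  show ?thesis
    unfolding sq_norm_nabla_def Let_def e_def[symmetric]
    by (intro sum_nonneg h_nonneg nabla_in[OF s] et)
qed

text \<open>With u = |s|^2 one has du(e_k) = 2 <s, nabla s(e_k)>. Cauchy-Schwarz applied to each
  term before summing produces the factor 4 u.\<close>

lemma grad_sq_norm_le:
  assumes s: "smooth_section A E T s" and c: "c \<in> A" "x \<in> cdom c"
  shows "grad_inner c (sq_norm h s) (sq_norm h s) (cmap c x)
    \<le> 4 * sq_norm h s x * sq_norm_nabla A g h nabla s x"
proof -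
  define e where "e = (SOME e. orthonormal_frame A g x e)"
  have e: "orthonormal_frame A g x e"
    unfolding e_def by (rule someI_ex[OF ex_orthonormal_frame])
  then have et: "e k \<in> tangent_space A x" for k by (simp add: orthonormal_frame_def)
  have "grad_inner c (sq_norm h s) (sq_norm h s) (cmap c x) =
      (\<Sum>k\<in>UNIV. 4 * (h x (s x) (nabla s x (e k)))\<^sup>2)"
    using frame_sum_differential[OF c smooth_sq_norm[OF s] smooth_sq_norm[OF s] e]
    by (simp add: differential_sq_norm[OF s et] power2_eq_square mult.assoc)
  also have "\<dots> \<le> (\<Sum>k\<in>UNIV. 4 * (sq_norm h s x * h x (nabla s x (e k)) (nabla s x (e k))))"
    unfolding sq_norm_def
    by (intro sum_mono mult_left_mono h_cauchy_schwarz section_in[OF s] nabla_in[OF s et]) simp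
  also have "\<dots> = 4 * sq_norm h s x * sq_norm_nabla A g h nabla s x"
    by (simp add: sq_norm_nabla_def e_def[symmetric] sum_distrib_left mult.assoc)
  finally show ?thesis .
qed

lemma smooth_map_on_mult:
  fixes f f' :: "'m \<Rightarrow> real"
  assumes "smooth_map_on A UNIV f" "smooth_map_on A UNIV f'"
  shows "smooth_map_on A UNIV (\<lambda>x. f x * f' x)"
proof (rule smooth_map_onI)
  fix c assume c: "c \<in> A"
  show "smooth_on (cimg c) ((\<lambda>x. f x * f' x) \<circ> cinv c)"
    using smooth_on_mult[OF cimg_open[OF c] smooth_map_on_chart[OF assms(1) c] smooth_map_on_chart[OF assms(2) c]]
    by (simp add: comp_def)
qed

lemma smooth_map_on_const: "smooth_map_on A UNIV (\<lambda>x. k :: real)"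
  by (rule smooth_map_onI) (simp add: comp_def smooth_on_const cimg_open)

lemma smooth_map_on_affine:
  assumes "smooth_map_on A UNIV f"
  shows "smooth_map_on A UNIV (\<lambda>x. 1 + t * f x :: real)"
proof (rule smooth_map_onI)
  fix c assume c: "c \<in> A"
  have "smooth_on (cimg c) (\<lambda>y. 1 + t * (f \<circ> cinv c) y)"
    by (intro smooth_on_add smooth_on_mult smooth_on_const cimg_open c smooth_map_on_chart assms)
  then show "smooth_on (cimg c) ((\<lambda>x. 1 + t * f x) \<circ> cinv c)"
    by (simp add: comp_def)
qed

lemma smooth_section_scale:
  assumes f: "smooth_map_on A UNIV f" and s: "smooth_section A E T s"
  shows "smooth_section A E T (\<lambda>x. f x *\<^sub>R s x)"
  unfolding smooth_section_def smooth_map_on_def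
proof (safe)
  show "f x *\<^sub>R s x \<in> E x" for x
    using fibre_subspace section_in[OF s] by (simp add: subspace_scale)
  fix W \<tau> c assume W: "(W, \<tau>) \<in> T" and c: "c \<in> A"
  have o: "open (cmap c ` (cdom c \<inter> W))" by (rule cimg_Int_open[OF c triv(1)[OF W]])
  have "smooth_on (cmap c ` (cdom c \<inter> W)) (\<lambda>y. (f \<circ> cinv c) y *\<^sub>R ((\<lambda>x. \<tau> x (s x)) \<circ> cinv c) y)"
    by (intro smooth_on_scaleR o section_smooth s c W smooth_on_subset[OF smooth_map_on_chart[OF f c]]) auto
  then show "smooth_on (cmap c ` (cdom c \<inter> W)) ((\<lambda>x. \<tau> x (f x *\<^sub>R s x)) \<circ> cinv c)"
  proof (rule smooth_on_cong[OF o, rotated])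
    fix y assume "y \<in> cmap c ` (cdom c \<inter> W)"
    then have "cinv c y \<in> W" using c by auto
    from triv(3)[OF W this section_in[OF s] section_in[OF s], of "f (cinv c y)" 0]
    show "(f \<circ> cinv c) y *\<^sub>R ((\<lambda>x. \<tau> x (s x)) \<circ> cinv c) y = ((\<lambda>x. \<tau> x (f x *\<^sub>R s x)) \<circ> cinv c) y"
      by simp
  qed
qed

section \<open>Norms of a rescaled section\<close>

lemma sq_norm_scale:
  assumes s: "smooth_section A E T s"
  shows "sq_norm h (\<lambda>x. f x *\<^sub>R s x) x = (f x)\<^sup>2 * sq_norm h s x"
  using h_comb_self[OF section_in[OF s, of x] section_in[OF s, of x], of "f x" 0] by (simp add: sq_norm_def)

text \<open>Expand nabla(f s) = df s + f nabla s. By metric compatibility the mixed term 2 f df(e_k)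
  <s, nabla s(e_k)> is f df(e_k) d|s|^2(e_k), so it sums to <grad f, grad |s|^2>.\<close>

lemma sq_norm_nabla_scale:
  assumes f: "smooth_map_on A UNIV f" and s: "smooth_section A E T s" and c: "c \<in> A" "x \<in> cdom c"
  shows "sq_norm_nabla A g h nabla (\<lambda>x. f x *\<^sub>R s x) x =
    (f x)\<^sup>2 * sq_norm_nabla A g h nabla s x + f x * grad_inner c f (sq_norm h s) (cmap c x)
    + sq_norm h s x * grad_inner c f f (cmap c x)"
proof -
  define e where "e = (SOME e. orthonormal_frame A g x e)"
  have e: "orthonormal_frame A g x e"
    unfolding e_def by (rule someI_ex[OF ex_orthonormal_frame])
  then have et: "e k \<in> tangent_space A x" for k by (simp add: orthonormal_frame_def)
  have "h x (nabla (\<lambda>x. f x *\<^sub>R s x) x (e k)) (nabla (\<lambda>x. f x *\<^sub>R s x) x (e k)) =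
     (f x)\<^sup>2 * h x (nabla s x (e k)) (nabla s x (e k))
     + f x * (differential A f x (e k) * differential A (sq_norm h s) x (e k))
     + sq_norm h s x * (differential A f x (e k) * differential A f x (e k))" for k
    using h_comb_self[OF section_in[OF s] nabla_in[OF s et[of k]], of "differential A f x (e k)" "f x"]
    by (simp add: nabla_scale[OF s et f] differential_sq_norm[OF s et] sq_norm_def power2_eq_square algebra_simps)
  then have "sq_norm_nabla A g h nabla (\<lambda>x. f x *\<^sub>R s x) x =
      (f x)\<^sup>2 * (\<Sum>k\<in>UNIV. h x (nabla s x (e k)) (nabla s x (e k)))
     + f x * (\<Sum>k\<in>UNIV. differential A f x (e k) * differential A (sq_norm h s) x (e k))
     + sq_norm h s x * (\<Sum>k\<in>UNIV. differential A f x (e k) * differential A f x (e k))"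
    by (simp add: sq_norm_nabla_def e_def[symmetric] sum.distrib sum_distrib_left)
  then show ?thesis
    by (simp add: frame_sum_differential[OF c _ _ e] f smooth_sq_norm[OF s])
      (simp add: sq_norm_nabla_def e_def[symmetric])
qed

text \<open>For u = |s|^2 the function is F of the section f s. Its gradient is (f^2/2) grad u + f u
  grad f, and the three terms are the expansion of the squared length.\<close>

lemma sq_norm_grad_scale:
  assumes f: "smooth_map_on A UNIV f" and u: "smooth_map_on A UNIV u" and c: "c \<in> A" "x \<in> cdom c"
  shows "sq_norm_grad A g (\<lambda>x. 1/2 * ((f x)\<^sup>2 * u x)) x =
    (f x)^4 * grad_inner c u u (cmap c x) / 4 + (f x)^3 * u x * grad_inner c f u (cmap c x)
    + (f x)\<^sup>2 * (u x)\<^sup>2 * grad_inner c f f (cmap c x)"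
proof -
  let ?y = "cmap c x" and ?F = "\<lambda>x. 1/2 * ((f x)\<^sup>2 * u x)"
  have y: "?y \<in> cimg c" using c by simp
  have F: "smooth_map_on A UNIV ?F"
    unfolding power2_eq_square by (intro smooth_map_on_mult smooth_map_on_const f u)
  have "((\<lambda>z. 1/2 * (((f \<circ> cinv c) z)\<^sup>2 * (u \<circ> cinv c) z)) has_derivative
      (\<lambda>v. v \<bullet> (((f x)\<^sup>2 / 2) *\<^sub>R grad_in c u ?y + (f x * u x) *\<^sub>R grad_in c f ?y))) (at ?y)"
    by (rule derivative_eq_intros grad_in_has_derivative[OF f c(1) y] grad_in_has_derivative[OF u c(1) y] refl)+
      (use c in \<open>simp add: inner_add_right fun_eq_iff algebra_simps\<close>)
  then have gF: "grad_in c ?F ?y = ((f x)\<^sup>2 / 2) *\<^sub>R grad_in c u ?y + (f x * u x) *\<^sub>R grad_in c f ?y"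
    by (intro grad_in_unique) (simp add: comp_def)
  have sym: "grad_inner c u f ?y = grad_inner c f u ?y"
    unfolding grad_inner_def by (rule posdef_inner_sym[OF posdef_matrix_inv[OF posdef_gram[OF c(1) y]]])
  have "grad_inner c ?F ?F ?y = ((f x)\<^sup>2 / 2) * ((f x)\<^sup>2 / 2) * grad_inner c u u ?y
      + ((f x)\<^sup>2 / 2) * (f x * u x) * grad_inner c u f ?y
      + (f x * u x) * ((f x)\<^sup>2 / 2) * grad_inner c f u ?y + (f x * u x) * (f x * u x) * grad_inner c f f ?y"
    unfolding grad_inner_def gF
    by (simp only: matrix_vector_right_distrib matrix_vector_mult_scaleR inner_add_left inner_add_right
        inner_scaleR_left inner_scaleR_right) (simp add: algebra_simps)
  then show ?thesis
    unfolding sq_norm_grad_eq[OF c F] sym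
    by (simp add: power2_eq_square power3_eq_cube power4_eq_xxxx algebra_simps)
qed

lemma grad_inner_affine:
  assumes f: "smooth_map_on A UNIV f" and c: "c \<in> A" "x \<in> cdom c"
  shows "grad_inner c (\<lambda>x. 1 + t * f x) u (cmap c x) = t * grad_inner c f u (cmap c x)"
    "grad_inner c (\<lambda>x. 1 + t * f x) (\<lambda>x. 1 + t * f x) (cmap c x) = t\<^sup>2 * grad_inner c f f (cmap c x)"
proof -
  have y: "cmap c x \<in> cimg c" using c by simp
  have "((\<lambda>z. 1 + t * (f \<circ> cinv c) z) has_derivative (\<lambda>v. v \<bullet> (t *\<^sub>R grad_in c f (cmap c x)))) (at (cmap c x))"
    by (rule derivative_eq_intros grad_in_has_derivative[OF f c(1) y] refl)+ simp
  then have "grad_in c (\<lambda>x. 1 + t * f x) (cmap c x) = t *\<^sub>R grad_in c f (cmap c x)"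
    by (intro grad_in_unique) (simp add: comp_def)
  then show "grad_inner c (\<lambda>x. 1 + t * f x) u (cmap c x) = t * grad_inner c f u (cmap c x)"
    "grad_inner c (\<lambda>x. 1 + t * f x) (\<lambda>x. 1 + t * f x) (cmap c x) = t\<^sup>2 * grad_inner c f f (cmap c x)"
    by (simp_all add: grad_inner_def matrix_vector_mult_scaleR power2_eq_square)
qed

end

section \<open>The first variation\<close>

text \<open>The integrand is the energy density of \<open>(1 + t \<phi>) \<sigma>\<close>, where \<open>u = |\<sigma>|\<^sup>2\<close>, \<open>n = |\<nabla>\<sigma>|\<^sup>2\<close>,
  \<open>a = |\<nabla>u|\<^sup>2\<close>, \<open>b = \<langle>\<nabla>\<phi>, \<nabla>u\<rangle>\<close> and \<open>e = |\<nabla>\<phi>|\<^sup>2\<close>.\<close>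

lemma radial_energy_has_derivative:
  fixes u n a b e \<phi> \<rho> :: "'a::euclidean_space \<Rightarrow> real" and p q :: real
  assumes cont: "continuous_on (cbox l r) u" "continuous_on (cbox l r) n" "continuous_on (cbox l r) a"
      "continuous_on (cbox l r) b" "continuous_on (cbox l r) e" "continuous_on (cbox l r) \<phi>"
      "continuous_on (cbox l r) \<rho>"
    and u: "\<And>y. y \<in> cbox l r \<Longrightarrow> u y \<ge> 0"
  shows "((\<lambda>t. integral (cbox l r) (\<lambda>y. \<rho> y * (1 / (1 + (1 + t * \<phi> y)\<^sup>2 * u y) powr p *
      ((1 + t * \<phi> y)\<^sup>2 * n y + (1 + t * \<phi> y) * (t * b y) + u y * (t\<^sup>2 * e y)
      + q * ((1 + t * \<phi> y)^4 * a y / 4 + (1 + t * \<phi> y)^3 * u y * (t * b y)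
        + (1 + t * \<phi> y)\<^sup>2 * (u y)\<^sup>2 * (t\<^sup>2 * e y))))))
    has_real_derivative integral (cbox l r) (\<lambda>y. \<rho> y * ((1 + u y) powr (- p) *
        (2 * \<phi> y * n y + b y + q * (\<phi> y * a y + u y * b y))
      - p * (1 + u y) powr (- p - 1) * (2 * \<phi> y * u y) * (n y + q * a y / 4)))) (at 0)"
proof -
  define U :: "real set" where "U = {-1<..<1}"
  define F where "F t y = 1 + t * \<phi> y" for t y
  define B where "B t y = 1 + (F t y)\<^sup>2 * u y" for t y
  define Q where "Q t y = (F t y)\<^sup>2 * n y + F t y * (t * b y) + u y * (t\<^sup>2 * e y)
      + q * ((F t y)^4 * a y / 4 + (F t y)^3 * u y * (t * b y) + (F t y)\<^sup>2 * (u y)\<^sup>2 * (t\<^sup>2 * e y))" for t y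
  define Q' where "Q' t y = 2 * F t y * \<phi> y * n y + \<phi> y * (t * b y) + F t y * b y + u y * (2 * t * e y)
      + q * ((F t y)^3 * \<phi> y * a y + 3 * (F t y)\<^sup>2 * \<phi> y * u y * (t * b y) + (F t y)^3 * u y * b y
        + 2 * F t y * \<phi> y * (u y)\<^sup>2 * (t\<^sup>2 * e y) + (F t y)\<^sup>2 * (u y)\<^sup>2 * (2 * t * e y))" for t y
  define J where "J = (\<lambda>t y. \<rho> y * (B t y powr (- p) * Q t y))"
  define J' where "J' = (\<lambda>t y. \<rho> y * (B t y powr (- p) * Q' t y
      + (- p * B t y powr (- p - 1) * (2 * F t y * \<phi> y * u y)) * Q t y))"
  \<comment> \<open>Nonnegativity of \<open>u\<close> keeps the base of the power at least 1 for
    every \<open>t\<close>, so real exponents cause no singularity.\<close>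
  have Bpos: "B t y > 0" if "y \<in> cbox l r" for t y
    using u[OF that] by (simp add: B_def add_pos_nonneg)
  have Bne: "B t y \<noteq> 0" if "y \<in> cbox l r" for t y
    using Bpos[OF that, of t] by simp
  have F': "((\<lambda>t. F t y) has_real_derivative \<phi> y) (at t within U)" for t y
    unfolding F_def by (auto intro!: derivative_eq_intros)
  have B': "((\<lambda>t. B t y) has_real_derivative 2 * F t y * \<phi> y * u y) (at t within U)" for t y
    unfolding B_def by (rule derivative_eq_intros F' refl)+ simp
  have Q': "((\<lambda>t. Q t y) has_real_derivative Q' t y) (at t within U)" for t y
    unfolding Q_def Q'_def
    by (auto intro!: derivative_eq_intros F' simp: algebra_simps power2_eq_square power3_eq_cube)
  have P': "((\<lambda>t. B t y powr (- p)) has_real_derivative - p * B t y powr (- p - 1) * (2 * F t y * \<phi> y * u y))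
      (at t within U)" if "y \<in> cbox l r" for t y
    using DERIV_chain2[where f = "\<lambda>x. x powr (- p)", OF has_real_derivative_powr[OF Bpos[OF that]] B'[of y t]]
    by simp
  have J': "((\<lambda>t. J t y) has_field_derivative J' t y) (at t within U)" if "y \<in> cbox l r" for t y
    unfolding J_def J'_def
    by (rule derivative_eq_intros P'[OF that] Q' refl)+ (simp add: algebra_simps)
  have snd: "continuous_on (U \<times> cbox l r) (\<lambda>z. f (snd z))" if "continuous_on (cbox l r) f" for f :: "'a \<Rightarrow> real"
    by (rule continuous_on_compose2[OF that]) (auto intro: continuous_intros)
  note cs = cont[THEN snd]
  have cF: "continuous_on (U \<times> cbox l r) (\<lambda>z. F (fst z) (snd z))"
    unfolding F_def by (intro continuous_intros cs)
  have cB: "continuous_on (U \<times> cbox l r) (\<lambda>z. B (fst z) (snd z))"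
    unfolding B_def by (intro continuous_intros cs cF)
  have cJ': "continuous_on (U \<times> cbox l r) (\<lambda>(t, y). J' t y)"
    unfolding case_prod_unfold J'_def Q_def Q'_def
    by (intro continuous_intros cs cF cB) (auto simp: Bne)
  have cJ: "J t integrable_on cbox l r" for t
    unfolding J_def Q_def B_def F_def
    by (intro integrable_continuous continuous_intros cont)
      (auto simp: Bne[unfolded B_def F_def])
  have "((\<lambda>t. integral (cbox l r) (J t)) has_real_derivative integral (cbox l r) (J' 0)) (at 0 within U)"
    by (rule leibniz_rule_field_derivative[OF J' cJ cJ']) (auto simp: U_def)
  then have "((\<lambda>t. integral (cbox l r) (J t)) has_real_derivative integral (cbox l r) (J' 0)) (at 0)"
    by (simp add: U_def at_within_open[of 0 "{-1<..<1::real}"])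
  \<comment> \<open>At \<open>t = 0\<close> the terms quadratic in \<open>t\<close> disappear, so
    \<open>e\<close> leaves no trace and \<open>b\<close> enters only linearly.\<close>
  moreover have "J' 0 = (\<lambda>y. \<rho> y * ((1 + u y) powr (- p) *
        (2 * \<phi> y * n y + b y + q * (\<phi> y * a y + u y * b y))
      - p * (1 + u y) powr (- p - 1) * (2 * \<phi> y * u y) * (n y + q * a y / 4)))"
    by (simp add: fun_eq_iff J'_def Q_def Q'_def B_def F_def)
  ultimately show ?thesis
    unfolding J_def Q_def B_def F_def powr_minus_divide by simp
qed

section \<open>The energy along radial variations\<close>

locale riemannian_bundle =
  riemannian_volume A g vol + metric_vector_bundle A g E T h nabla
  for A :: "('m::{t2_space, second_countable_topology}, 'n::finite) chart set"
    and g :: "('m, 'n) metric" and vol :: "'m measure"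
    and E :: "'m \<Rightarrow> 'v::real_vector set" and T :: "('m, 'v, 'k::finite) triv set"
    and h :: "'m \<Rightarrow> 'v \<Rightarrow> 'v \<Rightarrow> real" and nabla :: "('m, 'n, 'v) conn"
begin

definition energy_density :: "real \<Rightarrow> real \<Rightarrow> ('m \<Rightarrow> 'v) \<Rightarrow> 'm \<Rightarrow> real" where
  "energy_density p q s x = 1 / ((1 + sq_norm h s x) powr p) *
    (sq_norm_nabla A g h nabla s x + q * sq_norm_grad A g (\<lambda>y. 1/2 * sq_norm h s y) x)"

lemma vertical_energy_eq:
  "vertical_energy A g vol h nabla p q D s = 1/2 * (LINT x:D|vol. energy_density p q s x)"
  by (simp add: vertical_energy_def energy_density_def)

lemma energy_density_continuous:
  assumes s: "smooth_section A E T s"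
  shows "continuous_on UNIV (energy_density p q s)"
proof -
  have F: "smooth_map_on A UNIV (\<lambda>y. 1/2 * sq_norm h s y)"
    by (intro smooth_map_on_mult smooth_map_on_const smooth_sq_norm s)
  have "1 + sq_norm h s x > 0" for x using sq_norm_nonneg[OF s, of x] by linarith
  then have "1 + sq_norm h s x \<noteq> 0" for x by (metis less_irrefl)
  then show ?thesis
    unfolding energy_density_def
    by (intro continuous_intros smooth_map_continuous smooth_sq_norm[OF s] smooth_sq_norm_nabla[OF s]
        smooth_sq_norm_grad[OF F]) auto
qed

lemma energy_density_radial:
  assumes s: "smooth_section A E T s" and f: "smooth_map_on A UNIV f" and c: "c \<in> A" "x \<in> cdom c"
  shows "energy_density p q (\<lambda>x. (1 + t * f x) *\<^sub>R s x) x =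
    1 / (1 + (1 + t * f x)\<^sup>2 * sq_norm h s x) powr p *
      ((1 + t * f x)\<^sup>2 * sq_norm_nabla A g h nabla s x
      + (1 + t * f x) * (t * grad_inner c f (sq_norm h s) (cmap c x))
      + sq_norm h s x * (t\<^sup>2 * grad_inner c f f (cmap c x))
      + q * ((1 + t * f x)^4 * grad_inner c (sq_norm h s) (sq_norm h s) (cmap c x) / 4
        + (1 + t * f x)^3 * sq_norm h s x * (t * grad_inner c f (sq_norm h s) (cmap c x))
        + (1 + t * f x)\<^sup>2 * (sq_norm h s x)\<^sup>2 * (t\<^sup>2 * grad_inner c f f (cmap c x))))"
proof -
  have F: "smooth_map_on A UNIV (\<lambda>x. 1 + t * f x)" by (rule smooth_map_on_affine[OF f])
  show ?thesis
    unfolding energy_density_def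
    by (simp only: sq_norm_scale[OF s] sq_norm_nabla_scale[OF F s c]
        sq_norm_grad_scale[OF F smooth_sq_norm[OF s] c],
        simp only: grad_inner_affine(2)[OF f c], simp only: grad_inner_affine(1)[OF f c])
qed

text \<open>\<open>C\<close> is closed, so \<open>f\<close> vanishes near \<open>x\<close> and its
  differential vanishes too. The radial formula for \<open>t\<close> then agrees with the one for
  \<open>t = 0\<close>, which is the density of \<open>s\<close>.\<close>

lemma energy_density_radial_outside:
  assumes s: "smooth_section A E T s" and f: "smooth_map_on A UNIV f"
    and C: "closed C" "\<And>x. x \<notin> C \<Longrightarrow> f x = 0" and x: "x \<notin> C"
  shows "energy_density p q (\<lambda>x. (1 + t * f x) *\<^sub>R s x) x = energy_density p q s x"
proof -
  obtain c where c: "c \<in> A" "x \<in> cdom c" using ex_chart by blast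
  have "((f \<circ> cinv c) has_derivative (\<lambda>v. v \<bullet> 0)) (at (cmap c x))"
    by (rule has_derivative_transform_within_open[OF _ cimg_Int_open[OF c(1), of "- C"], of "\<lambda>y. 0"])
      (use c x C in auto)
  then have "grad_in c f (cmap c x) = 0" by (rule grad_in_unique)
  then have "grad_inner c f k (cmap c x) = 0" for k by (simp add: grad_inner_def)
  then show ?thesis
    using energy_density_radial[OF s f c, of p q t] energy_density_radial[OF s f c, of p q 0] C(2)[OF x]
    by simp
qed

text \<open>On \<open>cdom c\<close> the function is \<open>\<beta>\<close> composed with a
  transition map, and off the image of the box it is zero. That image is compact, hence closed, so
  two open sets cover the manifold.\<close>

lemma smooth_map_extend:
  fixes \<beta> :: "real ^ 'n \<Rightarrow> real"
  assumes c: "c \<in> A" and \<beta>: "smooth_on UNIV \<beta>" "\<And>y. y \<notin> cbox l r \<Longrightarrow> \<beta> y = 0" and lr: "cbox l r \<subseteq> cimg c"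
  shows "smooth_map_on A UNIV (\<lambda>x. if x \<in> cdom c then \<beta> (cmap c x) else 0)" (is "smooth_map_on A UNIV ?f")
proof (rule smooth_map_onI)
  fix c' assume c': "c' \<in> A"
  have C: "closed (cinv c ` cbox l r)"
    by (intro compact_imp_closed compact_continuous_image continuous_on_subset[OF cinv_continuous[OF c] lr] compact_cbox)
  show "smooth_on (cimg c') (?f \<circ> cinv c')"
  proof (rule smooth_on_local)
    fix y assume y: "y \<in> cimg c'"
    show "\<exists>S. open S \<and> y \<in> S \<and> smooth_on S (?f \<circ> cinv c')"
    proof (cases "cinv c' y \<in> cdom c")
      case True
      let ?S = "cmap c' ` (cdom c' \<inter> cdom c)"
      have o: "open ?S" by (rule cimg_Int_open[OF c' cdom_open[OF c]])
      have "smooth_on ?S (\<lambda>y. \<beta> ((cmap c \<circ> cinv c') y))"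
        by (rule smooth_on_compose[OF o open_UNIV _ \<beta>(1) transition_smooth[OF c' c]]) simp
      then have "smooth_on ?S (?f \<circ> cinv c')"
        by (rule smooth_on_cong[OF o, rotated]) (use c' in auto)
      moreover have "y \<in> ?S" using True y by (simp add: cimg_Int_eq[OF c'])
      ultimately show ?thesis using o by blast
    next
      case False
      let ?S = "cmap c' ` (cdom c' \<inter> - cinv c ` cbox l r)"
      have o: "open ?S" by (rule cimg_Int_open[OF c' open_Compl[OF C]])
      have "smooth_on ?S (?f \<circ> cinv c')"
      proof (rule smooth_on_cong[OF o _ smooth_on_const[OF o, of 0]])
        fix z assume "z \<in> ?S"
        then have z: "cinv c' z \<notin> cinv c ` cbox l r" using c' by auto
        show "0 = (?f \<circ> cinv c') z"
        proof (cases "cinv c' z \<in> cdom c")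
          case True
          have "cmap c (cinv c' z) \<notin> cbox l r"
            using z cinv_cmap[OF c True] by (metis image_eqI)
          then show ?thesis using \<beta>(2) by simp
        qed simp
      qed
      moreover have "y \<in> ?S" using False y lr by (auto simp: cimg_Int_eq[OF c'])
      ultimately show ?thesis using o by blast
    qed
  qed
qed

text \<open>In a trivialisation the family is affine in \<open>t\<close> with smooth coefficients,
  hence jointly smooth. The radius 1 of the parameter interval is a convenient choice.\<close>

lemma radial_variation:
  assumes s: "smooth_section A E T s" and f: "smooth_map_on A UNIV f"
  shows "smooth_variation A E T s 1 (\<lambda>t x. (1 + t * f x) *\<^sub>R s x)"
  unfolding smooth_variation_def
proof (intro conjI ballI allI, simp_all only: case_prod_unfold split_beta)
  show "(1 + t * f x) *\<^sub>R s x \<in> E x" for t x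
    using fibre_subspace section_in[OF s] by (simp add: subspace_scale)
  fix c Z assume c: "c \<in> A" and Z: "Z \<in> T"
  obtain W \<tau> where W: "Z = (W, \<tau>)" "(W, \<tau>) \<in> T" using Z by (cases Z) auto
  let ?S = "cmap c ` (cdom c \<inter> W)"
  let ?U = "{-1<..<1::real} \<times> ?S"
  have oS: "open ?S" by (rule cimg_Int_open[OF c triv(1)[OF W(2)]])
  then have oU: "open ?U" by (intro open_Times) auto
  have snd: "smooth_on ?U (\<lambda>z. k (snd z))" if "smooth_on ?S k" for k :: "real ^ 'n \<Rightarrow> 'w::real_normed_vector"
    by (rule smooth_on_compose[OF oU oS _ that smooth_on_linear[OF oU bounded_linear_snd]]) auto
  have 1: "smooth_on ?U (\<lambda>z. (1 + fst z * (f \<circ> cinv c) (snd z)) *\<^sub>R ((\<lambda>x. \<tau> x (s x)) \<circ> cinv c) (snd z))"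
    by (intro smooth_on_scaleR smooth_on_add smooth_on_mult smooth_on_const oU
        smooth_on_linear[OF oU bounded_linear_fst] snd section_smooth[OF s c W(2)]
        smooth_on_subset[OF smooth_map_on_chart[OF f c]]) auto
  have 2: "\<tau> (cinv c y) ((1 + t * f (cinv c y)) *\<^sub>R s (cinv c y)) =
      (1 + t * (f \<circ> cinv c) y) *\<^sub>R ((\<lambda>x. \<tau> x (s x)) \<circ> cinv c) y" if "y \<in> ?S" for t y
  proof -
    have "cinv c y \<in> W" using that c by auto
    from triv(3)[OF W(2) this section_in[OF s] section_in[OF s], of "1 + t * f (cinv c y)" 0]
    show ?thesis by simp
  qed
  show "smooth_on ({-1<..<1::real} \<times> cmap c ` (cdom c \<inter> fst Z))
      (\<lambda>z. snd Z (cinv c (snd z)) ((1 + fst z * f (cinv c (snd z))) *\<^sub>R s (cinv c (snd z))))"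
    unfolding W(1) fst_conv snd_conv
    by (rule smooth_on_cong[OF oU _ 1]) (use 2 in force)
qed auto

text \<open>Merges the compact and the non-compact definition of harmonicity. In the non-compact
  case the domain is the image of a coordinate ball, which is open, connected and relatively
  compact; in the compact case it is the whole manifold. It does not depend on the test
  function.\<close>

lemma ex_energy_domain:
  assumes harm: "harmonic_section A g vol E T h nabla p q s"
    and c: "c \<in> A" and R: "cball z R \<subseteq> cimg c" and C: "C \<subseteq> cinv c ` ball z R" "compact C"
  obtains D where "D \<in> sets borel" "compact (closure D)" "C \<subseteq> D"
    "\<forall>f :: 'm \<Rightarrow> real. smooth_map_on A UNIV f \<longrightarrow> (\<forall>x. x \<notin> C \<longrightarrow> f x = 0) \<longrightarrow>
      ((\<lambda>t. vertical_energy A g vol h nabla p q D (\<lambda>x. (1 + t * f x) *\<^sub>R s x)) has_real_derivative 0) (at 0)"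
proof (cases "compact (UNIV :: 'm set)")
  case True
  have s: "smooth_section A E T s"
    and stat: "\<And>\<epsilon> S. smooth_variation A E T s \<epsilon> S \<Longrightarrow>
      ((\<lambda>t. vertical_energy A g vol h nabla p q UNIV (S t)) has_real_derivative 0) (at 0)"
    using harm True unfolding harmonic_section_def by auto
  show ?thesis
    by (rule that[of UNIV]) (use True stat[OF radial_variation[OF s]] in auto)
next
  case False
  let ?D = "cinv c ` ball z R"
  have sub: "ball z R \<subseteq> cimg c" using R ball_subset_cball by blast
  have K: "compact (cinv c ` cball z R)"
    by (intro compact_continuous_image continuous_on_subset[OF cinv_continuous[OF c] R] compact_cball)
  \<comment> \<open>The description as a preimage under the chart map shows that the image of the
    ball is open.\<close>
  have "?D = cdom c \<inter> cmap c -` ball z R"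
  proof (intro equalityI subsetI)
    fix x assume "x \<in> ?D"
    then obtain y where "y \<in> ball z R" "x = cinv c y" by blast
    then show "x \<in> cdom c \<inter> cmap c -` ball z R" using sub by (auto simp del: mem_ball)
  next
    fix x assume x: "x \<in> cdom c \<inter> cmap c -` ball z R"
    then have "x = cinv c (cmap c x)" using c by simp
    then show "x \<in> ?D" using x by blast
  qed
  then have open_D: "open ?D"
    by (metis c cdom_open cmap_continuous continuous_open_preimage open_ball)
  have conn_D: "connected ?D"
    by (intro connected_continuous_image continuous_on_subset[OF cinv_continuous[OF c] sub]) simp
  have "closure ?D \<subseteq> cinv c ` cball z R"
    by (intro closure_minimal compact_imp_closed K image_mono ball_subset_cball)
  then have comp_D: "compact (closure ?D)"
    using compact_Int_closed[OF K closed_closure, of ?D] by (simp add: Int_absorb1)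
  show ?thesis
  proof (rule that[of ?D]; (intro allI impI)?)
    fix f :: "'m \<Rightarrow> real" assume f: "smooth_map_on A UNIV f" and f0: "\<forall>x. x \<notin> C \<longrightarrow> f x = 0"
    have s: "smooth_section A E T s" using harm by (simp add: harmonic_section_def)
    have "\<forall>t\<in>{-1<..<1}. \<forall>x. x \<notin> C \<longrightarrow> (1 + t * f x) *\<^sub>R s x = s x" using f0 by simp
    with harm radial_variation[OF s f] C open_D conn_D comp_D False
    show "((\<lambda>t. vertical_energy A g vol h nabla p q ?D (\<lambda>x. (1 + t * f x) *\<^sub>R s x)) has_real_derivative 0) (at 0)"
      unfolding harmonic_section_def by meson
  qed (use open_D comp_D C in auto)
qed

text \<open>Transports stationarity of the global energy to a Euclidean integral: the varied density
  differs from that of \<sigma> only on the image of the box, and there the chart formula can be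
  differentiated under the integral.\<close>

lemma first_variation:
  assumes harm: "harmonic_section A g vol E T h nabla p q s"
    and c: "c \<in> A" and R: "cball z R \<subseteq> cimg c" and lr: "cbox l r \<subseteq> ball z R"
    and \<beta>: "smooth_on UNIV \<beta>" "\<And>y. y \<notin> cbox l r \<Longrightarrow> \<beta> y = 0"
  defines "f \<equiv> \<lambda>x. if x \<in> cdom c then \<beta> (cmap c x) else 0"
    and "u \<equiv> \<lambda>y. sq_norm h s (cinv c y)" and "n \<equiv> \<lambda>y. sq_norm_nabla A g h nabla s (cinv c y)"
    and "a \<equiv> grad_inner c (sq_norm h s) (sq_norm h s)"
  defines "b \<equiv> grad_inner c f (sq_norm h s)"
  shows "integral (cbox l r) (\<lambda>y. sqrt (det (gram c y)) * ((1 + u y) powr (- p) *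
        (2 * \<beta> y * n y + b y + q * (\<beta> y * a y + u y * b y))
      - p * (1 + u y) powr (- p - 1) * (2 * \<beta> y * u y) * (n y + q * a y / 4))) = 0"
proof -
  let ?C = "cinv c ` cbox l r" and ?S = "\<lambda>t x. (1 + t * f x) *\<^sub>R s x"
  have s: "smooth_section A E T s" using harm by (simp add: harmonic_section_def)
  have lrc: "cbox l r \<subseteq> cimg c" using lr R ball_subset_cball by blast
  have f: "smooth_map_on A UNIV f" unfolding f_def by (rule smooth_map_extend[OF c \<beta> lrc])
  have C: "compact ?C"
    by (intro compact_continuous_image continuous_on_subset[OF cinv_continuous[OF c] lrc] compact_cbox)
  have f0: "f x = 0" if "x \<notin> ?C" for x
  proof (cases "x \<in> cdom c")
    case True
    have "cmap c x \<notin> cbox l r" using that cinv_cmap[OF c True] by (metis image_eqI)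
    then show ?thesis using \<beta>(2) by (simp add: f_def)
  qed (simp add: f_def)
  obtain D where D: "D \<in> sets borel" "compact (closure D)" "?C \<subseteq> D"
    and stat: "\<forall>f :: 'm \<Rightarrow> real. smooth_map_on A UNIV f \<longrightarrow> (\<forall>x. x \<notin> ?C \<longrightarrow> f x = 0) \<longrightarrow>
      ((\<lambda>t. vertical_energy A g vol h nabla p q D (\<lambda>x. (1 + t * f x) *\<^sub>R s x)) has_real_derivative 0) (at 0)"
    by (rule ex_energy_domain[OF harm c R image_mono[OF lr] C])
  let ?d = "energy_density p q"
  have cont: "continuous_on UNIV (?d (?S t))" for t
    by (intro energy_density_continuous smooth_section_scale smooth_map_on_affine f s)
  \<comment> \<open>\<open>k\<close> is the part of the integral over \<open>D\<close> that the
    variation leaves unchanged; only \<open>I t\<close> depends on \<open>t\<close>.\<close>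
  define k where "k = (LINT x:D|vol. ?d s x) - (LINT x:?C|vol. ?d s x)"
  define I where "I t = integral (cbox l r) (\<lambda>y. sqrt (det (gram c y)) * ?d (?S t) (cinv c y))" for t
  have en: "vertical_energy A g vol h nabla p q D (?S t) = 1/2 * (k + I t)" for t
  proof -
    have Cb: "?C \<in> sets borel" using C by (intro borel_closed compact_imp_closed)
    have iC: "compact (closure ?C)" using C by (simp add: closure_closed compact_imp_closed)
    note ints = set_integrable_vol[OF cont D(1,2)] set_integrable_vol[OF energy_density_continuous[OF s] D(1,2)]
      set_integrable_vol[OF cont Cb iC] set_integrable_vol[OF energy_density_continuous[OF s] Cb iC]
    have "(LINT x:D|vol. ?d (?S t) x) - (LINT x:D|vol. ?d s x) = (LINT x:D|vol. ?d (?S t) x - ?d s x)"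
      by (rule set_integral_diff(2)[symmetric]) (rule ints)+
    also have "\<dots> = (LINT x:?C|vol. ?d (?S t) x - ?d s x)"
      unfolding set_lebesgue_integral_def
    proof (rule Bochner_Integration.integral_cong[OF refl])
      show "indicator D x *\<^sub>R (?d (?S t) x - ?d s x) = indicator ?C x *\<^sub>R (?d (?S t) x - ?d s x)" for x
        using energy_density_radial_outside[OF s f compact_imp_closed[OF C] f0, of x p q t] D(3)
        by (cases "x \<in> ?C") auto
    qed
    also have "\<dots> = (LINT x:?C|vol. ?d (?S t) x) - (LINT x:?C|vol. ?d s x)"
      by (rule set_integral_diff(2)) (rule ints)+
    also have "(LINT x:?C|vol. ?d (?S t) x) = I t"
      unfolding I_def by (rule set_lebesgue_integral_chart[OF c lrc cont])
    finally show ?thesis by (simp add: vertical_energy_eq k_def)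
  qed
  have "((\<lambda>t. vertical_energy A g vol h nabla p q D (?S t)) has_real_derivative 0) (at 0)"
    using stat f f0 by blast
  \<comment> \<open>Solving the energy formula for \<open>I\<close> passes stationarity from the
    energy to the chart integral.\<close>
  then have "((\<lambda>t. 2 * (1/2 * (k + I t)) - k) has_real_derivative 2 * 0 - 0) (at 0)"
    unfolding en by (rule DERIV_diff[OF DERIV_cmult DERIV_const])
  moreover have "(\<lambda>t. 2 * (1/2 * (k + I t)) - k) = I" by (simp add: fun_eq_iff field_simps)
  ultimately have I0: "(I has_real_derivative 0) (at 0)" by simp
  have fy: "f (cinv c y) = \<beta> y" if "y \<in> cimg c" for y using that by (simp add: f_def)
  have co: "continuous_on (cbox l r) k" if "smooth_on (cimg c) k" for k :: "real ^ 'n \<Rightarrow> real"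
    using smooth_on_continuous_on[OF that] lrc by (rule continuous_on_subset)
  have "I = (\<lambda>t. integral (cbox l r) (\<lambda>y. sqrt (det (gram c y)) * (1 / (1 + (1 + t * \<beta> y)\<^sup>2 * u y) powr p *
      ((1 + t * \<beta> y)\<^sup>2 * n y + (1 + t * \<beta> y) * (t * b y) + u y * (t\<^sup>2 * grad_inner c f f y)
      + q * ((1 + t * \<beta> y)^4 * a y / 4 + (1 + t * \<beta> y)^3 * u y * (t * b y)
        + (1 + t * \<beta> y)\<^sup>2 * (u y)\<^sup>2 * (t\<^sup>2 * grad_inner c f f y))))))"
  proof (rule ext)
    fix t
    show "I t = integral (cbox l r) (\<lambda>y. sqrt (det (gram c y)) * (1 / (1 + (1 + t * \<beta> y)\<^sup>2 * u y) powr p *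
      ((1 + t * \<beta> y)\<^sup>2 * n y + (1 + t * \<beta> y) * (t * b y) + u y * (t\<^sup>2 * grad_inner c f f y)
      + q * ((1 + t * \<beta> y)^4 * a y / 4 + (1 + t * \<beta> y)^3 * u y * (t * b y)
        + (1 + t * \<beta> y)\<^sup>2 * (u y)\<^sup>2 * (t\<^sup>2 * grad_inner c f f y)))))"
      unfolding I_def
    proof (rule integral_cong)
      fix y assume "y \<in> cbox l r"
      then have y: "y \<in> cimg c" using lrc by blast
      show "sqrt (det (gram c y)) * ?d (?S t) (cinv c y) =
          sqrt (det (gram c y)) * (1 / (1 + (1 + t * \<beta> y)\<^sup>2 * u y) powr p *
          ((1 + t * \<beta> y)\<^sup>2 * n y + (1 + t * \<beta> y) * (t * b y) + u y * (t\<^sup>2 * grad_inner c f f y)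
          + q * ((1 + t * \<beta> y)^4 * a y / 4 + (1 + t * \<beta> y)^3 * u y * (t * b y)
            + (1 + t * \<beta> y)\<^sup>2 * (u y)\<^sup>2 * (t\<^sup>2 * grad_inner c f f y))))"
        unfolding energy_density_radial[OF s f c cinv_in[OF y]] cmap_cinv[OF y] fy[OF y] u_def n_def a_def b_def
        by (rule refl)
    qed
  qed
  moreover have "smooth_on (cimg c) \<beta>"
    by (rule smooth_on_subset[OF \<beta>(1)]) simp
  ultimately have "(I has_real_derivative integral (cbox l r) (\<lambda>y. sqrt (det (gram c y)) * ((1 + u y) powr (- p) *
        (2 * \<beta> y * n y + b y + q * (\<beta> y * a y + u y * b y))
      - p * (1 + u y) powr (- p - 1) * (2 * \<beta> y * u y) * (n y + q * a y / 4)))) (at 0)"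
    by (simp only:, intro radial_energy_has_derivative co)
      (use smooth_map_on_chart[OF smooth_sq_norm[OF s] c] smooth_map_on_chart[OF smooth_sq_norm_nabla[OF s] c]
        smooth_on_grad_inner[OF c smooth_sq_norm[OF s] smooth_sq_norm[OF s]]
        smooth_on_grad_inner[OF c f smooth_sq_norm[OF s]] smooth_on_grad_inner[OF c f f]
        smooth_on_sqrt_det[OF c] sq_norm_nonneg[OF s]
        in \<open>simp_all add: u_def n_def a_def b_def comp_def\<close>)
  then show ?thesis using I0 DERIV_unique by blast
qed

text \<open>The divergence lemma for the field psi(u) grad u, where psi(t) = (1 + t)^(-p) (1 + q t)
  is chosen to match the coefficient of \<open>b\<close> in \<open>first_variation\<close>.
  Harmonicity leaves psi'(u) |grad u|^2 as its divergence.\<close>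

lemma integration_by_parts:
  assumes v: "harmonic_function A g v" and nonneg: "\<And>x. v x \<ge> 0"
    and c: "c \<in> A" and lr: "cbox l r \<subseteq> cimg c"
    and \<beta>: "smooth_on UNIV \<beta>" "\<And>y. y \<notin> cbox l r \<Longrightarrow> \<beta> y = 0"
  defines "f \<equiv> \<lambda>x. if x \<in> cdom c then \<beta> (cmap c x) else 0"
    and "u \<equiv> \<lambda>y. v (cinv c y)"
  shows "((\<lambda>y. sqrt (det (gram c y)) * ((1 + u y) powr (- p) * (1 + q * u y) * grad_inner c f v y
      + \<beta> y * (q * (1 + u y) powr (- p) - p * (1 + u y) powr (- p - 1) * (1 + q * u y)) * grad_inner c v v y))
    has_integral 0) (cbox l r)"
proof -
  have sv: "smooth_map_on A UNIV v" using v by (simp add: harmonic_function_def)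
  have su: "smooth_on (cimg c) u"
    using smooth_map_on_chart[OF sv c] by (simp add: u_def comp_def)
  have upos: "1 + u y > 0" for y using nonneg[of "cinv c y"] by (simp add: u_def)
  \<comment> \<open>The gradient component multiplied by the volume density; the coordinate
    divergence of these components vanishes because \<open>v\<close> is harmonic.\<close>
  let ?V = "\<lambda>i y. sqrt (det (gram c y)) * (matrix_inv (gram c y) *v grad_in c v y) $ i"
  let ?\<psi> = "\<lambda>y. (1 + u y) powr (- p) * (1 + q * u y)"
  let ?\<psi>' = "\<lambda>y. q * (1 + u y) powr (- p) - p * (1 + u y) powr (- p - 1) * (1 + q * u y)"
  have sV: "smooth_on (cimg c) (?V i)" for i
    unfolding matrix_vector_mult_def
    by (simp, intro smooth_on_mult smooth_on_sum smooth_on_sqrt_det smooth_on_gram_inv smooth_on_grad_in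
        cimg_open c sv)
  have s\<psi>: "smooth_on (cimg c) ?\<psi>"
    by (intro smooth_on_mult smooth_on_powr smooth_on_add smooth_on_const cimg_open c su upos)
  have sX: "smooth_on (cimg c) (\<lambda>y. ?\<psi> y * ?V i y)" for i
    by (rule smooth_on_mult[OF cimg_open[OF c] s\<psi> sV])
  have "((\<lambda>y. \<Sum>i\<in>UNIV. frechet_derivative \<beta> (at y) (axis i 1) * (?\<psi> y * ?V i y)
      + \<beta> y * frechet_derivative (\<lambda>y. ?\<psi> y * ?V i y) (at y) (axis i 1)) has_integral 0) (cbox l r)"
    by (rule has_integral_divergence[OF \<beta> cimg_open[OF c] lr sX])
  moreover have "(\<Sum>i\<in>UNIV. frechet_derivative \<beta> (at y) (axis i 1) * (?\<psi> y * ?V i y)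
      + \<beta> y * frechet_derivative (\<lambda>y. ?\<psi> y * ?V i y) (at y) (axis i 1)) =
      sqrt (det (gram c y)) * (?\<psi> y * grad_inner c f v y + \<beta> y * ?\<psi>' y * grad_inner c v v y)"
    if "y \<in> cbox l r" for y
  proof -
    have y: "y \<in> cimg c" using that lr by blast
    have "(\<beta> has_derivative frechet_derivative \<beta> (at y)) (at y)"
      using smooth_on_has_derivative[OF \<beta>(1)] by simp
    then have "((f \<circ> cinv c) has_derivative frechet_derivative \<beta> (at y)) (at y)"
      by (rule has_derivative_transform_within_open[OF _ cimg_open[OF c] y]) (simp add: f_def)
    from frechet_derivative_at[OF this]
    have gf: "frechet_derivative \<beta> (at y) (axis i 1) = grad_in c f y $ i" for i
      by (simp add: grad_in_def)
    have du: "(u has_derivative (\<lambda>w. w \<bullet> grad_in c v y)) (at y)"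
      using grad_in_has_derivative[OF sv c y] by (simp add: u_def comp_def)
    have "((\<lambda>t. (1 + t) powr (- p) * (1 + q * t)) has_real_derivative ?\<psi>' y) (at (u y))"
      using upos[of y] by (auto intro!: derivative_eq_intros simp: algebra_simps)
    then have "((\<lambda>t. (1 + t) powr (- p) * (1 + q * t)) has_derivative (*) (?\<psi>' y)) (at (u y))"
      by (simp only: has_field_derivative_def)
    from has_derivative_compose[OF du this]
    have d\<psi>: "(?\<psi> has_derivative (\<lambda>w. ?\<psi>' y * (w \<bullet> grad_in c v y))) (at y)" .
    have dX: "frechet_derivative (\<lambda>y. ?\<psi> y * ?V i y) (at y) (axis i 1) =
        ?\<psi> y * frechet_derivative (?V i) (at y) (axis i 1) + ?\<psi>' y * grad_in c v y $ i * ?V i y" for i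
    proof -
      have "((\<lambda>y. ?\<psi> y * ?V i y) has_derivative (\<lambda>w. ?\<psi> y * frechet_derivative (?V i) (at y) w
          + ?\<psi>' y * (w \<bullet> grad_in c v y) * ?V i y)) (at y)"
        by (rule has_derivative_mult[OF d\<psi> smooth_on_has_derivative[OF sV y]])
      from frechet_derivative_at[OF this, symmetric] show ?thesis by (simp add: inner_axis')
    qed
    have "(\<Sum>i\<in>UNIV. frechet_derivative \<beta> (at y) (axis i 1) * (?\<psi> y * ?V i y)
        + \<beta> y * frechet_derivative (\<lambda>y. ?\<psi> y * ?V i y) (at y) (axis i 1)) =
        (\<Sum>i\<in>UNIV. grad_in c f y $ i * (?\<psi> y * ?V i y))
        + \<beta> y * ?\<psi> y * (\<Sum>i\<in>UNIV. frechet_derivative (?V i) (at y) (axis i 1))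
        + \<beta> y * ?\<psi>' y * (\<Sum>i\<in>UNIV. grad_in c v y $ i * ?V i y)"
      by (simp only: gf dX sum_distrib_left sum.distrib[symmetric])
        (intro sum.cong refl, simp only: distrib_left distrib_right mult_ac add_ac)
    also have "(\<Sum>i\<in>UNIV. frechet_derivative (?V i) (at y) (axis i 1)) = 0"
      by (rule harmonic_divergence[OF v c y])
    also have "(\<Sum>i\<in>UNIV. grad_in c v y $ i * ?V i y) = sqrt (det (gram c y)) * grad_inner c v v y"
      by (simp add: grad_inner_def inner_vec_def sum_distrib_left mult.left_commute)
    also have "(\<Sum>i\<in>UNIV. grad_in c f y $ i * (?\<psi> y * ?V i y)) =
        ?\<psi> y * sqrt (det (gram c y)) * grad_inner c f v y"
      by (simp only: grad_inner_def inner_vec_def inner_real_def sum_distrib_left mult_ac)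
    finally show ?thesis by (simp add: algebra_simps)
  qed
  ultimately show ?thesis
    by (subst has_integral_cong[symmetric]) auto
qed

text \<open>Subtracting \<open>integration_by_parts\<close> from \<open>first_variation\<close>
  cancels every occurrence of \<open>b\<close>. What remains is the integral of a bump function
  times \<open>K\<close>, for all small bumps at \<open>z\<close>.\<close>

lemma stationary_identity:
  assumes harm: "harmonic_section A g vol E T h nabla p q s"
    and v: "harmonic_function A g (sq_norm h s)" and c: "c \<in> A" and z: "z \<in> cimg c"
  defines "u \<equiv> sq_norm h s (cinv c z)" and "n \<equiv> sq_norm_nabla A g h nabla s (cinv c z)"
    and "a \<equiv> grad_inner c (sq_norm h s) (sq_norm h s) z"
  shows "2 * n * (1 + (1 - p) * u) + p * a * (1 + q * u / 2) = 0"
proof -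
  have s: "smooth_section A E T s" using harm by (simp add: harmonic_section_def)
  obtain R where R: "R > 0" "cball z R \<subseteq> cimg c"
    using cimg_open[OF c] z open_contains_cball by blast
  have "z \<in> ball z R" using R(1) by simp
  then obtain l r where lr: "cbox l r \<subseteq> ball z R" "z \<in> box l r"
    using open_contains_cbox[OF open_ball] by metis
  have lrc: "cbox l r \<subseteq> cimg c" using lr R ball_subset_cball by blast
  define U where "U y = sq_norm h s (cinv c y)" for y
  define N where "N y = sq_norm_nabla A g h nabla s (cinv c y)" for y
  define B where "B = grad_inner c (sq_norm h s) (sq_norm h s)"
  define S where "S y = sqrt (det (gram c y))" for y
  \<comment> \<open>The factor in front of the bracket is positive, so a zero of \<open>K\<close> at
    \<open>z\<close> gives the claimed identity.\<close>
  define K where "K y = S y * (1 + U y) powr (- p - 1) *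
      (2 * N y * (1 + (1 - p) * U y) + p * B y * (1 + q * U y / 2))" for y
  have Upos: "1 + U y > 0" for y using sq_norm_nonneg[OF s, of "cinv c y"] by (simp add: U_def)
  then have Une: "1 + U y \<noteq> 0" for y by (metis less_irrefl)
  have "K z = 0"
  proof (rule eq_0_if_bump_integrals_eq_0[OF _ lr(2)])
    have co: "continuous_on (cbox l r) k" if "smooth_on (cimg c) k" for k :: "real ^ 'n \<Rightarrow> real"
      using smooth_on_continuous_on[OF that] lrc by (rule continuous_on_subset)
    have cs: "continuous_on (cbox l r) U" "continuous_on (cbox l r) N" "continuous_on (cbox l r) B"
      "continuous_on (cbox l r) S"
      using co[OF smooth_map_on_chart[OF smooth_sq_norm[OF s] c]]
        co[OF smooth_map_on_chart[OF smooth_sq_norm_nabla[OF s] c]]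
        co[OF smooth_on_grad_inner[OF c smooth_sq_norm[OF s] smooth_sq_norm[OF s]]]
        co[OF smooth_on_sqrt_det[OF c]]
      by (simp_all add: U_def[abs_def] N_def[abs_def] B_def S_def[abs_def] comp_def)
    show "continuous_on (cbox l r) K"
      unfolding K_def by (intro continuous_intros cs) (auto simp: Une)
    fix \<epsilon> :: real assume \<epsilon>: "\<epsilon> > 0" "cball z \<epsilon> \<subseteq> box l r"
    let ?\<beta> = "bump z \<epsilon>"
    have \<beta>: "smooth_on UNIV ?\<beta>" by (rule smooth_on_bump)
    have \<beta>0: "?\<beta> y = 0" if "y \<notin> cbox l r" for y
      using that \<epsilon> box_subset_cbox[of l r] by (intro bump_eq_0) force+
    define f where "f x = (if x \<in> cdom c then ?\<beta> (cmap c x) else 0)" for x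
    define b where "b = grad_inner c f (sq_norm h s)"
    have f: "smooth_map_on A UNIV f"
      unfolding f_def by (rule smooth_map_extend[OF c \<beta> \<beta>0 lrc])
    have fv: "integral (cbox l r) (\<lambda>y. S y * ((1 + U y) powr (- p) *
        (2 * ?\<beta> y * N y + b y + q * (?\<beta> y * B y + U y * b y))
      - p * (1 + U y) powr (- p - 1) * (2 * ?\<beta> y * U y) * (N y + q * B y / 4))) = 0"
      using first_variation[OF harm c R(2) lr(1) \<beta> \<beta>0]
      by (simp add: U_def[abs_def] N_def[abs_def] B_def b_def f_def[abs_def] S_def)
    have ibp: "((\<lambda>y. S y * ((1 + U y) powr (- p) * (1 + q * U y) * b y
      + ?\<beta> y * (q * (1 + U y) powr (- p) - p * (1 + U y) powr (- p - 1) * (1 + q * U y)) * B y))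
      has_integral 0) (cbox l r)"
      using integration_by_parts[OF v sq_norm_nonneg[OF s] c lrc \<beta> \<beta>0, of p q]
      by (simp add: U_def[abs_def] B_def b_def f_def[abs_def] S_def)
    have "integral (cbox l r) (\<lambda>y. ?\<beta> y * K y) = integral (cbox l r) (\<lambda>y.
        S y * ((1 + U y) powr (- p) *
        (2 * ?\<beta> y * N y + b y + q * (?\<beta> y * B y + U y * b y))
      - p * (1 + U y) powr (- p - 1) * (2 * ?\<beta> y * U y) * (N y + q * B y / 4))
      - S y * ((1 + U y) powr (- p) * (1 + q * U y) * b y
      + ?\<beta> y * (q * (1 + U y) powr (- p) - p * (1 + U y) powr (- p - 1) * (1 + q * U y)) * B y))"
    proof (rule integral_cong)
      fix y
      \<comment> \<open>Splitting off one factor \<open>1 + U y\<close> leaves a single power on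
        both sides, so that the comparison becomes polynomial.\<close>
      have "(1 + U y) powr (- p) = (1 + U y) * (1 + U y) powr (- p - 1)"
        using powr_add[of "1 + U y" 1 "- p - 1"] Upos[of y] by simp
      then show "?\<beta> y * K y = S y * ((1 + U y) powr (- p) *
        (2 * ?\<beta> y * N y + b y + q * (?\<beta> y * B y + U y * b y))
      - p * (1 + U y) powr (- p - 1) * (2 * ?\<beta> y * U y) * (N y + q * B y / 4))
      - S y * ((1 + U y) powr (- p) * (1 + q * U y) * b y
      + ?\<beta> y * (q * (1 + U y) powr (- p) - p * (1 + U y) powr (- p - 1) * (1 + q * U y)) * B y)"
        unfolding K_def by (simp only:) (simp add: field_simps)
    qed
    also have "\<dots> = 0 - 0"
    proof -
      have "continuous_on (cbox l r) b" "continuous_on (cbox l r) ?\<beta>"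
        using co[OF smooth_on_grad_inner[OF c f smooth_sq_norm[OF s]]]
          continuous_on_subset[OF smooth_on_continuous_on[OF \<beta>]] by (auto simp: b_def)
      note cs = cs this
      have "(\<lambda>y. S y * ((1 + U y) powr (- p) *
          (2 * ?\<beta> y * N y + b y + q * (?\<beta> y * B y + U y * b y))
        - p * (1 + U y) powr (- p - 1) * (2 * ?\<beta> y * U y) * (N y + q * B y / 4))) integrable_on cbox l r"
        by (intro integrable_continuous continuous_intros cs) (auto simp: Une)
      from integral_diff[OF this has_integral_integrable[OF ibp]] show ?thesis
        unfolding fv integral_unique[OF ibp] .
    qed
    finally show "integral (cbox l r) (\<lambda>y. ?\<beta> y * K y) = 0" by simp
  qed
  moreover have "sqrt (det (gram c z)) > 0"
    using posdef_det_pos[OF posdef_gram[OF c z]] by simp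
  moreover have "(1 + U z) powr (- p - 1) > 0" using Upos[of z] by simp
  ultimately show ?thesis
    by (simp add: K_def U_def N_def B_def S_def u_def n_def a_def)
qed

end

section \<open>Sign analysis at a point with nonzero gradient\<close>

theorem corollary4p10:
  fixes A :: "('m::{t2_space, second_countable_topology}, 'n::finite) chart set"
    and g :: "('m, 'n) metric"
    and vol :: "'m measure"
    and E :: "'m \<Rightarrow> 'v::real_vector set"
    and T :: "('m, 'v, 'k::finite) triv set"
    and h :: "'m \<Rightarrow> 'v \<Rightarrow> 'v \<Rightarrow> real"
    and nabla :: "('m, 'n, 'v) conn"
    and \<sigma> :: "'m \<Rightarrow> 'v"
  assumes "oriented_atlas A"
    and "connected (UNIV :: 'm set)"
    and "riemannian_metric A g"
    and "riemannian_measure A g vol"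
    and "oriented_vector_bundle A E T"
    and "fibre_metric A E T h"
    and "connection A E T nabla"
    and "metric_compatible A E T h nabla"
    and "smooth_section A E T \<sigma>"
    and "harmonic_function A g (sq_norm h \<sigma>)"
    and "\<not> sq_norm h \<sigma> constant_on UNIV"
  shows "(\<forall>p. \<exists>\<^sub>\<le>\<^sub>1 q. harmonic_section A g vol E T h nabla p q \<sigma>) \<and>
    (\<forall>p q. harmonic_section A g vol E T h nabla p q \<sigma> \<longrightarrow>
       (p < 0 \<and> q \<le> 4 * p \<longrightarrow> (\<exists>x. sq_norm h \<sigma> x > - 2 / q)) \<and>
       (0 \<le> p \<and> p \<le> 1 \<longrightarrow> q < 0 \<and> (\<exists>x. sq_norm h \<sigma> x > - 2 / q)) \<and>
       (p > 1 \<and> q < 2 * (1 - p) \<longrightarrow> (\<exists>x. sq_norm h \<sigma> x > - 2 / q)) \<and>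
       (p > 1 \<and> q \<ge> 2 * (1 - p) \<longrightarrow> (\<exists>x. sq_norm h \<sigma> x > 1 / (p - 1))))"
proof -
  interpret riemannian_bundle A g vol E T h nabla
    by unfold_locales (fact assms)+
  note \<sigma> = \<open>smooth_section A E T \<sigma>\<close> and harm = \<open>harmonic_function A g (sq_norm h \<sigma>)\<close>
  \<comment> \<open>One point serves all \<open>p\<close> and \<open>q\<close>: it decides
    uniqueness and is itself the point required in (a), (b) and (c).\<close>
  obtain c z where c: "c \<in> A" and z: "z \<in> cimg c" and nz: "grad_in c (sq_norm h \<sigma>) z \<noteq> 0"
    using constant_if_grad_eq_0[OF assms(2) smooth_sq_norm[OF \<sigma>]] assms(11) by blast
  define x where "x = cinv c z"
  define u where "u = sq_norm h \<sigma> x"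
  define n where "n = sq_norm_nabla A g h nabla \<sigma> x"
  define a where "a = grad_inner c (sq_norm h \<sigma>) (sq_norm h \<sigma>) z"
  have a: "a > 0" unfolding a_def by (rule grad_inner_pos[OF c z nz])
  have cs: "a \<le> 4 * u * n"
    using grad_sq_norm_le[OF \<sigma> c cinv_in[OF z]] z by (simp add: a_def u_def n_def x_def)
  have u0: "u \<ge> 0" and n0: "n \<ge> 0"
    by (simp_all add: u_def n_def sq_norm_nonneg[OF \<sigma>] sq_norm_nabla_nonneg[OF \<sigma>])
  have u: "u > 0" and n: "n > 0"
    using a cs u0 n0 by (auto simp: less_le)
  have id: "2 * n * (1 + (1 - p) * u) + p * a * (1 + q * u / 2) = 0"
    if "harmonic_section A g vol E T h nabla p q \<sigma>" for p q
    using stationary_identity[OF that harm c z] by (simp add: u_def n_def a_def x_def)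
  \<comment> \<open>Since \<open>u > 0\<close>, a negative bracket forces \<open>q < 0\<close>, and
    division by \<open>q\<close> gives the bound. Cases (a), (b) and (c) thereby reduce to the sign
    of this bracket.\<close>
  have larger: "sq_norm h \<sigma> x > - 2 / q" "q < 0" if "1 + q * u / 2 < 0" for q
  proof -
    show q: "q < 0"
    proof (rule ccontr)
      assume "\<not> q < 0"
      then have "q * u \<ge> 0" using u by simp
      then show False using that by simp
    qed
    then show "sq_norm h \<sigma> x > - 2 / q"
      using that by (simp add: u_def[symmetric] field_simps)
  qed
  show ?thesis
  proof (intro conjI allI impI)
    fix p
    show "\<exists>\<^sub>\<le>\<^sub>1 q. harmonic_section A g vol E T h nabla p q \<sigma>"
    proof (rule Uniq_I)
      fix q q'
      assume "harmonic_section A g vol E T h nabla p q \<sigma>" "harmonic_section A g vol E T h nabla p q' \<sigma>"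
      note e = id[OF this(1)] id[OF this(2)]
      have "p \<noteq> 0"
      proof
        assume "p = 0"
        then have "n * (1 + u) = 0" using e(1) by simp
        then show False using n u by simp
      qed
      \<comment> \<open>Both sides equal - 2 n (1 + (1 - p) u), which does not involve the second
        parameter.\<close>
      moreover have "p * a * (1 + q * u / 2) = p * a * (1 + q' * u / 2)" using e by linarith
      ultimately have "q * u = q' * u" using a by simp
      then show "q' = q" using u by simp
    qed
  next
    fix p q
    assume H: "harmonic_section A g vol E T h nabla p q \<sigma>" and pq: "p < 0 \<and> q \<le> 4 * p"
    have "1 + q * u / 2 < 0"
    proof (rule ccontr)
      assume "\<not> 1 + q * u / 2 < 0"
      \<comment> \<open>Multiplying \<open>a <= 4 u n\<close> by the nonnegative factors - p and 1 +
        q u / 2 replaces the gradient term by a multiple of \<open>n\<close>, which can then be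
        cancelled.\<close>
      then have "(- p) * a * (1 + q * u / 2) \<le> (- p) * (4 * u * n) * (1 + q * u / 2)"
        using cs pq by (intro mult_right_mono mult_left_mono) auto
      then have "2 * n * (1 + (1 - p) * u) \<le> (- p) * (4 * u * n) * (1 + q * u / 2)"
        using id[OF H] by linarith
      then have "2 * n * (1 + u + p * u + p * q * u\<^sup>2) \<le> 0"
        by (simp add: algebra_simps power2_eq_square)
      then have "1 + u + p * u + p * q * u\<^sup>2 \<le> 0"
        using n by (simp add: mult_le_0_iff)
      \<comment> \<open>Multiplication by the negative \<open>p\<close> reverses q <= 4 p.
        Completing the square in p u leaves the constant 15/16, which contradicts the inequality
        above since \<open>u > 0\<close>.\<close>
      moreover have "p * (4 * p) * u\<^sup>2 \<le> p * q * u\<^sup>2"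
        using pq by (intro mult_right_mono mult_left_mono_neg) auto
      moreover have "p * (4 * p) * u\<^sup>2 + p * u + 1 = (2 * p * u + 1/4)\<^sup>2 + 15/16"
        by (simp add: power2_eq_square algebra_simps)
      ultimately show False using u zero_le_power2[of "2 * p * u + 1/4"] by linarith
    qed
    from larger(1)[OF this] show "\<exists>x. sq_norm h \<sigma> x > - 2 / q" by blast
  next
    fix p q
    assume H: "harmonic_section A g vol E T h nabla p q \<sigma>" and p: "0 \<le> p \<and> p \<le> 1"
    \<comment> \<open>The first summand of the identity is positive for \<open>p <= 1\<close>, so
      the second is negative; this also rules out \<open>p = 0\<close>.\<close>
    have "2 * n * (1 + (1 - p) * u) > 0"
      using n u p by (intro mult_pos_pos) (auto intro: add_pos_nonneg)
    then have "(p * a) * (1 + q * u / 2) < 0" using id[OF H] by linarith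
    then have neg: "1 + q * u / 2 < 0"
      using p a by (simp add: mult_less_0_iff)
    show "q < 0" by (rule larger(2)[OF neg])
    show "\<exists>x. sq_norm h \<sigma> x > - 2 / q" using larger(1)[OF neg] by blast
  next
    fix p q
    assume H: "harmonic_section A g vol E T h nabla p q \<sigma>" and pq: "p > 1 \<and> q < 2 * (1 - p)"
    have "1 + q * u / 2 < 0"
    proof (rule ccontr)
      assume nn: "\<not> 1 + q * u / 2 < 0"
      \<comment> \<open>The bound on \<open>q\<close> says q u / 2 < (1 - p) u, so a nonnegative
        bracket 1 + q u / 2 makes the other bracket strictly positive.\<close>
      have "q * u < 2 * ((1 - p) * u)"
        using mult_strict_right_mono[of q "2 * (1 - p)" u] pq u by (simp only: mult.assoc)
      then have "1 + (1 - p) * u > 0" using nn by linarith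
      then have "2 * n * (1 + (1 - p) * u) > 0" using n by simp
      moreover have "p * a * (1 + q * u / 2) \<ge> 0" using nn pq a by simp
      ultimately show False using id[OF H] by linarith
    qed
    from larger(1)[OF this] show "\<exists>x. sq_norm h \<sigma> x > - 2 / q" by blast
  next
    fix p q
    assume H: "harmonic_section A g vol E T h nabla p q \<sigma>" and pq: "p > 1 \<and> q \<ge> 2 * (1 - p)"
    show "\<exists>x. sq_norm h \<sigma> x > 1 / (p - 1)"
    proof (rule ccontr)
      assume "\<not> (\<exists>x. sq_norm h \<sigma> x > 1 / (p - 1))"
      then have le: "sq_norm h \<sigma> x' \<le> 1 / (p - 1)" for x' by (simp add: not_less)
      have nn: "1 + (1 - p) * u \<ge> 0" using le[of x] pq by (simp add: u_def[symmetric] field_simps)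
      \<comment> \<open>The bound on \<open>q\<close> now says q u / 2 >= (1 - p) u. Both summands
        of the identity are then nonnegative, hence zero.\<close>
      have "2 * ((1 - p) * u) \<le> q * u"
        using mult_right_mono[of "2 * (1 - p)" q u] pq u by (simp only: mult.assoc less_imp_le)
      then have "1 + q * u / 2 \<ge> 0" using nn by linarith
      then have "p * a * (1 + q * u / 2) \<ge> 0" using pq a by simp
      moreover have "2 * n * (1 + (1 - p) * u) \<ge> 0" using n nn by simp
      ultimately have "2 * n * (1 + (1 - p) * u) = 0" using id[OF H] by linarith
      then have "1 + (1 - p) * u = 0" using n by simp
      then have "u = 1 / (p - 1)" using pq by (simp add: field_simps)
      \<comment> \<open>The assumed global bound is attained at \<open>z\<close>, so the coordinate
        expression has an interior maximum there and its derivative vanishes.\<close>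
      then have "\<forall>y\<in>cimg c. (sq_norm h \<sigma> \<circ> cinv c) y \<le> (sq_norm h \<sigma> \<circ> cinv c) z"
        using le by (simp add: u_def x_def)
      then have "(\<lambda>v. v \<bullet> grad_in c (sq_norm h \<sigma>) z) = (\<lambda>v. 0)"
        using differential_zero_maxmin[OF z cimg_open[OF c] grad_in_has_derivative[OF smooth_sq_norm[OF \<sigma>] c z]]
        by blast
      from fun_cong[OF this, of "grad_in c (sq_norm h \<sigma>) z"] show False using nz by simp
    qed
  qed
qed

end
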